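(* Let $H$ be a weak bialgebra over the field $k$. For left $H$-modules $M,N$ let $\gamma=\gamma_{MN}\colon M\odot N\to M\diamond N$ be the map induced by the identity on $M\otimes N$, i.e. the composition of the inclusion $M\odot N=\Delta(1)(M\otimes N)\subset M\otimes N$ with the canonical surjection $M\otimes N\to M\diamond N$. Then the maps $\gamma_{MN}$ are isomorphisms and endow the identity functor with the structure of a monoidal functor $$(\mathrm{Id},\gamma)\colon({}_H\mathcal M,\diamond)\to({}_H\mathcal M,\odot),$$ where ${}_H\mathcal M$ is the category of left $H$-modules.
   Context: $k$ is a field; algebras (unital, associative), coalgebras, $\otimes$ are over $k$; Sweedler notation $\Delta(h)=h_{(1)}\otimes h_{(2)}$, and $1_{(1)}\otimes 1_{(2)}=\Delta(1)$. Weak bialgebra: an algebra and coalgebra $H$ with $\Delta(gh)=\Delta(g)\Delta(h)$ and, for all $f,g,h\in H$: $\epsilon(fgh)=\epsilon(fg_{(1)})\epsilon(g_{(2)}h)=\epsilon(fg_{(2)})\epsilon(g_{(1)}h)$, and $1_{(1)}\otimes1_{(2)}\otimes1_{(3)}=(\Delta(1)\otimes1)(1\otimes\Delta(1))=(1\otimes\Delta(1))(\Delta(1)\otimes1)$. Put $\epsilon_t(h)=\epsilon(1_{(1)}h)1_{(2)}$, $\epsilon_s'(h)=1_{(1)}\epsilon(1_{(2)}h)$; $R:=H_t:=\epsilon_t(H)$ is a subalgebra of $H$, the target counital subalgebra. For $r\in R$ write $\overline r:=\epsilon_s'(r)\in H$; $r\mapsto\overline r$ is an injective algebra anti-homomorphism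 $R\to H$ whose image commutes elementwise with $R$. Tensor product $\odot$: for left $H$-modules $M,N$, $M\odot N:=\Delta(1)(M\otimes N)\subset M\otimes N$ with the diagonal $H$-action $h(m\otimes n)=h_{(1)}m\otimes h_{(2)}n$. Tensor product $\diamond$ (that of modules over the $\times_R$-bialgebra associated to $H$): $M\diamond N:=M\otimes N/\langle\overline rm\otimes n-m\otimes rn\mid r\in R,m\in M,n\in N\rangle$, with the $H$-action $h(m\otimes n)=h_{(1)}m\otimes h_{(2)}n$ (well defined). The associativity constraints of both monoidal structures are induced by the usual associativity of $\otimes$. In both, the unit object is $R=H_t$ with action $h\cdot x=\epsilon_t(hx)$, with unit constraints induced by $x\otimes m\mapsto xm$ and $m\otimes x\mapsto\overline xm$ for $x\in R$. A monoidal functor structure on $\mathrm{Id}$ consists of natural $H$-linear isomorphisms $\gamma_{MN}\colon M\odot N\to M\diamond N$ compatible with the associativity (and unit) constraints, with the identity of $R$ as the comparison of unit objects. *)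

theory Defs
  imports "HOL-Algebra.Module" "HOL-Algebra.AbelCoset"
begin

section \<open>Vector spaces: linear maps, spans, quotients\<close>

text \<open>
  The ground field \<open>K\<close> is a ring record; vector spaces over it are records of type \<open>module\<close> of which
  only the fields \<open>carrier\<close>, \<open>zero\<close>, \<open>add\<close> and \<open>smult\<close> matter. The ring fields \<open>mult\<close> and \<open>one\<close> are
  used for algebras only and are left undefined in the constructions that do not yield algebras.
\<close>

definition linear_maps ::
  "('k, 'c) ring_scheme \<Rightarrow> ('k, 'm, 'x) module_scheme \<Rightarrow> ('k, 'n, 'y) module_scheme \<Rightarrow> ('m \<Rightarrow> 'n) set"
  where "linear_maps K M N = {f \<in> carrier M \<rightarrow> carrier N.
    (\<forall>x\<in>carrier M. \<forall>y\<in>carrier M. f (x \<oplus>\<^bsub>M\<^esub> y) = f x \<oplus>\<^bsub>N\<^esub> f y) \<and>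
    (\<forall>c\<in>carrier K. \<forall>x\<in>carrier M. f (c \<odot>\<^bsub>M\<^esub> x) = c \<odot>\<^bsub>N\<^esub> f x)}"

definition span_in ::
  "('k, 'c) ring_scheme \<Rightarrow> ('k, 'm, 'x) module_scheme \<Rightarrow> 'm set \<Rightarrow> 'm set"
  where "span_in K M X = \<Inter> {S. submodule S K M \<and> X \<subseteq> S}"

definition quotient_module ::
  "('k, 'm, 'x) module_scheme \<Rightarrow> 'm set \<Rightarrow> ('k, 'm set) module"
  where "quotient_module M S =
    \<lparr>carrier = a_rcosets\<^bsub>M\<^esub> S, mult = undefined, one = undefined, zero = S, add = set_add M,
     smult = (\<lambda>c X. \<Union>x\<in>X. S +>\<^bsub>M\<^esub> (c \<odot>\<^bsub>M\<^esub> x))\<rparr>"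

definition self_module :: "('k, 'c) ring_scheme \<Rightarrow> ('k, 'k) module"
  where "self_module K =
    \<lparr>carrier = carrier K, mult = mult K, one = one K, zero = zero K, add = add K, smult = mult K\<rparr>"

definition free_module :: "('k, 'c) ring_scheme \<Rightarrow> 'a set \<Rightarrow> ('k, 'a \<Rightarrow> 'k) module"
  where "free_module K A =
    \<lparr>carrier = {f. range f \<subseteq> carrier K \<and> finite {a. f a \<noteq> \<zero>\<^bsub>K\<^esub>} \<and> {a. f a \<noteq> \<zero>\<^bsub>K\<^esub>} \<subseteq> A},
     mult = undefined, one = undefined, zero = (\<lambda>_. \<zero>\<^bsub>K\<^esub>),
     add = (\<lambda>f g a. f a \<oplus>\<^bsub>K\<^esub> g a), smult = (\<lambda>c f a. c \<otimes>\<^bsub>K\<^esub> f a)\<rparr>"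

definition free_gen :: "('k, 'c) ring_scheme \<Rightarrow> 'a \<Rightarrow> 'a \<Rightarrow> 'k"
  where "free_gen K a = (\<lambda>b. if b = a then \<one>\<^bsub>K\<^esub> else \<zero>\<^bsub>K\<^esub>)"


section \<open>Tensor products over the ground field\<close>

type_synonym ('k, 'm, 'n) tensor = "('m \<times> 'n \<Rightarrow> 'k) set"

definition tensor_relations ::
  "('k, 'c) ring_scheme \<Rightarrow> ('k, 'm, 'x) module_scheme \<Rightarrow> ('k, 'n, 'y) module_scheme \<Rightarrow> ('m \<times> 'n \<Rightarrow> 'k) set"
  where "tensor_relations K M N =
    (let F = free_module K (carrier M \<times> carrier N); e = (\<lambda>m n. free_gen K (m, n)) in
      {e (m \<oplus>\<^bsub>M\<^esub> m') n \<ominus>\<^bsub>F\<^esub> (e m n \<oplus>\<^bsub>F\<^esub> e m' n) | m m' n.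
         m \<in> carrier M \<and> m' \<in> carrier M \<and> n \<in> carrier N} \<union>
      {e m (n \<oplus>\<^bsub>N\<^esub> n') \<ominus>\<^bsub>F\<^esub> (e m n \<oplus>\<^bsub>F\<^esub> e m n') | m n n'.
         m \<in> carrier M \<and> n \<in> carrier N \<and> n' \<in> carrier N} \<union>
      {e (c \<odot>\<^bsub>M\<^esub> m) n \<ominus>\<^bsub>F\<^esub> (c \<odot>\<^bsub>F\<^esub> e m n) | c m n.
         c \<in> carrier K \<and> m \<in> carrier M \<and> n \<in> carrier N} \<union>
      {e m (c \<odot>\<^bsub>N\<^esub> n) \<ominus>\<^bsub>F\<^esub> (c \<odot>\<^bsub>F\<^esub> e m n) | c m n.
         c \<in> carrier K \<and> m \<in> carrier M \<and> n \<in> carrier N})"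

definition tensor_kernel ::
  "('k, 'c) ring_scheme \<Rightarrow> ('k, 'm, 'x) module_scheme \<Rightarrow> ('k, 'n, 'y) module_scheme \<Rightarrow> ('m \<times> 'n \<Rightarrow> 'k) set"
  where "tensor_kernel K M N =
    span_in K (free_module K (carrier M \<times> carrier N)) (tensor_relations K M N)"

definition tensor ::
  "('k, 'c) ring_scheme \<Rightarrow> ('k, 'm, 'x) module_scheme \<Rightarrow> ('k, 'n, 'y) module_scheme
    \<Rightarrow> ('k, ('k, 'm, 'n) tensor) module"
  where "tensor K M N =
    quotient_module (free_module K (carrier M \<times> carrier N)) (tensor_kernel K M N)"

definition pure_tensor ::
  "('k, 'c) ring_scheme \<Rightarrow> ('k, 'm, 'x) module_scheme \<Rightarrow> ('k, 'n, 'y) module_scheme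
    \<Rightarrow> 'm \<Rightarrow> 'n \<Rightarrow> ('k, 'm, 'n) tensor"
  where "pure_tensor K M N m n =
    tensor_kernel K M N +>\<^bsub>free_module K (carrier M \<times> carrier N)\<^esub> free_gen K (m, n)"

text \<open>
  The linear map \<open>M \<otimes> N \<rightarrow> W\<close> induced by a bilinear map \<open>B\<close>, i.e. the map sending
  \<open>m \<otimes> n\<close> to \<open>B m n\<close>. For bilinear \<open>B\<close> all representatives \<open>f\<close> of a class \<open>t\<close> give the same sum.
  Sweedler notation is expressed with this map: \<open>tensor_lift K W B (comult H h)\<close> is
  \<open>B(h\<^sub>(\<^sub>1\<^sub>), h\<^sub>(\<^sub>2\<^sub>))\<close>.
\<close>

definition tensor_lift ::
  "('k, 'c) ring_scheme \<Rightarrow> ('k, 'w, 'z) module_scheme \<Rightarrow> ('m \<Rightarrow> 'n \<Rightarrow> 'w) \<Rightarrow> ('k, 'm, 'n) tensor \<Rightarrow> 'w"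
  where "tensor_lift K W B t = the_elem
    ((\<lambda>f. \<Oplus>\<^bsub>W\<^esub>p\<in>{p. f p \<noteq> \<zero>\<^bsub>K\<^esub>}. f p \<odot>\<^bsub>W\<^esub> B (fst p) (snd p)) ` t)"

text \<open>\<open>f \<otimes> g\<close>; the two module arguments are those of the codomain \<open>M' \<otimes> N'\<close>.\<close>

definition tensor_map ::
  "('k, 'c) ring_scheme \<Rightarrow> ('k, 'm2, 'x) module_scheme \<Rightarrow> ('k, 'n2, 'y) module_scheme
    \<Rightarrow> ('m \<Rightarrow> 'm2) \<Rightarrow> ('n \<Rightarrow> 'n2) \<Rightarrow> ('k, 'm, 'n) tensor \<Rightarrow> ('k, 'm2, 'n2) tensor"
  where "tensor_map K M' N' f g =
    tensor_lift K (tensor K M' N') (\<lambda>m n. pure_tensor K M' N' (f m) (g n))"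

definition tensor_assoc ::
  "('k, 'c) ring_scheme \<Rightarrow> ('k, 'm, 'x) module_scheme \<Rightarrow> ('k, 'n, 'y) module_scheme
    \<Rightarrow> ('k, 'p, 'z) module_scheme
    \<Rightarrow> ('k, ('k, 'm, 'n) tensor, 'p) tensor \<Rightarrow> ('k, 'm, ('k, 'n, 'p) tensor) tensor"
  where "tensor_assoc K M N P =
    (let W = tensor K M (tensor K N P) in
      tensor_lift K W (\<lambda>u p.
        tensor_lift K W (\<lambda>m n. pure_tensor K M (tensor K N P) m (pure_tensor K N P n p)) u))"

text \<open>
  If \<open>a\<close> and \<open>b\<close> act on \<open>M\<close> and on \<open>N\<close>, respectively, then
  \<open>(g \<otimes> h) \<cdot> (m \<otimes> n) = a g m \<otimes> b h n\<close>.
\<close>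

definition tensor_act ::
  "('k, 'c) ring_scheme \<Rightarrow> ('k, 'm, 'x) module_scheme \<Rightarrow> ('k, 'n, 'y) module_scheme
    \<Rightarrow> ('g \<Rightarrow> 'm \<Rightarrow> 'm) \<Rightarrow> ('h \<Rightarrow> 'n \<Rightarrow> 'n)
    \<Rightarrow> ('k, 'g, 'h) tensor \<Rightarrow> ('k, 'm, 'n) tensor \<Rightarrow> ('k, 'm, 'n) tensor"
  where "tensor_act K M N a b z t =
    tensor_lift K (tensor K M N) (\<lambda>g h. tensor_map K M N (a g) (b h) t) z"

definition tensor_algebra ::
  "('k, 'c) ring_scheme \<Rightarrow> ('k, 'a, 'x) module_scheme \<Rightarrow> ('k, 'b, 'y) module_scheme
    \<Rightarrow> ('k, ('k, 'a, 'b) tensor) module"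
  where "tensor_algebra K A B = (tensor K A B)
    \<lparr>mult := tensor_act K A B (mult A) (mult B), one := pure_tensor K A B \<one>\<^bsub>A\<^esub> \<one>\<^bsub>B\<^esub>\<rparr>"


section \<open>Weak bialgebras\<close>

text \<open>
  The library locale \<open>algebra\<close> is restricted to commutative algebras.
\<close>

locale k_algebra = module R M + field R + ring M for R (structure) and M (structure) +
  assumes smult_mult_left: "\<lbrakk>c \<in> carrier R; x \<in> carrier M; y \<in> carrier M\<rbrakk>
      \<Longrightarrow> (c \<odot>\<^bsub>M\<^esub> x) \<otimes>\<^bsub>M\<^esub> y = c \<odot>\<^bsub>M\<^esub> (x \<otimes>\<^bsub>M\<^esub> y)"
    and smult_mult_right: "\<lbrakk>c \<in> carrier R; x \<in> carrier M; y \<in> carrier M\<rbrakk>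
      \<Longrightarrow> x \<otimes>\<^bsub>M\<^esub> (c \<odot>\<^bsub>M\<^esub> y) = c \<odot>\<^bsub>M\<^esub> (x \<otimes>\<^bsub>M\<^esub> y)"

record ('k, 'h) bialg = "('k, 'h) module" +
  comult :: "'h \<Rightarrow> ('k, 'h, 'h) tensor"
  counit :: "'h \<Rightarrow> 'k"

text \<open>
  In \<open>comult_one\<close>, the three-fold tensor product is bracketed as \<open>H \<otimes> (H \<otimes> H)\<close>; the element
  \<open>\<Delta>(1) \<otimes> 1\<close> is transported there by associativity.
\<close>

locale weak_bialgebra = k_algebra K H
  for K :: "('k, 'c) ring_scheme" (structure) and H :: "('k, 'h, 'z) bialg_scheme" (structure) +
  assumes comult_linear: "comult H \<in> linear_maps K H (tensor K H H)"
    and counit_linear: "counit H \<in> linear_maps K H (self_module K)"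
    and coassoc: "h \<in> carrier H \<Longrightarrow>
      tensor_assoc K H H H (tensor_map K (tensor K H H) H (comult H) id (comult H h))
        = tensor_map K H (tensor K H H) id (comult H) (comult H h)"
    and counit_left: "h \<in> carrier H \<Longrightarrow>
      tensor_lift K H (\<lambda>a b. counit H a \<odot>\<^bsub>H\<^esub> b) (comult H h) = h"
    and counit_right: "h \<in> carrier H \<Longrightarrow>
      tensor_lift K H (\<lambda>a b. counit H b \<odot>\<^bsub>H\<^esub> a) (comult H h) = h"
    and comult_mult: "\<lbrakk>g \<in> carrier H; h \<in> carrier H\<rbrakk> \<Longrightarrow>
      comult H (g \<otimes>\<^bsub>H\<^esub> h) = comult H g \<otimes>\<^bsub>tensor_algebra K H H\<^esub> comult H h"
    and counit_mult1: "\<lbrakk>f \<in> carrier H; g \<in> carrier H; h \<in> carrier H\<rbrakk> \<Longrightarrow>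
      counit H (f \<otimes>\<^bsub>H\<^esub> g \<otimes>\<^bsub>H\<^esub> h) = tensor_lift K (self_module K)
        (\<lambda>a b. counit H (f \<otimes>\<^bsub>H\<^esub> a) \<otimes>\<^bsub>K\<^esub> counit H (b \<otimes>\<^bsub>H\<^esub> h)) (comult H g)"
    and counit_mult2: "\<lbrakk>f \<in> carrier H; g \<in> carrier H; h \<in> carrier H\<rbrakk> \<Longrightarrow>
      counit H (f \<otimes>\<^bsub>H\<^esub> g \<otimes>\<^bsub>H\<^esub> h) = tensor_lift K (self_module K)
        (\<lambda>a b. counit H (f \<otimes>\<^bsub>H\<^esub> b) \<otimes>\<^bsub>K\<^esub> counit H (a \<otimes>\<^bsub>H\<^esub> h)) (comult H g)"
    and comult_one:
      "let D = comult H \<one>\<^bsub>H\<^esub>;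
           HH = tensor_algebra K H H;
           X = tensor_assoc K H H H (pure_tensor K HH H D \<one>\<^bsub>H\<^esub>);
           Y = pure_tensor K H HH \<one>\<^bsub>H\<^esub> D
       in tensor_map K H HH id (comult H) D = X \<otimes>\<^bsub>tensor_algebra K H HH\<^esub> Y
        \<and> tensor_map K H HH id (comult H) D = Y \<otimes>\<^bsub>tensor_algebra K H HH\<^esub> X"

definition eps_t :: "('k, 'c) ring_scheme \<Rightarrow> ('k, 'h, 'z) bialg_scheme \<Rightarrow> 'h \<Rightarrow> 'h"
  where "eps_t K H h =
    tensor_lift K H (\<lambda>a b. counit H (a \<otimes>\<^bsub>H\<^esub> h) \<odot>\<^bsub>H\<^esub> b) (comult H \<one>\<^bsub>H\<^esub>)"

definition eps_s' :: "('k, 'c) ring_scheme \<Rightarrow> ('k, 'h, 'z) bialg_scheme \<Rightarrow> 'h \<Rightarrow> 'h"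
  where "eps_s' K H h =
    tensor_lift K H (\<lambda>a b. counit H (b \<otimes>\<^bsub>H\<^esub> h) \<odot>\<^bsub>H\<^esub> a) (comult H \<one>\<^bsub>H\<^esub>)"

definition target_subalgebra :: "('k, 'c) ring_scheme \<Rightarrow> ('k, 'h, 'z) bialg_scheme \<Rightarrow> 'h set"
  where "target_subalgebra K H = eps_t K H ` carrier H"


section \<open>Left modules\<close>

record ('k, 'h, 'm) hmodule = "('k, 'm) module" +
  act :: "'h \<Rightarrow> 'm \<Rightarrow> 'm"

locale left_module = k_algebra K H + module K M
  for K :: "('k, 'c) ring_scheme" (structure) and H :: "('k, 'h, 'z) module_scheme" (structure)
    and M :: "('k, 'h, 'm, 'y) hmodule_scheme" (structure) +
  assumes act_linear: "h \<in> carrier H \<Longrightarrow> act M h \<in> linear_maps K M M"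
    and act_add: "\<lbrakk>g \<in> carrier H; h \<in> carrier H; m \<in> carrier M\<rbrakk>
      \<Longrightarrow> act M (g \<oplus>\<^bsub>H\<^esub> h) m = act M g m \<oplus>\<^bsub>M\<^esub> act M h m"
    and act_smult: "\<lbrakk>c \<in> carrier K; h \<in> carrier H; m \<in> carrier M\<rbrakk>
      \<Longrightarrow> act M (c \<odot>\<^bsub>H\<^esub> h) m = c \<odot>\<^bsub>M\<^esub> act M h m"
    and act_mult: "\<lbrakk>g \<in> carrier H; h \<in> carrier H; m \<in> carrier M\<rbrakk>
      \<Longrightarrow> act M (g \<otimes>\<^bsub>H\<^esub> h) m = act M g (act M h m)"
    and act_one: "m \<in> carrier M \<Longrightarrow> act M \<one>\<^bsub>H\<^esub> m = m"

definition left_hom ::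
  "('k, 'c) ring_scheme \<Rightarrow> ('k, 'h, 'z) module_scheme \<Rightarrow> ('k, 'h, 'm, 'x) hmodule_scheme
    \<Rightarrow> ('k, 'h, 'n, 'y) hmodule_scheme \<Rightarrow> ('m \<Rightarrow> 'n) set"
  where "left_hom K H M N = {f. left_module K H M \<and> left_module K H N \<and> f \<in> linear_maps K M N \<and>
    (\<forall>h\<in>carrier H. \<forall>m\<in>carrier M. f (act M h m) = act N h (f m))}"

definition left_iso ::
  "('k, 'c) ring_scheme \<Rightarrow> ('k, 'h, 'z) module_scheme \<Rightarrow> ('k, 'h, 'm, 'x) hmodule_scheme
    \<Rightarrow> ('k, 'h, 'n, 'y) hmodule_scheme \<Rightarrow> ('m \<Rightarrow> 'n) set"
  where "left_iso K H M N = {f \<in> left_hom K H M N. bij_betw f (carrier M) (carrier N)}"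

definition with_act ::
  "('k, 'm, 'x) module_scheme \<Rightarrow> ('h \<Rightarrow> 'm \<Rightarrow> 'm) \<Rightarrow> ('k, 'h, 'm) hmodule"
  where "with_act M a =
    \<lparr>carrier = carrier M, mult = mult M, one = one M, zero = zero M, add = add M, smult = smult M,
     act = a\<rparr>"

definition unit_module :: "('k, 'c) ring_scheme \<Rightarrow> ('k, 'h, 'z) bialg_scheme \<Rightarrow> ('k, 'h, 'h) hmodule"
  where "unit_module K H =
    with_act (H\<lparr>carrier := target_subalgebra K H\<rparr>) (\<lambda>h x. eps_t K H (h \<otimes>\<^bsub>H\<^esub> x))"

definition diagonal_act ::
  "('k, 'c) ring_scheme \<Rightarrow> ('k, 'h, 'z) bialg_scheme \<Rightarrow> ('k, 'h, 'm, 'x) hmodule_scheme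
    \<Rightarrow> ('k, 'h, 'n, 'y) hmodule_scheme \<Rightarrow> 'h \<Rightarrow> ('k, 'm, 'n) tensor \<Rightarrow> ('k, 'm, 'n) tensor"
  where "diagonal_act K H M N h t = tensor_act K M N (act M) (act N) (comult H h) t"


section \<open>The monoidal structure given by \<open>\<Delta>(1)(M \<otimes> N)\<close>\<close>

definition odot ::
  "('k, 'c) ring_scheme \<Rightarrow> ('k, 'h, 'z) bialg_scheme \<Rightarrow> ('k, 'h, 'm, 'x) hmodule_scheme
    \<Rightarrow> ('k, 'h, 'n, 'y) hmodule_scheme \<Rightarrow> ('k, 'h, ('k, 'm, 'n) tensor) hmodule"
  where "odot K H M N = with_act
    ((tensor K M N)\<lparr>carrier := diagonal_act K H M N \<one>\<^bsub>H\<^esub> ` carrier (tensor K M N)\<rparr>)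
    (diagonal_act K H M N)"

text \<open>The restriction of \<open>f \<otimes> g\<close>; the module arguments are those of the codomain.\<close>

definition odot_map ::
  "('k, 'c) ring_scheme \<Rightarrow> ('k, 'h, 'm2, 'x) hmodule_scheme \<Rightarrow> ('k, 'h, 'n2, 'y) hmodule_scheme
    \<Rightarrow> ('m \<Rightarrow> 'm2) \<Rightarrow> ('n \<Rightarrow> 'n2) \<Rightarrow> ('k, 'm, 'n) tensor \<Rightarrow> ('k, 'm2, 'n2) tensor"
  where "odot_map K M' N' f g = tensor_map K M' N' f g"

text \<open>
  \<open>(M \<odot> N) \<odot> P\<close> and \<open>M \<odot> (N \<odot> P)\<close> are mapped into \<open>(M \<otimes> N) \<otimes> P\<close> and \<open>M \<otimes> (N \<otimes> P)\<close> by the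
  (injective) maps induced by the inclusions \<open>M \<odot> N \<subseteq> M \<otimes> N\<close> and \<open>N \<odot> P \<subseteq> N \<otimes> P\<close>; on
  representatives these maps are identities, but the classes differ since the tensor products are
  formed from different carriers.
\<close>

definition odot_assoc ::
  "('k, 'c) ring_scheme \<Rightarrow> ('k, 'h, 'z) bialg_scheme \<Rightarrow> ('k, 'h, 'm, 'x) hmodule_scheme
    \<Rightarrow> ('k, 'h, 'n, 'y) hmodule_scheme \<Rightarrow> ('k, 'h, 'p, 'w) hmodule_scheme
    \<Rightarrow> ('k, ('k, 'm, 'n) tensor, 'p) tensor \<Rightarrow> ('k, 'm, ('k, 'n, 'p) tensor) tensor"
  where "odot_assoc K H M N P t =
    (THE s. s \<in> carrier (odot K H M (odot K H N P)) \<and>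
      tensor_map K M (tensor K N P) id id s
        = tensor_assoc K M N P (tensor_map K (tensor K M N) P id id t))"

definition odot_lunit ::
  "('k, 'c) ring_scheme \<Rightarrow> ('k, 'h, 'm, 'x) hmodule_scheme \<Rightarrow> ('k, 'h, 'm) tensor \<Rightarrow> 'm"
  where "odot_lunit K M = tensor_lift K M (\<lambda>x m. act M x m)"

definition odot_runit ::
  "('k, 'c) ring_scheme \<Rightarrow> ('k, 'h, 'z) bialg_scheme \<Rightarrow> ('k, 'h, 'm, 'x) hmodule_scheme
    \<Rightarrow> ('k, 'm, 'h) tensor \<Rightarrow> 'm"
  where "odot_runit K H M = tensor_lift K M (\<lambda>m x. act M (eps_s' K H x) m)"


section \<open>The monoidal structure given by the tensor product over \<open>R\<close>\<close>

definition diamond_relations ::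
  "('k, 'c) ring_scheme \<Rightarrow> ('k, 'h, 'z) bialg_scheme \<Rightarrow> ('k, 'h, 'm, 'x) hmodule_scheme
    \<Rightarrow> ('k, 'h, 'n, 'y) hmodule_scheme \<Rightarrow> ('k, 'm, 'n) tensor set"
  where "diamond_relations K H M N = span_in K (tensor K M N)
    {pure_tensor K M N (act M (eps_s' K H r) m) n \<ominus>\<^bsub>tensor K M N\<^esub> pure_tensor K M N m (act N r n)
      | r m n. r \<in> target_subalgebra K H \<and> m \<in> carrier M \<and> n \<in> carrier N}"

definition diamond_proj ::
  "('k, 'c) ring_scheme \<Rightarrow> ('k, 'h, 'z) bialg_scheme \<Rightarrow> ('k, 'h, 'm, 'x) hmodule_scheme
    \<Rightarrow> ('k, 'h, 'n, 'y) hmodule_scheme \<Rightarrow> ('k, 'm, 'n) tensor \<Rightarrow> ('k, 'm, 'n) tensor set"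
  where "diamond_proj K H M N t = diamond_relations K H M N +>\<^bsub>tensor K M N\<^esub> t"

text \<open>
  Maps on the quotient are defined on a coset \<open>X\<close> as the common value at all its elements.
\<close>

definition diamond ::
  "('k, 'c) ring_scheme \<Rightarrow> ('k, 'h, 'z) bialg_scheme \<Rightarrow> ('k, 'h, 'm, 'x) hmodule_scheme
    \<Rightarrow> ('k, 'h, 'n, 'y) hmodule_scheme \<Rightarrow> ('k, 'h, ('k, 'm, 'n) tensor set) hmodule"
  where "diamond K H M N = with_act
    (quotient_module (tensor K M N) (diamond_relations K H M N))
    (\<lambda>h X. the_elem ((\<lambda>t. diamond_proj K H M N (diagonal_act K H M N h t)) ` X))"

definition diamond_map ::
  "('k, 'c) ring_scheme \<Rightarrow> ('k, 'h, 'z) bialg_scheme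
    \<Rightarrow> ('k, 'h, 'm2, 'x) hmodule_scheme \<Rightarrow> ('k, 'h, 'n2, 'y) hmodule_scheme
    \<Rightarrow> ('m \<Rightarrow> 'm2) \<Rightarrow> ('n \<Rightarrow> 'n2) \<Rightarrow> ('k, 'm, 'n) tensor set \<Rightarrow> ('k, 'm2, 'n2) tensor set"
  where "diamond_map K H M' N' f g X =
    the_elem ((\<lambda>t. diamond_proj K H M' N' (tensor_map K M' N' f g t)) ` X)"

text \<open>
  The value at the image in \<open>(M \<diamond> N) \<diamond> P\<close> of an element \<open>t\<close> of \<open>(M \<otimes> N) \<otimes> P\<close> is the image in
  \<open>M \<diamond> (N \<diamond> P)\<close> of the element of \<open>M \<otimes> (N \<otimes> P)\<close> corresponding to \<open>t\<close>.
\<close>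

definition diamond_assoc ::
  "('k, 'c) ring_scheme \<Rightarrow> ('k, 'h, 'z) bialg_scheme \<Rightarrow> ('k, 'h, 'm, 'x) hmodule_scheme
    \<Rightarrow> ('k, 'h, 'n, 'y) hmodule_scheme \<Rightarrow> ('k, 'h, 'p, 'w) hmodule_scheme
    \<Rightarrow> ('k, ('k, 'm, 'n) tensor set, 'p) tensor set \<Rightarrow> ('k, 'm, ('k, 'n, 'p) tensor set) tensor set"
  where "diamond_assoc K H M N P X =
    (THE Y. \<exists>t\<in>carrier (tensor K (tensor K M N) P).
      X = diamond_proj K H (diamond K H M N) P
            (tensor_map K (diamond K H M N) P (diamond_proj K H M N) id t) \<and>
      Y = diamond_proj K H M (diamond K H N P)
            (tensor_map K M (diamond K H N P) id (diamond_proj K H N P) (tensor_assoc K M N P t)))"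

definition diamond_lunit ::
  "('k, 'c) ring_scheme \<Rightarrow> ('k, 'h, 'm, 'x) hmodule_scheme \<Rightarrow> ('k, 'h, 'm) tensor set \<Rightarrow> 'm"
  where "diamond_lunit K M X =
    the_elem (tensor_lift K M (\<lambda>x m. act M x m) ` X)"

definition diamond_runit ::
  "('k, 'c) ring_scheme \<Rightarrow> ('k, 'h, 'z) bialg_scheme \<Rightarrow> ('k, 'h, 'm, 'x) hmodule_scheme
    \<Rightarrow> ('k, 'm, 'h) tensor set \<Rightarrow> 'm"
  where "diamond_runit K H M X =
    the_elem (tensor_lift K M (\<lambda>m x. act M (eps_s' K H x) m) ` X)"


section \<open>The comparison map\<close>

text \<open>
  The inclusion of \<open>M \<odot> N\<close> into \<open>M \<otimes> N\<close>, whose carrier contains that of \<open>M \<odot> N\<close>, followed by the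
  projection onto \<open>M \<diamond> N\<close>.
\<close>

definition gamma ::
  "('k, 'c) ring_scheme \<Rightarrow> ('k, 'h, 'z) bialg_scheme \<Rightarrow> ('k, 'h, 'm, 'x) hmodule_scheme
    \<Rightarrow> ('k, 'h, 'n, 'y) hmodule_scheme \<Rightarrow> ('k, 'm, 'n) tensor \<Rightarrow> ('k, 'm, 'n) tensor set"
  where "gamma K H M N t = diamond_proj K H M N t"

end

theory Submission
  imports Defs
begin

text \<open>
  Write \<open>E\<close> for the action of \<open>\<Delta>(1)\<close> on \<open>M \<otimes> N\<close>, an idempotent with image \<open>M \<odot> N\<close>. The point is that
  the kernel of \<open>E\<close> is the space \<open>D\<close> of relations defining \<open>M \<diamond> N\<close>.

  First, \<open>\<Delta>(u)\<close> kills \<open>D\<close>: since \<open>x \<epsilon>\<^sub>s'(h) = x\<^sub>1 \<epsilon>(x\<^sub>2 h)\<close> and \<open>x \<epsilon>\<^sub>t(h) = \<epsilon>(x\<^sub>1 h) x\<^sub>2\<close>, both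
  \<open>\<Delta>(u)(\<epsilon>\<^sub>s'(h) \<otimes> 1)\<close> and \<open>\<Delta>(u)(1 \<otimes> \<epsilon>\<^sub>t(h))\<close> are equal to \<open>u\<^sub>1 \<epsilon>(u\<^sub>2 h) \<otimes> u\<^sub>3\<close>, and
  \<open>\<epsilon>\<^sub>s'(\<epsilon>\<^sub>t(h)) = \<epsilon>\<^sub>s'(h)\<close>. Second, \<open>\<Delta>(1) = \<epsilon>\<^sub>s'(1\<^sub>1) \<otimes> 1\<^sub>2\<close>, so that modulo \<open>D\<close> the element
  \<open>E(m \<otimes> n)\<close> is \<open>m \<otimes> \<epsilon>\<^sub>t(1\<^sub>1) 1\<^sub>2 n = m \<otimes> n\<close>.

  Consequently the kernel of \<open>(M \<otimes> N) \<otimes> P \<rightarrow> (M \<diamond> N) \<diamond> P\<close> is the kernel of the action of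
  \<open>(\<Delta> \<otimes> id)(\<Delta>(1))\<close>, likewise for the other bracketing, and the two correspond by coassociativity.
\<close>

section \<open>Linear maps, spans and quotients\<close>

text \<open>Sweedler expressions are handled through the universal property: a term in
  \<open>h_1\<close>, \<open>h_2\<close> is a bilinear map lifted to the tensor product and
  evaluated at \<open>\<Delta>(h)\<close>, so each rewriting under the sum costs a proof of
  bilinearity. Many auxiliary lemmas exist to discharge these.

  The identity that carries the proof is stated for an arbitrary bilinear \<open>B\<close>:
  \<open>B(u_1 \<epsilon>\<^sub>s'(h), u_2) = B(u_1, u_2 \<epsilon>\<^sub>t(h))\<close>. For
  \<open>B\<close> given by the actions on \<open>m\<close> and \<open>n\<close>, and for all
  \<open>u\<close>, it makes the action on \<open>M \<diamond> N\<close> well defined; for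
  \<open>B\<close> built from the counit, it makes the unit constraints well defined on the
  quotient.

  The obstacle in the associativity is that \<open>M \<odot> N\<close>, \<open>M \<otimes> N\<close>
  and \<open>M \<diamond> N\<close> have different carriers, so iterated tensor products over them
  consist of different classes, and both constraints are definite descriptions. Existence and
  uniqueness come from \<open>E\<close>: it retracts \<open>M \<otimes> N\<close> onto
  \<open>M \<odot> N\<close>, it induces a section of the projection to
  \<open>M \<diamond> N\<close>, and the action of 1 on threefold products absorbs it.\<close>

lemma linear_mapsI:
  assumes "\<And>x. x \<in> carrier M \<Longrightarrow> f x \<in> carrier N"
    and "\<And>x y. \<lbrakk>x \<in> carrier M; y \<in> carrier M\<rbrakk> \<Longrightarrow> f (x \<oplus>\<^bsub>M\<^esub> y) = f x \<oplus>\<^bsub>N\<^esub> f y"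
    and "\<And>c x. \<lbrakk>c \<in> carrier K; x \<in> carrier M\<rbrakk> \<Longrightarrow> f (c \<odot>\<^bsub>M\<^esub> x) = c \<odot>\<^bsub>N\<^esub> f x"
  shows "f \<in> linear_maps K M N"
  using assms by (auto simp: linear_maps_def)

lemma linear_maps_closed: "\<lbrakk>f \<in> linear_maps K M N; x \<in> carrier M\<rbrakk> \<Longrightarrow> f x \<in> carrier N"
  by (auto simp: linear_maps_def)

lemma linear_maps_add:
  "\<lbrakk>f \<in> linear_maps K M N; x \<in> carrier M; y \<in> carrier M\<rbrakk> \<Longrightarrow> f (x \<oplus>\<^bsub>M\<^esub> y) = f x \<oplus>\<^bsub>N\<^esub> f y"
  by (auto simp: linear_maps_def)

lemma linear_maps_smult:
  "\<lbrakk>f \<in> linear_maps K M N; c \<in> carrier K; x \<in> carrier M\<rbrakk> \<Longrightarrow> f (c \<odot>\<^bsub>M\<^esub> x) = c \<odot>\<^bsub>N\<^esub> f x"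
  by (auto simp: linear_maps_def)

lemma linear_maps_comp:
  "\<lbrakk>f \<in> linear_maps K M N; g \<in> linear_maps K N P\<rbrakk> \<Longrightarrow> (\<lambda>x. g (f x)) \<in> linear_maps K M P"
  by (auto simp: linear_maps_def Pi_def)

text \<open>Functions need to agree on the carrier only. The module hypothesis makes the carrier
  closed, so that the agreement also covers sums and multiples.\<close>

lemma linear_maps_cong:
  assumes "g \<in> linear_maps K M N" "\<And>x. x \<in> carrier M \<Longrightarrow> f x = g x" "module K M"
  shows "f \<in> linear_maps K M N"
proof -
  interpret module K M by fact
  show ?thesis
    using assms(1) by (auto intro!: linear_mapsI simp: assms(2) linear_maps_closed linear_maps_add linear_maps_smult)
qed

lemma linear_maps_zero:
  assumes "module K M" "module K N" "f \<in> linear_maps K M N"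
  shows "f \<zero>\<^bsub>M\<^esub> = \<zero>\<^bsub>N\<^esub>"
proof -
  interpret M: module K M by fact
  interpret N: module K N by fact
  have "f \<zero>\<^bsub>M\<^esub> = f (\<zero>\<^bsub>K\<^esub> \<odot>\<^bsub>M\<^esub> \<zero>\<^bsub>M\<^esub>)" by simp
  also have "\<dots> = \<zero>\<^bsub>K\<^esub> \<odot>\<^bsub>N\<^esub> f \<zero>\<^bsub>M\<^esub>"
    by (rule linear_maps_smult[OF assms(3)]) auto
  finally show ?thesis using linear_maps_closed[OF assms(3)] by simp
qed

lemma linear_maps_minus:
  assumes "module K M" "module K N" "f \<in> linear_maps K M N" "x \<in> carrier M" "y \<in> carrier M"
  shows "f (x \<ominus>\<^bsub>M\<^esub> y) = f x \<ominus>\<^bsub>N\<^esub> f y"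
proof -
  interpret M: module K M by fact
  interpret N: module K N by fact
  \<comment> \<open>Subtraction becomes addition of the multiple by -1, an expression that
    \<open>f\<close> preserves by definition.\<close>
  have "f (x \<ominus>\<^bsub>M\<^esub> y) = f (x \<oplus>\<^bsub>M\<^esub> (\<ominus>\<^bsub>K\<^esub> \<one>\<^bsub>K\<^esub>) \<odot>\<^bsub>M\<^esub> y)"
    using assms(4,5) by (simp add: M.smult_l_minus M.minus_eq)
  also have "\<dots> = f x \<oplus>\<^bsub>N\<^esub> (\<ominus>\<^bsub>K\<^esub> \<one>\<^bsub>K\<^esub>) \<odot>\<^bsub>N\<^esub> f y"
    using assms(4,5) by (simp add: linear_maps_add[OF assms(3)] linear_maps_smult[OF assms(3)])
  also have "\<dots> = f x \<ominus>\<^bsub>N\<^esub> f y"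
    using linear_maps_closed[OF assms(3)] assms(4,5) by (simp add: N.smult_l_minus N.minus_eq)
  finally show ?thesis .
qed

lemma (in module) minus_eq_zeroD:
  assumes "x \<in> carrier M" "y \<in> carrier M" "x \<ominus>\<^bsub>M\<^esub> y = \<zero>\<^bsub>M\<^esub>"
  shows "x = y"
proof -
  have "x = (x \<ominus>\<^bsub>M\<^esub> y) \<oplus>\<^bsub>M\<^esub> y"
    using assms(1,2) by (simp add: M.minus_eq M.a_assoc M.l_neg)
  then show ?thesis using assms by simp
qed

lemma kernel_submodule:
  assumes "module K M" "module K N" "f \<in> linear_maps K M N"
  shows "submodule {x \<in> carrier M. f x = \<zero>\<^bsub>N\<^esub>} K M"
proof -
  interpret M: module K M by fact
  interpret N: module K N by fact
  have "f (\<ominus>\<^bsub>M\<^esub> x) = \<zero>\<^bsub>N\<^esub>" if "x \<in> carrier M" "f x = \<zero>\<^bsub>N\<^esub>" for x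
    using linear_maps_minus[OF assms, of "\<zero>\<^bsub>M\<^esub>" x] that linear_maps_zero[OF assms]
    by (simp add: M.minus_eq N.minus_eq)
  then show ?thesis
    by (intro M.submoduleI)
      (auto simp: linear_maps_zero[OF assms] linear_maps_add[OF assms(3)] linear_maps_smult[OF assms(3)])
qed

lemma span_in_superset: "X \<subseteq> span_in K M X"
  by (auto simp: span_in_def)

lemma span_in_least: "\<lbrakk>submodule S K M; X \<subseteq> S\<rbrakk> \<Longrightarrow> span_in K M X \<subseteq> S"
  by (auto simp: span_in_def)

lemma span_in_submodule:
  assumes "module K M" "X \<subseteq> carrier M"
  shows "submodule (span_in K M X) K M"
proof -
  interpret module K M by fact
  have Z: "\<zero>\<^bsub>M\<^esub> \<in> S" if "submodule S K M" for S
    using subgroup.one_closed[OF submodule.axioms(1)[OF that]] by simp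
  show ?thesis
  proof (rule submoduleI)
    show "span_in K M X \<subseteq> carrier M"
      by (rule span_in_least[OF carrier_is_submodule assms(2)])
  qed (simp_all add: span_in_def Z submoduleE(3-5))
qed

text \<open>The kernel is one of the submodules whose intersection is the span. Vanishing on a space
  of relations is thereby reduced to its generators.\<close>

lemma span_in_kernel:
  assumes "module K M" "module K N" "f \<in> linear_maps K M N" "X \<subseteq> carrier M"
    and "\<And>x. x \<in> X \<Longrightarrow> f x = \<zero>\<^bsub>N\<^esub>" and "y \<in> span_in K M X"
  shows "f y = \<zero>\<^bsub>N\<^esub>"
  using span_in_least[OF kernel_submodule[OF assms(1-3)], of X] assms(4-6) by auto

text \<open>Joins the coset theory of additive subgroups to the scalar action. It is used for both
  layers of quotients: the free module modulo \<open>tensor_kernel\<close>, and the tensor product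
  modulo \<open>diamond_relations\<close>.\<close>

locale quotient = module K M + submodule S K M
  for K (structure) and M (structure) and S
begin

sublocale abelian_subgroup S M
  by (rule abelian_subgroupI3[OF additive_subgroupI[OF subgroup_axioms] M.abelian_group_axioms])

lemma coset_eq_iff:
  assumes "x \<in> carrier M" "y \<in> carrier M"
  shows "S +>\<^bsub>M\<^esub> x = S +>\<^bsub>M\<^esub> y \<longleftrightarrow> x \<ominus>\<^bsub>M\<^esub> y \<in> S"
proof -
  have "x \<ominus>\<^bsub>M\<^esub> y \<in> S \<longleftrightarrow> x \<in> S +>\<^bsub>M\<^esub> y"
    using a_rcos_module[OF assms(2,1)] by (simp add: M.minus_eq)
  then show ?thesis
    using a_rcos_self[OF assms(1)] a_repr_independence'[OF _ assms(2), of x] by metis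
qed

lemma carrier_quotient: "carrier (quotient_module M S) = (\<lambda>x. S +>\<^bsub>M\<^esub> x) ` carrier M"
  by (auto simp: quotient_module_def A_RCOSETS_def')

lemma mem_cosetD:
  assumes "x \<in> carrier M" "y \<in> S +>\<^bsub>M\<^esub> x"
  shows "y \<in> carrier M \<and> S +>\<^bsub>M\<^esub> y = S +>\<^bsub>M\<^esub> x"
  using a_elemrcos_carrier[OF assms] a_repr_independence'[OF assms(2,1)] by simp

lemma add_quotient:
  "\<lbrakk>x \<in> carrier M; y \<in> carrier M\<rbrakk> \<Longrightarrow>
    (S +>\<^bsub>M\<^esub> x) \<oplus>\<^bsub>quotient_module M S\<^esub> (S +>\<^bsub>M\<^esub> y) = S +>\<^bsub>M\<^esub> (x \<oplus>\<^bsub>M\<^esub> y)"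
  by (simp add: quotient_module_def a_rcos_sum)

text \<open>\<open>quotient_module\<close> takes a union over all representatives. It is a single
  coset because two representatives differ by an element of \<open>S\<close>, and so do their
  multiples by \<open>c\<close>.\<close>

lemma smult_quotient:
  assumes "c \<in> carrier K" "x \<in> carrier M"
  shows "c \<odot>\<^bsub>quotient_module M S\<^esub> (S +>\<^bsub>M\<^esub> x) = S +>\<^bsub>M\<^esub> (c \<odot>\<^bsub>M\<^esub> x)"
proof -
  have "S +>\<^bsub>M\<^esub> (c \<odot>\<^bsub>M\<^esub> y) = S +>\<^bsub>M\<^esub> (c \<odot>\<^bsub>M\<^esub> x)" if "y \<in> S +>\<^bsub>M\<^esub> x" for y
  proof -
    have y: "y \<in> carrier M" "y \<ominus>\<^bsub>M\<^esub> x \<in> S"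
      using mem_cosetD[OF assms(2) that] coset_eq_iff[OF _ assms(2), of y] by blast+
    have "c \<odot>\<^bsub>M\<^esub> y \<ominus>\<^bsub>M\<^esub> c \<odot>\<^bsub>M\<^esub> x = c \<odot>\<^bsub>M\<^esub> (y \<ominus>\<^bsub>M\<^esub> x)"
      using assms y by (simp add: M.minus_eq smult_r_distr smult_r_minus)
    then show ?thesis using assms y by (subst coset_eq_iff) auto
  qed
  moreover have "x \<in> S +>\<^bsub>M\<^esub> x" by (rule a_rcos_self) (rule assms)
  ultimately have "(\<Union>y\<in>S +>\<^bsub>M\<^esub> x. S +>\<^bsub>M\<^esub> (c \<odot>\<^bsub>M\<^esub> y)) = S +>\<^bsub>M\<^esub> (c \<odot>\<^bsub>M\<^esub> x)"
    by blast
  then show ?thesis by (simp add: quotient_module_def)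
qed

lemma zero_quotient: "\<zero>\<^bsub>quotient_module M S\<^esub> = S +>\<^bsub>M\<^esub> \<zero>\<^bsub>M\<^esub>"
  using a_subset by (simp add: quotient_module_def)

lemma module_quotient: "module K (quotient_module M S)"
proof (rule moduleI[OF R.cring_axioms])
  show "abelian_group (quotient_module M S)"
  proof (rule abelian_groupI)
    fix X assume "X \<in> carrier (quotient_module M S)"
    then obtain x where x: "x \<in> carrier M" "X = S +>\<^bsub>M\<^esub> x"
      by (auto simp: carrier_quotient)
    then have "(S +>\<^bsub>M\<^esub> (\<ominus>\<^bsub>M\<^esub> x)) \<oplus>\<^bsub>quotient_module M S\<^esub> X = \<zero>\<^bsub>quotient_module M S\<^esub>"
      using a_subset by (simp add: add_quotient zero_quotient M.l_neg)
    then show "\<exists>y\<in>carrier (quotient_module M S). y \<oplus>\<^bsub>quotient_module M S\<^esub> X = \<zero>\<^bsub>quotient_module M S\<^esub>"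
      using x by (auto simp: carrier_quotient)
  next fix x y assume "x \<in> carrier (quotient_module M S)" "y \<in> carrier (quotient_module M S)"
    then show "x \<oplus>\<^bsub>quotient_module M S\<^esub> y = y \<oplus>\<^bsub>quotient_module M S\<^esub> x" 
    by (auto simp: carrier_quotient add_quotient M.a_comm)
  qed (auto simp: carrier_quotient add_quotient zero_quotient M.a_assoc simp del: a_coset_add_zero)
qed (auto simp: carrier_quotient add_quotient smult_quotient smult_l_distr smult_r_distr smult_assoc1)

lemma proj_linear: "(\<lambda>x. S +>\<^bsub>M\<^esub> x) \<in> linear_maps K M (quotient_module M S)"
  by (rule linear_mapsI) (auto simp: carrier_quotient add_quotient smult_quotient)

text \<open>A linear map that vanishes on \<open>S\<close> is constant on each coset, so its image
  of a coset is a singleton. This is what gives meaning to every \<open>the_elem\<close> in the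
  definitions: \<open>tensor_lift\<close>, the action on \<open>diamond\<close>,
  \<open>diamond_map\<close> and the unit constraints.\<close>

lemma the_elem_coset:
  assumes "module K W" "f \<in> linear_maps K M W" "\<And>y. y \<in> S \<Longrightarrow> f y = \<zero>\<^bsub>W\<^esub>" "x \<in> carrier M"
  shows "the_elem (f ` (S +>\<^bsub>M\<^esub> x)) = f x"
proof -
  interpret W: module K W by fact
  have "f y = f x" if "y \<in> S +>\<^bsub>M\<^esub> x" for y
  proof -
    have y: "y \<in> carrier M" "y \<ominus>\<^bsub>M\<^esub> x \<in> S"
      using mem_cosetD[OF assms(4) that] coset_eq_iff[OF _ assms(4), of y] by blast+
    have "f y \<ominus>\<^bsub>W\<^esub> f x = \<zero>\<^bsub>W\<^esub>"
      using linear_maps_minus[OF module_axioms assms(1,2) y(1) assms(4)] assms(3)[OF y(2)] by simp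
    then show ?thesis
      by (rule W.minus_eq_zeroD[OF linear_maps_closed[OF assms(2) y(1)] linear_maps_closed[OF assms(2,4)]])
  qed
  moreover have "x \<in> S +>\<^bsub>M\<^esub> x" by (rule a_rcos_self) (rule assms)
  ultimately have "f ` (S +>\<^bsub>M\<^esub> x) = {f x}" by blast
  then show ?thesis by simp
qed

lemma the_elem_linear:
  assumes "module K W" "f \<in> linear_maps K M W" "\<And>y. y \<in> S \<Longrightarrow> f y = \<zero>\<^bsub>W\<^esub>"
  shows "(\<lambda>X. the_elem (f ` X)) \<in> linear_maps K (quotient_module M S) W"
proof (rule linear_mapsI)
  fix X assume "X \<in> carrier (quotient_module M S)"
  then obtain x where x: "x \<in> carrier M" "X = S +>\<^bsub>M\<^esub> x" by (auto simp: carrier_quotient)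
  then show "the_elem (f ` X) \<in> carrier W"
    using the_elem_coset[OF assms] linear_maps_closed[OF assms(2)] by simp
  fix c assume "c \<in> carrier K"
  then show "the_elem (f ` (c \<odot>\<^bsub>quotient_module M S\<^esub> X)) = c \<odot>\<^bsub>W\<^esub> the_elem (f ` X)"
    using x by (simp add: smult_quotient the_elem_coset[OF assms] linear_maps_smult[OF assms(2)])
next
  fix X Y assume "X \<in> carrier (quotient_module M S)" "Y \<in> carrier (quotient_module M S)"
  then obtain x y where "x \<in> carrier M" "X = S +>\<^bsub>M\<^esub> x" "y \<in> carrier M" "Y = S +>\<^bsub>M\<^esub> y"
    by (auto simp: carrier_quotient)
  then show "the_elem (f ` (X \<oplus>\<^bsub>quotient_module M S\<^esub> Y)) = the_elem (f ` X) \<oplus>\<^bsub>W\<^esub> the_elem (f ` Y)"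
    by (simp add: add_quotient the_elem_coset[OF assms] linear_maps_add[OF assms(2)])
qed

end

section \<open>Free modules\<close>

lemma mem_free_module:
  "f \<in> carrier (free_module K A) \<longleftrightarrow>
    (\<forall>a. f a \<in> carrier K) \<and> finite {a. f a \<noteq> \<zero>\<^bsub>K\<^esub>} \<and> (\<forall>a. f a \<noteq> \<zero>\<^bsub>K\<^esub> \<longrightarrow> a \<in> A)"
  by (auto simp: free_module_def)

lemma free_module_simps:
  "\<zero>\<^bsub>free_module K A\<^esub> = (\<lambda>_. \<zero>\<^bsub>K\<^esub>)"
  "f \<oplus>\<^bsub>free_module K A\<^esub> g = (\<lambda>a. f a \<oplus>\<^bsub>K\<^esub> g a)"
  "c \<odot>\<^bsub>free_module K A\<^esub> f = (\<lambda>a. c \<otimes>\<^bsub>K\<^esub> f a)"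
  by (auto simp: free_module_def)

text \<open>The sum inside \<open>tensor_lift\<close>, separated from \<open>the_elem\<close> so
  that its linearity can be established on the free module before passing to classes.\<close>

definition free_lift ::
  "('k, 'c) ring_scheme \<Rightarrow> ('k, 'w, 'z) module_scheme \<Rightarrow> ('a \<Rightarrow> 'w) \<Rightarrow> ('a \<Rightarrow> 'k) \<Rightarrow> 'w"
  where "free_lift K W \<phi> f = (\<Oplus>\<^bsub>W\<^esub>p\<in>{p. f p \<noteq> \<zero>\<^bsub>K\<^esub>}. f p \<odot>\<^bsub>W\<^esub> \<phi> p)"

context cring
begin

lemma free_module_add_closed:
  assumes "f \<in> carrier (free_module R A)" "g \<in> carrier (free_module R A)"
  shows "f \<oplus>\<^bsub>free_module R A\<^esub> g \<in> carrier (free_module R A)"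
proof -
  have sub: "{a. f a \<oplus> g a \<noteq> \<zero>} \<subseteq> {a. f a \<noteq> \<zero>} \<union> {a. g a \<noteq> \<zero>}" by auto
  have "finite ({a. f a \<noteq> \<zero>} \<union> {a. g a \<noteq> \<zero>})" "{a. f a \<noteq> \<zero>} \<union> {a. g a \<noteq> \<zero>} \<subseteq> A"
    using assms by (auto simp: mem_free_module)
  then have "finite {a. f a \<oplus> g a \<noteq> \<zero>}" "{a. f a \<oplus> g a \<noteq> \<zero>} \<subseteq> A"
    using finite_subset[OF sub] sub by blast+
  then show ?thesis
    using assms unfolding mem_free_module free_module_simps by blast
qed

lemma free_module_mult_closed:
  assumes "c \<in> carrier R" "f \<in> carrier (free_module R A)"
  shows "(\<lambda>a. c \<otimes> f a) \<in> carrier (free_module R A)"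
proof -
  have sub: "{a. c \<otimes> f a \<noteq> \<zero>} \<subseteq> {a. f a \<noteq> \<zero>}" using assms(1) by auto
  have "finite {a. f a \<noteq> \<zero>}" "{a. f a \<noteq> \<zero>} \<subseteq> A"
    using assms(2) by (auto simp: mem_free_module)
  then have "finite {a. c \<otimes> f a \<noteq> \<zero>}" "{a. c \<otimes> f a \<noteq> \<zero>} \<subseteq> A"
    using finite_subset[OF sub] sub by blast+
  then show ?thesis
    using assms unfolding mem_free_module by blast
qed

lemma module_free_module: "module R (free_module R A)"
proof (rule moduleI[OF cring_axioms])
  note mem = mem_free_module[THEN iffD1, THEN conjunct1, rule_format]
  show "abelian_group (free_module R A)"
  proof (rule abelian_groupI)
    fix f assume f: "f \<in> carrier (free_module R A)"
    \<comment> \<open>The additive inverse is taken to be the multiple by -1, whose support is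
      already known to be finite.\<close>
    have "(\<ominus> \<one>) \<otimes> f a \<oplus> f a = \<zero>" for a
      using mem[OF f, of a] by (simp add: l_minus l_neg)
    then show "\<exists>g\<in>carrier (free_module R A). g \<oplus>\<^bsub>free_module R A\<^esub> f = \<zero>\<^bsub>free_module R A\<^esub>"
      by (intro bexI[OF _ free_module_mult_closed[OF _ f, of "\<ominus> \<one>"]]) (simp_all add: free_module_simps)
  qed (simp_all add: free_module_add_closed, simp_all add: free_module_simps mem_free_module a_ac)
qed (simp_all add: free_module_simps(3) free_module_mult_closed,
  simp_all add: free_module_simps mem_free_module l_distr r_distr m_assoc)

lemma free_gen_closed: "a \<in> A \<Longrightarrow> free_gen R a \<in> carrier (free_module R A)"
  by (auto simp: mem_free_module free_gen_def intro: finite_subset[of _ "{a}"])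

text \<open>Induction on a finite set that contains the support. At a point where \<open>f\<close>
  is nonzero, its coefficient is split off as a multiple of a generator; elsewhere the smaller set
  already contains the support.\<close>

lemma free_module_induct [consumes 1, case_names zero add]:
  assumes f: "f \<in> carrier (free_module R A)"
    and zero: "P \<zero>\<^bsub>free_module R A\<^esub>"
    and step: "\<And>g c a. \<lbrakk>g \<in> carrier (free_module R A); P g; c \<in> carrier R; a \<in> A\<rbrakk> \<Longrightarrow>
      P (g \<oplus>\<^bsub>free_module R A\<^esub> c \<odot>\<^bsub>free_module R A\<^esub> free_gen R a)"
  shows "P f"
proof -
  have "P f" if "finite S" "f \<in> carrier (free_module R A)" "{a. f a \<noteq> \<zero>} \<subseteq> S" for S f
    using that
  proof (induction S arbitrary: f rule: finite_induct)
    case empty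
    then have "f = \<zero>\<^bsub>free_module R A\<^esub>" by (auto simp: free_module_simps)
    then show ?case using zero by simp
  next
    case (insert a S)
    show ?case
    proof (cases "f a = \<zero>")
      case True
      then show ?thesis using insert by (intro insert.IH) auto
    next
      case False
      define g where "g = f(a := \<zero>)"
      have a: "a \<in> A" "f a \<in> carrier R" using False insert.prems by (auto simp: mem_free_module)
      have g: "g \<in> carrier (free_module R A)"
        using insert.prems by (auto simp: mem_free_module g_def intro: finite_subset[of _ "{a. f a \<noteq> \<zero>}"])
      have "P g" using insert.prems by (intro insert.IH[OF g]) (auto simp: g_def)
      then have "P (g \<oplus>\<^bsub>free_module R A\<^esub> f a \<odot>\<^bsub>free_module R A\<^esub> free_gen R a)"
        by (rule step[OF g _ a(2,1)])
      also have "g \<oplus>\<^bsub>free_module R A\<^esub> f a \<odot>\<^bsub>free_module R A\<^esub> free_gen R a = f"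
        using insert.prems by (auto simp: mem_free_module g_def free_module_simps free_gen_def)
      finally show ?thesis .
    qed
  qed
  then show ?thesis using f by (auto simp: mem_free_module)
qed

end

context module
begin

text \<open>Indices outside the support contribute zero. A larger index set is allowed so that
  \<open>f\<close>, \<open>g\<close> and their sum can be summed over a common set.\<close>

lemma free_lift_superset:
  assumes "f \<in> carrier (free_module R A)" "\<And>a. a \<in> A \<Longrightarrow> \<phi> a \<in> carrier M"
    "finite S" "{a. f a \<noteq> \<zero>} \<subseteq> S" "S \<subseteq> A"
  shows "free_lift R M \<phi> f = (\<Oplus>\<^bsub>M\<^esub>p\<in>S. f p \<odot>\<^bsub>M\<^esub> \<phi> p)"
  unfolding free_lift_def
  using assms by (intro M.add.finprod_mono_neutral_cong_left) (auto simp: mem_free_module)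

lemma free_lift_linear:
  assumes \<phi>: "\<And>a. a \<in> A \<Longrightarrow> \<phi> a \<in> carrier M"
  shows "free_lift R M \<phi> \<in> linear_maps R (free_module R A) M"
proof (rule linear_mapsI)
  fix f assume "f \<in> carrier (free_module R A)"
  then show "free_lift R M \<phi> f \<in> carrier M"
    unfolding free_lift_def using \<phi> by (intro M.finsum_closed) (auto simp: mem_free_module)
next
  fix f g assume fg: "f \<in> carrier (free_module R A)" "g \<in> carrier (free_module R A)"
  let ?S = "{a. f a \<noteq> \<zero>} \<union> {a. g a \<noteq> \<zero>}"
  have S: "finite ?S" "?S \<subseteq> A" using fg by (auto simp: mem_free_module)
  have c: "\<And>a. f a \<in> carrier R" "\<And>a. g a \<in> carrier R" using fg by (auto simp: mem_free_module)
  have fg': "f \<oplus>\<^bsub>free_module R A\<^esub> g \<in> carrier (free_module R A)"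
    using fg by (rule abelian_monoid.a_closed[OF abelian_group.axioms(1)[OF module.axioms(2)[OF module_free_module]]])
  have fgS: "{a. (f \<oplus>\<^bsub>free_module R A\<^esub> g) a \<noteq> \<zero>} \<subseteq> ?S"
    by (auto simp: free_module_simps)
  have "free_lift R M \<phi> (f \<oplus>\<^bsub>free_module R A\<^esub> g) = (\<Oplus>\<^bsub>M\<^esub>p\<in>?S. f p \<odot>\<^bsub>M\<^esub> \<phi> p \<oplus>\<^bsub>M\<^esub> g p \<odot>\<^bsub>M\<^esub> \<phi> p)"
    using S c \<phi> by (intro trans[OF free_lift_superset[OF fg' \<phi> S(1) fgS S(2)] M.finsum_cong']) (auto simp: free_module_simps smult_l_distr subset_iff)
  also have "\<dots> = free_lift R M \<phi> f \<oplus>\<^bsub>M\<^esub> free_lift R M \<phi> g"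
    using S c \<phi> by (subst M.finsum_addf)
      (auto simp: free_lift_superset[OF fg(1) \<phi> S(1) _ S(2)] free_lift_superset[OF fg(2) \<phi> S(1) _ S(2)])
  finally show "free_lift R M \<phi> (f \<oplus>\<^bsub>free_module R A\<^esub> g) = free_lift R M \<phi> f \<oplus>\<^bsub>M\<^esub> free_lift R M \<phi> g" .
next
  fix k f assume k: "k \<in> carrier R" and f: "f \<in> carrier (free_module R A)"
  let ?S = "{a. f a \<noteq> \<zero>}"
  have S: "finite ?S" "?S \<subseteq> A" using f by (auto simp: mem_free_module)
  have c: "\<And>a. f a \<in> carrier R" using f by (auto simp: mem_free_module)
  have kf: "k \<odot>\<^bsub>free_module R A\<^esub> f \<in> carrier (free_module R A)"
    by (rule module.smult_closed[OF module_free_module k f])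
  have kfS: "{a. (k \<odot>\<^bsub>free_module R A\<^esub> f) a \<noteq> \<zero>} \<subseteq> ?S"
    using k by (auto simp: free_module_simps)
  have "free_lift R M \<phi> (k \<odot>\<^bsub>free_module R A\<^esub> f) = (\<Oplus>\<^bsub>M\<^esub>p\<in>?S. k \<odot>\<^bsub>M\<^esub> (f p \<odot>\<^bsub>M\<^esub> \<phi> p))"
    using S c k \<phi> by (intro trans[OF free_lift_superset[OF kf \<phi> S(1) kfS S(2)] M.finsum_cong']) (auto simp: free_module_simps smult_assoc1 subset_iff)
  also have "\<dots> = k \<odot>\<^bsub>M\<^esub> free_lift R M \<phi> f"
    unfolding free_lift_def using S c k \<phi> by (subst finsum_smult_ldistr) auto
  finally show "free_lift R M \<phi> (k \<odot>\<^bsub>free_module R A\<^esub> f) = k \<odot>\<^bsub>M\<^esub> free_lift R M \<phi> f" .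
qed

text \<open>Summing over \<open>{a}\<close> rather than over the support also covers the zero ring,
  where the support of the generator is empty.\<close>

lemma free_lift_gen:
  assumes "a \<in> A" "\<And>a. a \<in> A \<Longrightarrow> \<phi> a \<in> carrier M"
  shows "free_lift R M \<phi> (free_gen R a) = \<phi> a"
  using assms by (subst free_lift_superset[OF free_gen_closed[OF assms(1)] assms(2), where S = "{a}"])
    (auto simp: free_gen_def)

end

section \<open>Bilinear maps and tensor products\<close>

text \<open>Linearity in each variable separately, so that \<open>bilinI\<close> splits a goal into
  goals about linear maps, which the closure rules for composite expressions solve.\<close>

definition bilin ::
  "('k, 'c) ring_scheme \<Rightarrow> ('k, 'm, 'x) module_scheme \<Rightarrow> ('k, 'n, 'y) module_scheme
    \<Rightarrow> ('k, 'w, 'z) module_scheme \<Rightarrow> ('m \<Rightarrow> 'n \<Rightarrow> 'w) \<Rightarrow> bool"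
  where "bilin K M N W B \<longleftrightarrow>
    (\<forall>m\<in>carrier M. (\<lambda>n. B m n) \<in> linear_maps K N W) \<and>
    (\<forall>n\<in>carrier N. (\<lambda>m. B m n) \<in> linear_maps K M W)"

lemma bilinI:
  assumes "\<And>m. m \<in> carrier M \<Longrightarrow> (\<lambda>n. B m n) \<in> linear_maps K N W"
    and "\<And>n. n \<in> carrier N \<Longrightarrow> (\<lambda>m. B m n) \<in> linear_maps K M W"
  shows "bilin K M N W B"
  using assms by (auto simp: bilin_def)

lemma bilin_left: "\<lbrakk>bilin K M N W B; n \<in> carrier N\<rbrakk> \<Longrightarrow> (\<lambda>m. B m n) \<in> linear_maps K M W"
  by (auto simp: bilin_def)

lemma bilin_right: "\<lbrakk>bilin K M N W B; m \<in> carrier M\<rbrakk> \<Longrightarrow> (\<lambda>n. B m n) \<in> linear_maps K N W"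
  by (auto simp: bilin_def)

lemma bilin_closed: "\<lbrakk>bilin K M N W B; m \<in> carrier M; n \<in> carrier N\<rbrakk> \<Longrightarrow> B m n \<in> carrier W"
  by (auto simp: bilin_def dest: linear_maps_closed)

lemma bilin_comp:
  "\<lbrakk>bilin K M N W B; f \<in> linear_maps K W V\<rbrakk> \<Longrightarrow> bilin K M N V (\<lambda>m n. f (B m n))"
  by (auto simp: bilin_def intro: linear_maps_comp)

lemma bilin_cong:
  assumes "bilin K M N W B" "\<And>m n. \<lbrakk>m \<in> carrier M; n \<in> carrier N\<rbrakk> \<Longrightarrow> B' m n = B m n"
    "module K M" "module K N"
  shows "bilin K M N W B'"
proof (rule bilinI)
  fix m assume m: "m \<in> carrier M"
  show "B' m \<in> linear_maps K N W"
    by (rule linear_maps_cong[OF bilin_right[OF assms(1) m] assms(2)[OF m] assms(4)])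
next
  fix n assume n: "n \<in> carrier N"
  show "(\<lambda>m. B' m n) \<in> linear_maps K M W"
    by (rule linear_maps_cong[OF bilin_left[OF assms(1) n] assms(2)[OF _ n] assms(3)])
qed

lemma tensor_relations_subset:
  assumes "module K M" "module K N"
  shows "tensor_relations K M N \<subseteq> carrier (free_module K (carrier M \<times> carrier N))"
proof -
  interpret M: module K M by fact
  interpret N: module K N by fact
  interpret F: module K "free_module K (carrier M \<times> carrier N)" by (rule M.module_free_module)
  show ?thesis by (auto simp: tensor_relations_def Let_def M.free_gen_closed)
qed

lemma quotient_tensor:
  assumes "module K M" "module K N"
  shows "quotient K (free_module K (carrier M \<times> carrier N)) (tensor_kernel K M N)"
proof -
  interpret M: module K M by fact
  show ?thesis
    unfolding quotient_def tensor_kernel_def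
    using M.module_free_module span_in_submodule tensor_relations_subset[OF assms] by blast
qed

lemma module_tensor: "\<lbrakk>module K M; module K N\<rbrakk> \<Longrightarrow> module K (tensor K M N)"
  unfolding tensor_def by (rule quotient.module_quotient[OF quotient_tensor])

text \<open>Each of the four families in \<open>tensor_relations\<close> is one law of bilinearity,
  written as a difference that lies in the kernel.\<close>

lemma pure_tensor_bilin:
  assumes "module K M" "module K N"
  shows "bilin K M N (tensor K M N) (pure_tensor K M N)"
proof -
  interpret M: module K M by fact
  interpret N: module K N by fact
  let ?F = "free_module K (carrier M \<times> carrier N)"
  interpret quotient K ?F "tensor_kernel K M N" by (rule quotient_tensor[OF assms])
  let ?e = "\<lambda>m n. free_gen K (m, n)"
  have gen: "?e m n \<in> carrier ?F" if "m \<in> carrier M" "n \<in> carrier N" for m n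
    using that by (intro M.free_gen_closed) simp
  have eq: "tensor_kernel K M N +>\<^bsub>?F\<^esub> x = tensor_kernel K M N +>\<^bsub>?F\<^esub> y"
    if "x \<ominus>\<^bsub>?F\<^esub> y \<in> tensor_relations K M N" "x \<in> carrier ?F" "y \<in> carrier ?F" for x y
    using coset_eq_iff[OF that(2,3)] subsetD[OF span_in_superset that(1)]
    unfolding tensor_kernel_def by blast
  show ?thesis
    unfolding pure_tensor_def tensor_def
  proof (intro bilinI linear_mapsI)
    fix m n n' assume mn: "m \<in> carrier M" "n \<in> carrier N" "n' \<in> carrier N"
    have "?e m (n \<oplus>\<^bsub>N\<^esub> n') \<ominus>\<^bsub>?F\<^esub> (?e m n \<oplus>\<^bsub>?F\<^esub> ?e m n') \<in> tensor_relations K M N"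
      using mn unfolding tensor_relations_def Let_def by blast
    from eq[OF this] show "tensor_kernel K M N +>\<^bsub>?F\<^esub> ?e m (n \<oplus>\<^bsub>N\<^esub> n') =
      (tensor_kernel K M N +>\<^bsub>?F\<^esub> ?e m n) \<oplus>\<^bsub>quotient_module ?F (tensor_kernel K M N)\<^esub>
      (tensor_kernel K M N +>\<^bsub>?F\<^esub> ?e m n')"
      using mn by (subst add_quotient) (simp_all add: gen)
  next
    fix m n c assume mn: "m \<in> carrier M" "c \<in> carrier K" "n \<in> carrier N"
    have "?e m (c \<odot>\<^bsub>N\<^esub> n) \<ominus>\<^bsub>?F\<^esub> (c \<odot>\<^bsub>?F\<^esub> ?e m n) \<in> tensor_relations K M N"
      using mn unfolding tensor_relations_def Let_def by blast
    from eq[OF this] show "tensor_kernel K M N +>\<^bsub>?F\<^esub> ?e m (c \<odot>\<^bsub>N\<^esub> n) =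
      c \<odot>\<^bsub>quotient_module ?F (tensor_kernel K M N)\<^esub> (tensor_kernel K M N +>\<^bsub>?F\<^esub> ?e m n)"
      using mn by (subst smult_quotient) (simp_all add: gen)
  next
    fix n m m' assume mn: "n \<in> carrier N" "m \<in> carrier M" "m' \<in> carrier M"
    have "?e (m \<oplus>\<^bsub>M\<^esub> m') n \<ominus>\<^bsub>?F\<^esub> (?e m n \<oplus>\<^bsub>?F\<^esub> ?e m' n) \<in> tensor_relations K M N"
      using mn unfolding tensor_relations_def Let_def by blast
    from eq[OF this] show "tensor_kernel K M N +>\<^bsub>?F\<^esub> ?e (m \<oplus>\<^bsub>M\<^esub> m') n =
      (tensor_kernel K M N +>\<^bsub>?F\<^esub> ?e m n) \<oplus>\<^bsub>quotient_module ?F (tensor_kernel K M N)\<^esub>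
      (tensor_kernel K M N +>\<^bsub>?F\<^esub> ?e m' n)"
      using mn by (subst add_quotient) (simp_all add: gen)
  next
    fix n m c assume mn: "n \<in> carrier N" "c \<in> carrier K" "m \<in> carrier M"
    have "?e (c \<odot>\<^bsub>M\<^esub> m) n \<ominus>\<^bsub>?F\<^esub> (c \<odot>\<^bsub>?F\<^esub> ?e m n) \<in> tensor_relations K M N"
      using mn unfolding tensor_relations_def Let_def by blast
    from eq[OF this] show "tensor_kernel K M N +>\<^bsub>?F\<^esub> ?e (c \<odot>\<^bsub>M\<^esub> m) n =
      c \<odot>\<^bsub>quotient_module ?F (tensor_kernel K M N)\<^esub> (tensor_kernel K M N +>\<^bsub>?F\<^esub> ?e m n)"
      using mn by (subst smult_quotient) (simp_all add: gen)
  qed (unfold carrier_quotient, (intro imageI gen; assumption)+)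
qed

text \<open>Induction on a representative in the free module. The coefficient of a generator is
  absorbed by \<open>c (m \<otimes> n) = (c m) \<otimes> n\<close>, so the step adds a pure tensor
  without a scalar.\<close>

lemma tensor_induct [consumes 3, case_names zero add]:
  assumes M: "module K M" and N: "module K N" and t: "t \<in> carrier (tensor K M N)"
    and zero: "P \<zero>\<^bsub>tensor K M N\<^esub>"
    and add: "\<And>t m n. \<lbrakk>t \<in> carrier (tensor K M N); P t; m \<in> carrier M; n \<in> carrier N\<rbrakk> \<Longrightarrow>
      P (t \<oplus>\<^bsub>tensor K M N\<^esub> pure_tensor K M N m n)"
  shows "P t"
proof -
  interpret M: module K M by fact
  let ?F = "free_module K (carrier M \<times> carrier N)"
  interpret quotient K ?F "tensor_kernel K M N" by (rule quotient_tensor[OF M N])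
  have "P (tensor_kernel K M N +>\<^bsub>?F\<^esub> f)" if "f \<in> carrier ?F" for f
    using that
  proof (induction rule: M.free_module_induct)
    case zero
    then show ?case using assms(4) by (simp add: zero_quotient tensor_def)
  next
    case (add g c a)
    obtain m n where a: "a = (m, n)" "m \<in> carrier M" "n \<in> carrier N" using add by auto
    have "tensor_kernel K M N +>\<^bsub>?F\<^esub> (g \<oplus>\<^bsub>?F\<^esub> c \<odot>\<^bsub>?F\<^esub> free_gen K a) =
      (tensor_kernel K M N +>\<^bsub>?F\<^esub> g) \<oplus>\<^bsub>tensor K M N\<^esub> c \<odot>\<^bsub>tensor K M N\<^esub> pure_tensor K M N m n"
      using add a by (simp add: tensor_def pure_tensor_def add_quotient smult_quotient M.free_gen_closed)
    also have "c \<odot>\<^bsub>tensor K M N\<^esub> pure_tensor K M N m n = pure_tensor K M N (c \<odot>\<^bsub>M\<^esub> m) n"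
      using linear_maps_smult[OF bilin_left[OF pure_tensor_bilin[OF M N]]] a add by simp
    finally have eq: "tensor_kernel K M N +>\<^bsub>?F\<^esub> (g \<oplus>\<^bsub>?F\<^esub> c \<odot>\<^bsub>?F\<^esub> free_gen K a) =
      (tensor_kernel K M N +>\<^bsub>?F\<^esub> g) \<oplus>\<^bsub>tensor K M N\<^esub> pure_tensor K M N (c \<odot>\<^bsub>M\<^esub> m) n" .
    have "tensor_kernel K M N +>\<^bsub>?F\<^esub> g \<in> carrier (tensor K M N)"
      using add(1) by (simp add: tensor_def carrier_quotient)
    moreover have "c \<odot>\<^bsub>M\<^esub> m \<in> carrier M"
      using add by (intro module.smult_closed[OF M _ a(2)])
    ultimately show ?case unfolding eq using add.IH a(3) by (intro assms(5))
  qed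
  then show ?thesis using t by (auto simp: tensor_def carrier_quotient)
qed

section \<open>The universal property of the tensor product\<close>

context
  fixes K :: "('k, 'c) ring_scheme" and M :: "('k, 'm, 'x) module_scheme"
    and N :: "('k, 'n, 'y) module_scheme" and W :: "('k, 'w, 'z) module_scheme"
    and B :: "'m \<Rightarrow> 'n \<Rightarrow> 'w"
  assumes MN: "module K M" "module K N" and W: "module K W" and B: "bilin K M N W B"
begin

interpretation M: module K M by (rule MN)
interpretation W: module K W by (rule W)
interpretation F: quotient K "free_module K (carrier M \<times> carrier N)" "tensor_kernel K M N"
  by (rule quotient_tensor[OF MN])

private abbreviation "F \<equiv> free_module K (carrier M \<times> carrier N)"
private abbreviation "\<Phi> \<equiv> free_lift K W (\<lambda>p. B (fst p) (snd p))"

private lemma B_closed: "p \<in> carrier M \<times> carrier N \<Longrightarrow> B (fst p) (snd p) \<in> carrier W"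
  using B by (auto simp: bilin_closed)

private lemma \<Phi>_linear: "\<Phi> \<in> linear_maps K F W"
  by (rule W.free_lift_linear) (rule B_closed)

private lemma \<Phi>_gen: "\<lbrakk>m \<in> carrier M; n \<in> carrier N\<rbrakk> \<Longrightarrow> \<Phi> (free_gen K (m, n)) = B m n"
  by (subst W.free_lift_gen[of _ "carrier M \<times> carrier N"]) (auto simp: bilin_closed[OF B])

private lemma \<Phi>_kernel:
  assumes "f \<in> tensor_kernel K M N"
  shows "\<Phi> f = \<zero>\<^bsub>W\<^esub>"
proof (rule span_in_kernel[OF F.module_axioms W \<Phi>_linear tensor_relations_subset[OF MN]])
  note gen = M.free_gen_closed[of _ "carrier M \<times> carrier N"]
  note \<Phi> = linear_maps_minus[OF F.module_axioms W \<Phi>_linear] linear_maps_add[OF \<Phi>_linear]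
    linear_maps_smult[OF \<Phi>_linear] linear_maps_closed[OF \<Phi>_linear] \<Phi>_gen gen
    linear_maps_add[OF bilin_left[OF B]] linear_maps_smult[OF bilin_left[OF B]]
    linear_maps_add[OF bilin_right[OF B]] linear_maps_smult[OF bilin_right[OF B]] bilin_closed[OF B]
    W.minus_eq W.r_neg
  interpret N: module K N by (rule MN)
  fix f assume "f \<in> tensor_relations K M N"
  then show "\<Phi> f = \<zero>\<^bsub>W\<^esub>"
    unfolding tensor_relations_def Let_def
    by (elim UnE CollectE exE conjE) (simp_all add: \<Phi>)
qed (use assms in \<open>simp add: tensor_kernel_def\<close>)

private lemma tensor_lift_eq: "tensor_lift K W B = (\<lambda>t. the_elem (\<Phi> ` t))"
  by (simp add: tensor_lift_def free_lift_def fun_eq_iff)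

lemma tensor_lift_linear: "tensor_lift K W B \<in> linear_maps K (tensor K M N) W"
  unfolding tensor_lift_eq tensor_def by (rule F.the_elem_linear[OF W \<Phi>_linear \<Phi>_kernel])

lemma tensor_lift_pure:
  "\<lbrakk>m \<in> carrier M; n \<in> carrier N\<rbrakk> \<Longrightarrow> tensor_lift K W B (pure_tensor K M N m n) = B m n"
  unfolding tensor_lift_eq pure_tensor_def
  by (subst F.the_elem_coset[OF W \<Phi>_linear \<Phi>_kernel]) (auto simp: M.free_gen_closed \<Phi>_gen)

end

lemma pure_tensor_closed:
  "\<lbrakk>module K M; module K N; m \<in> carrier M; n \<in> carrier N\<rbrakk> \<Longrightarrow> pure_tensor K M N m n \<in> carrier (tensor K M N)"
  by (rule bilin_closed[OF pure_tensor_bilin])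

text \<open>Induction over sums of pure tensors. Equality is concluded at elements of the carrier,
  since the functions are unconstrained elsewhere.\<close>

lemma tensor_ext:
  assumes MN: "module K M" "module K N" and W: "module K W"
    and fg: "f \<in> linear_maps K (tensor K M N) W" "g \<in> linear_maps K (tensor K M N) W"
    and eq: "\<And>m n. \<lbrakk>m \<in> carrier M; n \<in> carrier N\<rbrakk> \<Longrightarrow> f (pure_tensor K M N m n) = g (pure_tensor K M N m n)"
    and t: "t \<in> carrier (tensor K M N)"
  shows "f t = g t"
  using MN t
proof (induction rule: tensor_induct)
  case zero
  then show ?case using linear_maps_zero[OF module_tensor[OF MN] W] fg by metis
next
  case (add t m n)
  then show ?case
    using fg[THEN linear_maps_add] eq pure_tensor_closed[OF MN] by simp
qed

text \<open>Both sides are linear in \<open>t\<close> and agree on pure tensors. At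
  \<open>t = \<Delta>(h)\<close> this moves a linear map inside a Sweedler sum.\<close>

lemma tensor_lift_comp:
  assumes "module K M" "module K N" "module K W" "bilin K M N W B" "module K V" "f \<in> linear_maps K W V"
    "t \<in> carrier (tensor K M N)"
  shows "f (tensor_lift K W B t) = tensor_lift K V (\<lambda>m n. f (B m n)) t"
proof (rule tensor_ext[OF assms(1,2,5) _ _ _ assms(7)])
  note B' = bilin_comp[OF assms(4,6)]
  show "(\<lambda>t. f (tensor_lift K W B t)) \<in> linear_maps K (tensor K M N) V"
    by (rule linear_maps_comp[OF tensor_lift_linear[OF assms(1-4)] assms(6)])
  show "tensor_lift K V (\<lambda>m n. f (B m n)) \<in> linear_maps K (tensor K M N) V"
    by (rule tensor_lift_linear[OF assms(1,2,5) B'])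
  fix m n assume "m \<in> carrier M" "n \<in> carrier N"
  then show "f (tensor_lift K W B (pure_tensor K M N m n)) =
      tensor_lift K V (\<lambda>m n. f (B m n)) (pure_tensor K M N m n)"
    by (simp add: tensor_lift_pure[OF assms(1-4)] tensor_lift_pure[OF assms(1,2,5) B'])
qed

text \<open>Rewriting under a Sweedler sum. Bilinearity is asked of one integrand and passes to the
  other, as the two agree on the carriers.\<close>

lemma tensor_lift_cong:
  assumes "module K M" "module K N" "module K W" "bilin K M N W B'"
    "\<And>m n. \<lbrakk>m \<in> carrier M; n \<in> carrier N\<rbrakk> \<Longrightarrow> B m n = B' m n" "t \<in> carrier (tensor K M N)"
  shows "tensor_lift K W B t = tensor_lift K W B' t"
proof -
  have B: "bilin K M N W B" by (rule bilin_cong[OF assms(4,5,1,2)])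
  show ?thesis
    by (rule tensor_ext[OF assms(1-3) tensor_lift_linear[OF assms(1-3) B]
          tensor_lift_linear[OF assms(1-4)] _ assms(6)])
      (simp add: tensor_lift_pure[OF assms(1-3) B] tensor_lift_pure[OF assms(1-4)] assms(5))
qed

text \<open>Here the tensor \<open>t\<close> is fixed and a parameter of the integrand varies, so
  the universal property does not give linearity directly; it is shown by induction on
  \<open>t\<close>.\<close>

lemma linear_tensor_lift_integrand:
  assumes MN: "module K M" "module K N" and X: "module K X" and W: "module K W"
    and T: "\<And>x. x \<in> carrier X \<Longrightarrow> bilin K M N W (\<lambda>m n. T x m n)"
      "\<And>m n. \<lbrakk>m \<in> carrier M; n \<in> carrier N\<rbrakk> \<Longrightarrow> (\<lambda>x. T x m n) \<in> linear_maps K X W"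
    and t: "t \<in> carrier (tensor K M N)"
  shows "(\<lambda>x. tensor_lift K W (\<lambda>m n. T x m n) t) \<in> linear_maps K X W"
proof -
  interpret X: module K X by fact
  interpret W: module K W by fact
  note L = tensor_lift_linear[OF MN W T(1)]
  note Ls = linear_maps_zero[OF module_tensor[OF MN] W L] linear_maps_add[OF L] linear_maps_closed[OF L]
    tensor_lift_pure[OF MN W T(1)] linear_maps_closed[OF T(2)] linear_maps_add[OF T(2)]
    linear_maps_smult[OF T(2)] pure_tensor_closed[OF MN]
  show ?thesis
  proof (rule linear_mapsI)
    fix x y assume xy: "x \<in> carrier X" "y \<in> carrier X"
    show "tensor_lift K W (T (x \<oplus>\<^bsub>X\<^esub> y)) t = tensor_lift K W (T x) t \<oplus>\<^bsub>W\<^esub> tensor_lift K W (T y) t"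
      using MN t
    proof (induction rule: tensor_induct)
      case zero
      show ?case using xy by (simp add: Ls)
    next
      case (add t m n)
      then show ?case using xy by (simp add: Ls W.a_ac)
    qed
  next
    fix c x assume cx: "c \<in> carrier K" "x \<in> carrier X"
    show "tensor_lift K W (T (c \<odot>\<^bsub>X\<^esub> x)) t = c \<odot>\<^bsub>W\<^esub> tensor_lift K W (T x) t"
      using MN t
    proof (induction rule: tensor_induct)
      case zero
      show ?case using cx by (simp add: Ls)
    next
      case (add t m n)
      then show ?case using cx by (simp add: Ls W.smult_r_distr)
    qed
  qed (use t in \<open>simp add: Ls\<close>)
qed

text \<open>Fubini for two Sweedler sums: both sides are linear in \<open>s\<close>, and for a pure
  tensor \<open>s\<close> one of the sums is evaluated.\<close>

lemma tensor_lift_swap: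
  assumes "module K M" "module K N" "module K P" "module K Q" "module K W"
    and T: "\<And>m n. \<lbrakk>m \<in> carrier M; n \<in> carrier N\<rbrakk> \<Longrightarrow> bilin K P Q W (\<lambda>p q. T m n p q)"
      "\<And>p q. \<lbrakk>p \<in> carrier P; q \<in> carrier Q\<rbrakk> \<Longrightarrow> bilin K M N W (\<lambda>m n. T m n p q)"
    and st: "s \<in> carrier (tensor K M N)" "t \<in> carrier (tensor K P Q)"
  shows "tensor_lift K W (\<lambda>m n. tensor_lift K W (\<lambda>p q. T m n p q) t) s =
    tensor_lift K W (\<lambda>p q. tensor_lift K W (\<lambda>m n. T m n p q) s) t"
proof -
  have 1: "bilin K M N W (\<lambda>m n. tensor_lift K W (\<lambda>p q. T m n p q) t)"
    by (intro bilinI linear_tensor_lift_integrand[of K P Q] T assms) 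
      (simp_all add: bilin_left[OF T(2)] bilin_right[OF T(2)])
  have 2: "bilin K P Q W (\<lambda>p q. tensor_lift K W (\<lambda>m n. T m n p q) s)" if "s \<in> carrier (tensor K M N)" for s
    by (intro bilinI linear_tensor_lift_integrand[of K M N] T assms that) 
      (simp_all add: bilin_left[OF T(1)] bilin_right[OF T(1)])
  show ?thesis
  proof (rule tensor_ext[OF assms(1,2,5) _ _ _ st(1)])
    show "(\<lambda>s. tensor_lift K W (\<lambda>p q. tensor_lift K W (\<lambda>m n. T m n p q) s) t) \<in> linear_maps K (tensor K M N) W"
      using assms(1-5) st
      by (intro linear_tensor_lift_integrand[of K P Q] module_tensor 2 tensor_lift_linear T)
  next
    fix m n assume mn: "m \<in> carrier M" "n \<in> carrier N"
    show "tensor_lift K W (\<lambda>m n. tensor_lift K W (\<lambda>p q. T m n p q) t) (pure_tensor K M N m n) =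
      tensor_lift K W (\<lambda>p q. tensor_lift K W (\<lambda>m n. T m n p q) (pure_tensor K M N m n)) t"
      using mn st(2) by (subst tensor_lift_pure[OF assms(1,2,5) 1])
        (auto intro!: tensor_lift_cong[symmetric, OF assms(3,4,5) T(1)] simp: tensor_lift_pure[OF assms(1,2,5) T(2)])
  qed (rule tensor_lift_linear[OF assms(1,2,5) 1])
qed

section \<open>Scalars as a module, and closure rules for linear expressions\<close>

lemma module_self_module: "cring K \<Longrightarrow> module K (self_module K)"
proof -
  assume "cring K"
  then interpret cring K .
  show ?thesis
    by (rule moduleI[OF cring_axioms])
      (auto intro!: abelian_groupI simp: self_module_def l_distr r_distr m_assoc a_ac
        intro: exI[of _ "\<ominus>\<^bsub>K\<^esub> _"] l_neg a_inv_closed)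
qed

lemma self_module_simps [simp]:
  "carrier (self_module K) = carrier K" "smult (self_module K) = mult K" "add (self_module K) = add K"
  by (auto simp: self_module_def)

lemma linear_id: "(\<lambda>x. x) \<in> linear_maps K M M"
  by (auto simp: linear_maps_def)

lemma linear_smult_left:
  assumes "module K W" "f \<in> linear_maps K X (self_module K)" "w \<in> carrier W"
  shows "(\<lambda>x. f x \<odot>\<^bsub>W\<^esub> w) \<in> linear_maps K X W"
proof -
  interpret module K W by fact
  show ?thesis
    using linear_maps_closed[OF assms(2)] assms(3)
    by (intro linear_mapsI) (simp_all add: linear_maps_add[OF assms(2)] linear_maps_smult[OF assms(2)] smult_l_distr smult_assoc1)
qed

lemma linear_smult_right:
  assumes "module K W" "c \<in> carrier K" "f \<in> linear_maps K X W"
  shows "(\<lambda>x. c \<odot>\<^bsub>W\<^esub> f x) \<in> linear_maps K X W"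
proof -
  interpret module K W by fact
  show ?thesis
    using linear_maps_closed[OF assms(3)] assms(2)
    by (intro linear_mapsI) (simp_all add: linear_maps_add[OF assms(3)] linear_maps_smult[OF assms(3)] smult_r_distr smult_assoc1[symmetric] R.m_comm)
qed

lemma linear_pure_left:
  assumes "module K M" "module K N" "f \<in> linear_maps K X M" "n \<in> carrier N"
  shows "(\<lambda>x. pure_tensor K M N (f x) n) \<in> linear_maps K X (tensor K M N)"
  by (rule linear_maps_comp[OF assms(3) bilin_left[OF pure_tensor_bilin[OF assms(1,2)] assms(4)]])

lemma linear_pure_right:
  assumes "module K M" "module K N" "m \<in> carrier M" "f \<in> linear_maps K X N"
  shows "(\<lambda>x. pure_tensor K M N m (f x)) \<in> linear_maps K X (tensor K M N)"
  by (rule linear_maps_comp[OF assms(4) bilin_right[OF pure_tensor_bilin[OF assms(1,2)] assms(3)]])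

lemma linear_bilin_left:
  "\<lbrakk>bilin K M N W B; f \<in> linear_maps K X M; n \<in> carrier N\<rbrakk> \<Longrightarrow> (\<lambda>x. B (f x) n) \<in> linear_maps K X W"
  by (rule linear_maps_comp[OF _ bilin_left])

lemma linear_bilin_right:
  "\<lbrakk>bilin K M N W B; m \<in> carrier M; f \<in> linear_maps K X N\<rbrakk> \<Longrightarrow> (\<lambda>x. B m (f x)) \<in> linear_maps K X W"
  by (rule linear_maps_comp[OF _ bilin_right])

lemma linear_tensor_lift_arg:
  assumes "module K M" "module K N" "module K W" "bilin K M N W B" "f \<in> linear_maps K X (tensor K M N)"
  shows "(\<lambda>x. tensor_lift K W B (f x)) \<in> linear_maps K X W"
  by (rule linear_maps_comp[OF assms(5) tensor_lift_linear[OF assms(1-4)]])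

lemma bilin_tensor_lift_integrand:
  assumes "module K M" "module K N" "module K X" "module K Y" "module K W"
    and "\<And>x y. \<lbrakk>x \<in> carrier X; y \<in> carrier Y\<rbrakk> \<Longrightarrow> bilin K M N W (T x y)"
      "\<And>m n. \<lbrakk>m \<in> carrier M; n \<in> carrier N\<rbrakk> \<Longrightarrow> bilin K X Y W (\<lambda>x y. T x y m n)"
    and "t \<in> carrier (tensor K M N)"
  shows "bilin K X Y W (\<lambda>x y. tensor_lift K W (T x y) t)"
  by (intro bilinI linear_tensor_lift_integrand[of K M N] assms)
    (simp_all add: bilin_left[OF assms(7)] bilin_right[OF assms(7)])

text \<open>The third claim exposes the bilinear map inside \<open>tensor_map\<close>; it is needed
  whenever \<open>tensor_map\<close> is unfolded to a lift so that another linear map can be moved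
  inside.\<close>

lemma tensor_map_linear:
  assumes "module K M" "module K N" "module K M'" "module K N'"
    and fg: "f \<in> linear_maps K M M'" "g \<in> linear_maps K N N'"
  shows "tensor_map K M' N' f g \<in> linear_maps K (tensor K M N) (tensor K M' N')"
    and "\<lbrakk>m \<in> carrier M; n \<in> carrier N\<rbrakk> \<Longrightarrow>
      tensor_map K M' N' f g (pure_tensor K M N m n) = pure_tensor K M' N' (f m) (g n)"
    and "bilin K M N (tensor K M' N') (\<lambda>m n. pure_tensor K M' N' (f m) (g n))"
proof -
  show B: "bilin K M N (tensor K M' N') (\<lambda>m n. pure_tensor K M' N' (f m) (g n))"
    by (intro bilinI linear_pure_left linear_pure_right fg assms) 
      (auto intro: linear_maps_closed[OF fg(1)] linear_maps_closed[OF fg(2)])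
  show "tensor_map K M' N' f g \<in> linear_maps K (tensor K M N) (tensor K M' N')"
    unfolding tensor_map_def by (rule tensor_lift_linear[OF assms(1,2) module_tensor[OF assms(3,4)] B])
  show "tensor_map K M' N' f g (pure_tensor K M N m n) = pure_tensor K M' N' (f m) (g n)"
    if "m \<in> carrier M" "n \<in> carrier N"
    unfolding tensor_map_def by (rule tensor_lift_pure[OF assms(1,2) module_tensor[OF assms(3,4)] B that])
qed

text \<open>The second claim keeps an arbitrary \<open>u\<close> in the first factor, because it
  will be applied to values of the comultiplication, which are not pure tensors.\<close>

lemma tensor_assoc_linear:
  assumes M: "module K M" and N: "module K N" and P: "module K P"
  shows "tensor_assoc K M N P \<in> linear_maps K (tensor K (tensor K M N) P) (tensor K M (tensor K N P))"
    and "\<lbrakk>u \<in> carrier (tensor K M N); p \<in> carrier P\<rbrakk> \<Longrightarrow>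
      tensor_assoc K M N P (pure_tensor K (tensor K M N) P u p) =
      tensor_lift K (tensor K M (tensor K N P)) (\<lambda>m n. pure_tensor K M (tensor K N P) m (pure_tensor K N P n p)) u"
    and "p \<in> carrier P \<Longrightarrow> bilin K M N (tensor K M (tensor K N P))
      (\<lambda>m n. pure_tensor K M (tensor K N P) m (pure_tensor K N P n p))"
proof -
  note NP = module_tensor[OF N P] and MN = module_tensor[OF M N]
  let ?W = "tensor K M (tensor K N P)"
  let ?p = "\<lambda>m n p. pure_tensor K M (tensor K N P) m (pure_tensor K N P n p)"
  note W = module_tensor[OF M NP]
  show B: "bilin K M N ?W (\<lambda>m n. ?p m n p)" if "p \<in> carrier P" for p
    using that by (intro bilinI linear_pure_left linear_pure_right linear_id NP assms pure_tensor_closed)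
  have B': "bilin K (tensor K M N) P ?W (\<lambda>u p. tensor_lift K ?W (\<lambda>m n. ?p m n p) u)"
  proof (rule bilinI)
    show "(\<lambda>u. tensor_lift K ?W (\<lambda>m n. ?p m n p) u) \<in> linear_maps K (tensor K M N) ?W" if "p \<in> carrier P" for p
      by (rule tensor_lift_linear[OF M N W B[OF that]])
    have lin: "(\<lambda>p. ?p m n p) \<in> linear_maps K P ?W" if "m \<in> carrier M" "n \<in> carrier N" for m n
      using that by (intro linear_pure_right linear_id NP assms)
    show "(\<lambda>p. tensor_lift K ?W (\<lambda>m n. ?p m n p) u) \<in> linear_maps K P ?W"
      if "u \<in> carrier (tensor K M N)" for u
      by (rule linear_tensor_lift_integrand[OF M N P W B lin that])
  qed
  show "tensor_assoc K M N P \<in> linear_maps K (tensor K (tensor K M N) P) ?W"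
    unfolding tensor_assoc_def Let_def by (rule tensor_lift_linear[OF MN P W B'])
  show "tensor_assoc K M N P (pure_tensor K (tensor K M N) P u p) = tensor_lift K ?W (\<lambda>m n. ?p m n p) u"
    if "u \<in> carrier (tensor K M N)" "p \<in> carrier P"
    unfolding tensor_assoc_def Let_def by (rule tensor_lift_pure[OF MN P W B' that])
qed

section \<open>Sweedler calculus\<close>

context weak_bialgebra
begin

lemmas module_H = module_axioms

lemma module_K: "module K (self_module K)"
  by (rule module_self_module) (rule R.is_cring)

lemma module_HH: "module K (tensor K H H)"
  by (rule module_tensor[OF module_H module_H])

lemma module_HHH: "module K (tensor K H (tensor K H H))"
  by (rule module_tensor[OF module_H module_HH])

text \<open>The Sweedler expression \<open>B(h_1, h_2)\<close> with values in \<open>W\<close>.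
  Three legs arise by nesting a second \<open>sw\<close> at the first or at the second leg.\<close>

abbreviation "sw W B h \<equiv> tensor_lift K W B (comult H h)"

lemma comult_closed: "h \<in> carrier H \<Longrightarrow> comult H h \<in> carrier (tensor K H H)"
  by (rule linear_maps_closed[OF comult_linear])

lemma counit_closed [simp]: "h \<in> carrier H \<Longrightarrow> counit H h \<in> carrier K"
  using linear_maps_closed[OF counit_linear] by simp

lemma linear_counit: "f \<in> linear_maps K X H \<Longrightarrow> (\<lambda>x. counit H (f x)) \<in> linear_maps K X (self_module K)"
  by (rule linear_maps_comp[OF _ counit_linear])

lemma linear_comult: "f \<in> linear_maps K X H \<Longrightarrow> (\<lambda>x. comult H (f x)) \<in> linear_maps K X (tensor K H H)"
  by (rule linear_maps_comp[OF _ comult_linear])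

lemma linear_mult_left:
  assumes "f \<in> linear_maps K X H" "h \<in> carrier H"
  shows "(\<lambda>x. f x \<otimes>\<^bsub>H\<^esub> h) \<in> linear_maps K X H"
  using linear_maps_closed[OF assms(1)] assms(2)
  by (intro linear_mapsI) (simp_all add: linear_maps_add[OF assms(1)] linear_maps_smult[OF assms(1)] l_distr smult_mult_left)

lemma linear_mult_right:
  assumes "h \<in> carrier H" "f \<in> linear_maps K X H"
  shows "(\<lambda>x. h \<otimes>\<^bsub>H\<^esub> f x) \<in> linear_maps K X H"
  using linear_maps_closed[OF assms(2)] assms(1)
  by (intro linear_mapsI) (simp_all add: linear_maps_add[OF assms(2)] linear_maps_smult[OF assms(2)] r_distr smult_mult_right)

lemma linear_kmult_left:
  "\<lbrakk>f \<in> linear_maps K X (self_module K); c \<in> carrier K\<rbrakk> \<Longrightarrow> (\<lambda>x. f x \<otimes>\<^bsub>K\<^esub> c) \<in> linear_maps K X (self_module K)"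
  using linear_smult_left[OF module_K, of f X c] by simp

lemma linear_kmult_right:
  "\<lbrakk>c \<in> carrier K; f \<in> linear_maps K X (self_module K)\<rbrakk> \<Longrightarrow> (\<lambda>x. c \<otimes>\<^bsub>K\<^esub> f x) \<in> linear_maps K X (self_module K)"
  using linear_smult_right[OF module_K, of c f X] by simp

lemma linear_sw:
  "\<lbrakk>module K W; bilin K H H W B; f \<in> linear_maps K X H\<rbrakk> \<Longrightarrow> (\<lambda>x. sw W B (f x)) \<in> linear_maps K X W"
  by (rule linear_tensor_lift_arg[OF module_H module_H _ _ linear_comult])

lemmas linear_sw_integrand = linear_tensor_lift_integrand[OF module_H module_H _ _ _ _ comult_closed]
lemmas bilin_sw_integrand = bilin_tensor_lift_integrand[OF module_H module_H _ _ _ _ _ comult_closed]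
lemmas sw_comp = tensor_lift_comp[OF module_H module_H _ _ _ _ comult_closed]
lemmas sw_cong = tensor_lift_cong[OF module_H module_H _ _ _ comult_closed]
lemmas sw_swap = tensor_lift_swap[OF module_H module_H module_H module_H _ _ _ comult_closed comult_closed]

text \<open>The counit axiom has values in \<open>H\<close>; moving \<open>f\<close> into its sum
  gives the form \<open>\<epsilon>(h_1) f(h_2)\<close> with values in any module.\<close>

lemma sw_counit_left:
  assumes "module K W" "f \<in> linear_maps K H W" "h \<in> carrier H"
  shows "sw W (\<lambda>a b. counit H a \<odot>\<^bsub>W\<^esub> f b) h = f h"
proof -
  have B: "bilin K H H H (\<lambda>a b. counit H a \<odot>\<^bsub>H\<^esub> b)"
    by (intro bilinI linear_smult_left linear_smult_right linear_counit linear_id module_H) simp_all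
  have "f h = f (sw H (\<lambda>a b. counit H a \<odot>\<^bsub>H\<^esub> b) h)"
    using assms(3) by (simp add: counit_left)
  also have "\<dots> = sw W (\<lambda>a b. f (counit H a \<odot>\<^bsub>H\<^esub> b)) h"
    by (rule sw_comp[OF module_H B assms])
  also have "\<dots> = sw W (\<lambda>a b. counit H a \<odot>\<^bsub>W\<^esub> f b) h"
    using assms(3)
    by (intro sw_cong bilinI linear_smult_left linear_smult_right linear_counit linear_id assms(1,2))
      (simp_all add: linear_maps_smult[OF assms(2)] linear_maps_closed[OF assms(2)])
  finally show ?thesis by simp
qed

lemma sw_counit_right:
  assumes "module K W" "f \<in> linear_maps K H W" "h \<in> carrier H"
  shows "sw W (\<lambda>a b. counit H b \<odot>\<^bsub>W\<^esub> f a) h = f h"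
proof -
  have B: "bilin K H H H (\<lambda>a b. counit H b \<odot>\<^bsub>H\<^esub> a)"
    by (intro bilinI linear_smult_left linear_smult_right linear_counit linear_id module_H) simp_all
  have "f h = f (sw H (\<lambda>a b. counit H b \<odot>\<^bsub>H\<^esub> a) h)"
    using assms(3) by (simp add: counit_right)
  also have "\<dots> = sw W (\<lambda>a b. f (counit H b \<odot>\<^bsub>H\<^esub> a)) h"
    by (rule sw_comp[OF module_H B assms])
  also have "\<dots> = sw W (\<lambda>a b. counit H b \<odot>\<^bsub>W\<^esub> f a) h"
    using assms(3)
    by (intro sw_cong bilinI linear_smult_left linear_smult_right linear_counit linear_id assms(1,2))
      (simp_all add: linear_maps_smult[OF assms(2)] linear_maps_closed[OF assms(2)])
  finally show ?thesis by simp
qed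

text \<open>In Sweedler notation, \<open>B((g h)_1, (g h)_2) = B(g_1 h_1, g_2 h_2)\<close>. The
  product of \<open>tensor_algebra\<close> is itself a nested lift, and the map induced by
  \<open>B\<close> is moved through both layers.\<close>

lemma sw_mult:
  assumes W: "module K W" and B: "bilin K H H W B" and gh: "g \<in> carrier H" "h \<in> carrier H"
  shows "sw W B (g \<otimes>\<^bsub>H\<^esub> h) = sw W (\<lambda>a b. sw W (\<lambda>c d. B (a \<otimes>\<^bsub>H\<^esub> c) (b \<otimes>\<^bsub>H\<^esub> d)) h) g"
proof -
  let ?T = "tensor K H H" and ?p = "pure_tensor K H H"
  let ?in = "\<lambda>a b. sw ?T (\<lambda>c d. ?p (a \<otimes>\<^bsub>H\<^esub> c) (b \<otimes>\<^bsub>H\<^esub> d)) h"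
  note L = tensor_lift_linear[OF module_H module_H W B]
  have in1: "bilin K H H ?T (\<lambda>c d. ?p (a \<otimes>\<^bsub>H\<^esub> c) (b \<otimes>\<^bsub>H\<^esub> d))" if "a \<in> carrier H" "b \<in> carrier H" for a b
    using that by (intro bilinI linear_pure_left linear_pure_right linear_mult_right linear_id module_H) simp_all
  have in0: "bilin K H H ?T (\<lambda>a b. ?p (a \<otimes>\<^bsub>H\<^esub> c) (b \<otimes>\<^bsub>H\<^esub> d))" if "c \<in> carrier H" "d \<in> carrier H" for c d
    using that by (intro bilinI linear_pure_left linear_pure_right linear_mult_left linear_id module_H) simp_all
  have in2: "bilin K H H ?T ?in"
    by (rule bilin_sw_integrand[OF module_H module_H module_HH in1 in0 gh(2)])
  have "comult H (g \<otimes>\<^bsub>H\<^esub> h) = sw ?T ?in g"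
    using gh by (simp add: comult_mult tensor_algebra_def tensor_act_def tensor_map_def)
  then have "sw W B (g \<otimes>\<^bsub>H\<^esub> h) = sw W (\<lambda>a b. tensor_lift K W B (?in a b)) g"
    by (simp add: sw_comp[OF module_HH in2 W L gh(1)])
  also have "\<dots> = sw W (\<lambda>a b. sw W (\<lambda>c d. B (a \<otimes>\<^bsub>H\<^esub> c) (b \<otimes>\<^bsub>H\<^esub> d)) h) g"
  proof (rule sw_cong[OF W _ _ gh(1)])
    note c = linear_bilin_left[OF B] linear_bilin_right[OF B] linear_mult_left linear_mult_right linear_id
    show "bilin K H H W (\<lambda>a b. sw W (\<lambda>c d. B (a \<otimes>\<^bsub>H\<^esub> c) (b \<otimes>\<^bsub>H\<^esub> d)) h)"
      using gh by (intro bilin_sw_integrand W module_H bilinI c) simp_all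
    fix a b assume ab: "a \<in> carrier H" "b \<in> carrier H"
    show "tensor_lift K W B (?in a b) = sw W (\<lambda>c d. B (a \<otimes>\<^bsub>H\<^esub> c) (b \<otimes>\<^bsub>H\<^esub> d)) h"
      using ab unfolding sw_comp[OF module_HH in1[OF ab] W L gh(2)]
      by (intro sw_cong W gh(2) bilinI c) (simp_all add: tensor_lift_pure[OF module_H module_H W B])
  qed
  finally show ?thesis .
qed

text \<open>Trilinearity of \<open>T\<close> is expressed by bilinearity in its first two and in its
  last two arguments, the two pairs that the inner sums run over.\<close>

lemma sw_coassoc:
  assumes W: "module K W"
    and T1: "\<And>e. e \<in> carrier H \<Longrightarrow> bilin K H H W (\<lambda>c d. T c d e)"
    and T2: "\<And>c. c \<in> carrier H \<Longrightarrow> bilin K H H W (\<lambda>d e. T c d e)"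
    and h: "h \<in> carrier H"
  shows "sw W (\<lambda>x e. sw W (\<lambda>c d. T c d e) x) h = sw W (\<lambda>c y. sw W (\<lambda>d e. T c d e) y) h"
proof -
  let ?HH = "tensor K H H"
  \<comment> \<open>The linear map on the right-bracketed threefold tensor product induced by
    \<open>T\<close>; the two sides of the claim are its values at the two sides of
    \<open>coassoc\<close>.\<close>
  let ?\<Theta> = "tensor_lift K W (\<lambda>c y. tensor_lift K W (\<lambda>d e. T c d e) y)"
  let ?t = "\<lambda>c d e. pure_tensor K H ?HH c (pure_tensor K H H d e)"
  note assoc = tensor_assoc_linear[OF module_H module_H module_H]
  have \<Theta>: "bilin K H ?HH W (\<lambda>c y. tensor_lift K W (\<lambda>d e. T c d e) y)"
    by (intro bilinI tensor_lift_linear[OF module_H module_H W T2]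
        linear_tensor_lift_integrand[OF module_H module_H module_H W T2])
      (simp_all add: bilin_left[OF T1])
  note \<Theta>_linear = tensor_lift_linear[OF module_H module_HH W \<Theta>]
  have \<Theta>_pure: "?\<Theta> (?t c d e) = T c d e" if "c \<in> carrier H" "d \<in> carrier H" "e \<in> carrier H" for c d e
    using that by (simp add: tensor_lift_pure[OF module_H module_HH W \<Theta>] tensor_lift_pure[OF module_H module_H W T2]
        pure_tensor_closed[OF module_H module_H])
  have id: "id \<in> linear_maps K H H" using linear_id[of K H] by (simp add: id_def)
  note L = tensor_map_linear(3)[OF module_H module_H module_HH module_H comult_linear id]
  note R = tensor_map_linear(3)[OF module_H module_H module_H module_HH id comult_linear]
  have "sw W (\<lambda>x e. sw W (\<lambda>c d. T c d e) x) h =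
    sw W (\<lambda>x e. ?\<Theta> (tensor_assoc K H H H (pure_tensor K ?HH H (comult H x) (id e)))) h"
  proof (rule sw_cong[OF W _ _ h])
    show "bilin K H H W (\<lambda>x e. ?\<Theta> (tensor_assoc K H H H (pure_tensor K ?HH H (comult H x) (id e))))"
      by (rule bilin_comp[OF bilin_comp[OF L assoc(1)] \<Theta>_linear])
    fix x e assume xe: "x \<in> carrier H" "e \<in> carrier H"
    have "?\<Theta> (tensor_assoc K H H H (pure_tensor K ?HH H (comult H x) (id e))) = sw W (\<lambda>c d. ?\<Theta> (?t c d e)) x"
      using xe by (simp add: assoc(2) comult_closed sw_comp[OF module_HHH assoc(3) W \<Theta>_linear])
    also have "\<dots> = sw W (\<lambda>c d. T c d e) x"
      using xe by (intro sw_cong W T1) (simp_all add: \<Theta>_pure)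
    finally show "sw W (\<lambda>c d. T c d e) x = ?\<Theta> (tensor_assoc K H H H (pure_tensor K ?HH H (comult H x) (id e)))" ..
  qed
  also have "\<dots> = ?\<Theta> (tensor_assoc K H H H (tensor_map K ?HH H (comult H) id (comult H h)))"
    unfolding tensor_map_def
    by (simp only: sw_comp[OF module_tensor[OF module_HH module_H] L W linear_maps_comp[OF assoc(1) \<Theta>_linear] h])
  also have "\<dots> = ?\<Theta> (tensor_map K H ?HH id (comult H) (comult H h))"
    by (simp add: coassoc[OF h])
  also have "\<dots> = sw W (\<lambda>c y. ?\<Theta> (pure_tensor K H ?HH (id c) (comult H y))) h"
    unfolding tensor_map_def by (rule sw_comp[OF module_HHH R W \<Theta>_linear h])
  also have "\<dots> = sw W (\<lambda>c y. sw W (\<lambda>d e. T c d e) y) h"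
  proof (rule sw_cong[OF W _ _ h])
    show "bilin K H H W (\<lambda>c y. sw W (\<lambda>d e. T c d e) y)"
      using linear_bilin_left[OF \<Theta> linear_id] linear_bilin_right[OF \<Theta> _ comult_linear]
      by (intro bilinI) (simp_all add: comult_closed)
  qed (simp add: tensor_lift_pure[OF module_H module_HH W \<Theta>] comult_closed)
  finally show ?thesis .
qed


section \<open>The counital maps\<close>

lemmas linear_rules = linear_smult_left linear_smult_right linear_counit linear_mult_left
  linear_mult_right linear_kmult_left linear_kmult_right linear_id module_H module_K

lemma eps_t_linear: "eps_t K H \<in> linear_maps K H H"
proof -
  have "(\<lambda>h. sw H (\<lambda>a b. counit H (a \<otimes>\<^bsub>H\<^esub> h) \<odot>\<^bsub>H\<^esub> b) \<one>\<^bsub>H\<^esub>) \<in> linear_maps K H H"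
  proof (rule linear_sw_integrand)
    show "bilin K H H H (\<lambda>a b. counit H (a \<otimes>\<^bsub>H\<^esub> h) \<odot>\<^bsub>H\<^esub> b)" if "h \<in> carrier H" for h
      using that by (intro bilinI linear_rules) simp_all
    show "(\<lambda>h. counit H (a \<otimes>\<^bsub>H\<^esub> h) \<odot>\<^bsub>H\<^esub> b) \<in> linear_maps K H H" if "a \<in> carrier H" "b \<in> carrier H" for a b
      using that by (intro linear_rules)
  qed (simp_all add: module_H)
  then show ?thesis by (simp add: eps_t_def[abs_def])
qed

lemma eps_s'_linear: "eps_s' K H \<in> linear_maps K H H"
proof -
  have "(\<lambda>h. sw H (\<lambda>a b. counit H (b \<otimes>\<^bsub>H\<^esub> h) \<odot>\<^bsub>H\<^esub> a) \<one>\<^bsub>H\<^esub>) \<in> linear_maps K H H"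
  proof (rule linear_sw_integrand)
    show "bilin K H H H (\<lambda>a b. counit H (b \<otimes>\<^bsub>H\<^esub> h) \<odot>\<^bsub>H\<^esub> a)" if "h \<in> carrier H" for h
      using that by (intro bilinI linear_rules) simp_all
    show "(\<lambda>h. counit H (b \<otimes>\<^bsub>H\<^esub> h) \<odot>\<^bsub>H\<^esub> a) \<in> linear_maps K H H" if "a \<in> carrier H" "b \<in> carrier H" for a b
      using that by (intro linear_rules)
  qed (simp_all add: module_H)
  then show ?thesis by (simp add: eps_s'_def[abs_def])
qed

lemma eps_t_closed [simp]: "h \<in> carrier H \<Longrightarrow> eps_t K H h \<in> carrier H"
  by (rule linear_maps_closed[OF eps_t_linear])

lemma eps_s'_closed [simp]: "h \<in> carrier H \<Longrightarrow> eps_s' K H h \<in> carrier H"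
  by (rule linear_maps_closed[OF eps_s'_linear])

lemma eps_bilin:
  assumes "h \<in> carrier H"
  shows "bilin K H H H (\<lambda>a b. counit H (a \<otimes>\<^bsub>H\<^esub> h) \<odot>\<^bsub>H\<^esub> b)"
    and "bilin K H H H (\<lambda>a b. counit H (b \<otimes>\<^bsub>H\<^esub> h) \<odot>\<^bsub>H\<^esub> a)"
  using assms by (intro bilinI linear_rules; simp)+

text \<open>Moving \<open>\<epsilon>(g -)\<close> into the sum that defines
  \<open>\<epsilon>\<^sub>t(h)\<close> gives \<open>\<epsilon>(g 1_2) \<epsilon>(1_1 h)\<close>,
  which \<open>counit_mult2\<close> with middle argument 1 contracts.\<close>

lemma counit_mult_eps_t:
  assumes "g \<in> carrier H" "h \<in> carrier H"
  shows "counit H (g \<otimes>\<^bsub>H\<^esub> eps_t K H h) = counit H (g \<otimes>\<^bsub>H\<^esub> h)"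
proof -
  let ?K = "self_module K"
  have f: "(\<lambda>y. counit H (g \<otimes>\<^bsub>H\<^esub> y)) \<in> linear_maps K H ?K"
    using assms by (intro linear_rules)
  have "counit H (g \<otimes>\<^bsub>H\<^esub> eps_t K H h) = sw ?K (\<lambda>c d. counit H (g \<otimes>\<^bsub>H\<^esub> (counit H (c \<otimes>\<^bsub>H\<^esub> h) \<odot>\<^bsub>H\<^esub> d))) \<one>\<^bsub>H\<^esub>"
    unfolding eps_t_def
    by (rule sw_comp[OF module_H eps_bilin(1)[OF assms(2)] module_K f]) simp
  also have "\<dots> = sw ?K (\<lambda>c d. counit H (g \<otimes>\<^bsub>H\<^esub> d) \<otimes>\<^bsub>K\<^esub> counit H (c \<otimes>\<^bsub>H\<^esub> h)) \<one>\<^bsub>H\<^esub>"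
  proof (rule sw_cong)
    show "bilin K H H ?K (\<lambda>c d. counit H (g \<otimes>\<^bsub>H\<^esub> d) \<otimes>\<^bsub>K\<^esub> counit H (c \<otimes>\<^bsub>H\<^esub> h))"
      using assms by (intro bilinI linear_rules) simp_all
    fix c d assume "c \<in> carrier H" "d \<in> carrier H"
    then show "counit H (g \<otimes>\<^bsub>H\<^esub> (counit H (c \<otimes>\<^bsub>H\<^esub> h) \<odot>\<^bsub>H\<^esub> d)) = counit H (g \<otimes>\<^bsub>H\<^esub> d) \<otimes>\<^bsub>K\<^esub> counit H (c \<otimes>\<^bsub>H\<^esub> h)"
      using assms linear_maps_smult[OF f] by (simp add: R.m_comm)
  qed (simp_all add: module_K)
  also have "\<dots> = counit H (g \<otimes>\<^bsub>H\<^esub> h)"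
    using counit_mult2[OF assms(1) _ assms(2), of "\<one>\<^bsub>H\<^esub>"] assms by simp
  finally show ?thesis .
qed

text \<open>Both counital maps see their argument \<open>h\<close> only through scalars
  \<open>\<epsilon>(x h)\<close>, and these do not change when \<open>h\<close> is replaced by
  \<open>\<epsilon>\<^sub>t(h)\<close>.\<close>

lemma eps_eps_t:
  assumes "h \<in> carrier H"
  shows "eps_t K H (eps_t K H h) = eps_t K H h" and "eps_s' K H (eps_t K H h) = eps_s' K H h"
proof -
  have "eps_t K H (eps_t K H h) = sw H (\<lambda>a b. counit H (a \<otimes>\<^bsub>H\<^esub> eps_t K H h) \<odot>\<^bsub>H\<^esub> b) \<one>\<^bsub>H\<^esub>"
    by (simp add: eps_t_def)
  also have "\<dots> = sw H (\<lambda>a b. counit H (a \<otimes>\<^bsub>H\<^esub> h) \<odot>\<^bsub>H\<^esub> b) \<one>\<^bsub>H\<^esub>"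
    using assms by (intro sw_cong eps_bilin) (simp_all add: module_H counit_mult_eps_t)
  finally show "eps_t K H (eps_t K H h) = eps_t K H h" by (simp add: eps_t_def)
  have "eps_s' K H (eps_t K H h) = sw H (\<lambda>a b. counit H (b \<otimes>\<^bsub>H\<^esub> eps_t K H h) \<odot>\<^bsub>H\<^esub> a) \<one>\<^bsub>H\<^esub>"
    by (simp add: eps_s'_def)
  also have "\<dots> = sw H (\<lambda>a b. counit H (b \<otimes>\<^bsub>H\<^esub> h) \<odot>\<^bsub>H\<^esub> a) \<one>\<^bsub>H\<^esub>"
    using assms by (intro sw_cong eps_bilin) (simp_all add: module_H counit_mult_eps_t)
  finally show "eps_s' K H (eps_t K H h) = eps_s' K H h" by (simp add: eps_s'_def)
qed

text \<open>Weak multiplicativity of the counit carried along a fixed vector \<open>w\<close>, in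
  the two leg orders that occur for \<open>\<epsilon>\<^sub>s'\<close> and
  \<open>\<epsilon>\<^sub>t\<close>.\<close>

lemma sw_counit_mult:
  assumes "d \<in> carrier H" "y \<in> carrier H" "h \<in> carrier H" "w \<in> carrier H"
  shows "sw H (\<lambda>f b. (counit H (d \<otimes>\<^bsub>H\<^esub> f) \<otimes>\<^bsub>K\<^esub> counit H (b \<otimes>\<^bsub>H\<^esub> h)) \<odot>\<^bsub>H\<^esub> w) y =
      counit H (d \<otimes>\<^bsub>H\<^esub> y \<otimes>\<^bsub>H\<^esub> h) \<odot>\<^bsub>H\<^esub> w"
    and "sw H (\<lambda>b f. (counit H (d \<otimes>\<^bsub>H\<^esub> f) \<otimes>\<^bsub>K\<^esub> counit H (b \<otimes>\<^bsub>H\<^esub> h)) \<odot>\<^bsub>H\<^esub> w) y =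
      counit H (d \<otimes>\<^bsub>H\<^esub> y \<otimes>\<^bsub>H\<^esub> h) \<odot>\<^bsub>H\<^esub> w"
proof -
  let ?K = "self_module K"
  have w: "(\<lambda>k. k \<odot>\<^bsub>H\<^esub> w) \<in> linear_maps K ?K H"
    using assms by (intro linear_rules)
  have "bilin K H H ?K (\<lambda>f b. counit H (d \<otimes>\<^bsub>H\<^esub> f) \<otimes>\<^bsub>K\<^esub> counit H (b \<otimes>\<^bsub>H\<^esub> h))"
    using assms by (intro bilinI linear_rules) simp_all
  from sw_comp[OF module_K this module_H w assms(2)]
  show "sw H (\<lambda>f b. (counit H (d \<otimes>\<^bsub>H\<^esub> f) \<otimes>\<^bsub>K\<^esub> counit H (b \<otimes>\<^bsub>H\<^esub> h)) \<odot>\<^bsub>H\<^esub> w) y =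
      counit H (d \<otimes>\<^bsub>H\<^esub> y \<otimes>\<^bsub>H\<^esub> h) \<odot>\<^bsub>H\<^esub> w"
    using assms by (simp add: counit_mult1)
  have "bilin K H H ?K (\<lambda>b f. counit H (d \<otimes>\<^bsub>H\<^esub> f) \<otimes>\<^bsub>K\<^esub> counit H (b \<otimes>\<^bsub>H\<^esub> h))"
    using assms by (intro bilinI linear_rules) simp_all
  from sw_comp[OF module_K this module_H w assms(2)]
  show "sw H (\<lambda>b f. (counit H (d \<otimes>\<^bsub>H\<^esub> f) \<otimes>\<^bsub>K\<^esub> counit H (b \<otimes>\<^bsub>H\<^esub> h)) \<odot>\<^bsub>H\<^esub> w) y =
      counit H (d \<otimes>\<^bsub>H\<^esub> y \<otimes>\<^bsub>H\<^esub> h) \<odot>\<^bsub>H\<^esub> w"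
    using assms by (simp add: counit_mult2)
qed

text \<open>
  Insert the counit into \<open>x 1\<^sub>1\<close>; by coassociativity the product of the two counits is then contracted
  by \<open>counit_mult1\<close> (for \<open>\<epsilon>\<^sub>t\<close>: by \<open>counit_mult2\<close>).
\<close>

lemma mult_eps_s':
  assumes x: "x \<in> carrier H" and h: "h \<in> carrier H"
  shows "x \<otimes>\<^bsub>H\<^esub> eps_s' K H h = sw H (\<lambda>a b. counit H (b \<otimes>\<^bsub>H\<^esub> h) \<odot>\<^bsub>H\<^esub> a) x"
proof -
  \<comment> \<open>The legs are \<open>c = x_1\<close>, \<open>d = x_2\<close>,
    \<open>e = 1_1\<close>, \<open>f = 1_2\<close>, \<open>b = 1_3\<close>.\<close>
  let ?T = "\<lambda>c d e f b. (counit H (d \<otimes>\<^bsub>H\<^esub> f) \<otimes>\<^bsub>K\<^esub> counit H (b \<otimes>\<^bsub>H\<^esub> h)) \<odot>\<^bsub>H\<^esub> (c \<otimes>\<^bsub>H\<^esub> e)"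
  have T: "bilin K H H H (\<lambda>c d. ?T c d e f b)" "bilin K H H H (\<lambda>e f. ?T c d e f b)" "bilin K H H H (\<lambda>f b. ?T c d e f b)"
    "(\<lambda>b. ?T c d e f b) \<in> linear_maps K H H"
    if "b \<in> carrier H" "c \<in> carrier H" "d \<in> carrier H" "e \<in> carrier H" "f \<in> carrier H" for b c d e f
    using that h by (intro bilinI linear_rules; simp)+
  \<comment> \<open>With \<open>a\<close> and \<open>b\<close> in the roles of the legs of
    \<open>\<Delta>(1)\<close>: the counit law writes \<open>x a\<close> as
    \<open>(x a)_1 \<epsilon>((x a)_2)\<close>, and multiplicativity of \<open>\<Delta>\<close>
    separates the legs of \<open>x\<close> from those of \<open>a\<close>.\<close>
  have 1: "counit H (b \<otimes>\<^bsub>H\<^esub> h) \<odot>\<^bsub>H\<^esub> (x \<otimes>\<^bsub>H\<^esub> a) = sw H (\<lambda>c d. sw H (\<lambda>e f. ?T c d e f b) a) x"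
    if ab: "a \<in> carrier H" "b \<in> carrier H" for a b
  proof -
    have f: "(\<lambda>y. counit H (b \<otimes>\<^bsub>H\<^esub> h) \<odot>\<^bsub>H\<^esub> y) \<in> linear_maps K H H"
      using ab h by (intro linear_rules) simp_all
    have "counit H (b \<otimes>\<^bsub>H\<^esub> h) \<odot>\<^bsub>H\<^esub> (x \<otimes>\<^bsub>H\<^esub> a) =
      sw H (\<lambda>p q. counit H q \<odot>\<^bsub>H\<^esub> (counit H (b \<otimes>\<^bsub>H\<^esub> h) \<odot>\<^bsub>H\<^esub> p)) (x \<otimes>\<^bsub>H\<^esub> a)"
      using ab x by (intro sw_counit_right[OF module_H f, symmetric]) simp
    also have "\<dots> = sw H (\<lambda>p q. (counit H q \<otimes>\<^bsub>K\<^esub> counit H (b \<otimes>\<^bsub>H\<^esub> h)) \<odot>\<^bsub>H\<^esub> p) (x \<otimes>\<^bsub>H\<^esub> a)"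
      using ab x h by (intro sw_cong bilinI linear_rules) (simp_all add: smult_assoc1)
    also have "\<dots> = sw H (\<lambda>c d. sw H (\<lambda>e f. ?T c d e f b) a) x"
      using ab x h by (intro sw_mult bilinI linear_rules) simp_all
    finally show ?thesis .
  qed
  have "x \<otimes>\<^bsub>H\<^esub> eps_s' K H h = sw H (\<lambda>a b. x \<otimes>\<^bsub>H\<^esub> (counit H (b \<otimes>\<^bsub>H\<^esub> h) \<odot>\<^bsub>H\<^esub> a)) \<one>\<^bsub>H\<^esub>"
    unfolding eps_s'_def
    by (rule sw_comp[OF module_H eps_bilin(2)[OF h] module_H linear_mult_right[OF x linear_id]]) simp
  also have "\<dots> = sw H (\<lambda>a b. sw H (\<lambda>c d. sw H (\<lambda>e f. ?T c d e f b) a) x) \<one>\<^bsub>H\<^esub>"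
  proof (rule sw_cong)
    have "bilin K H H H (\<lambda>a b. counit H (b \<otimes>\<^bsub>H\<^esub> h) \<odot>\<^bsub>H\<^esub> (x \<otimes>\<^bsub>H\<^esub> a))"
      using x h by (intro bilinI linear_rules) simp_all
    then show "bilin K H H H (\<lambda>a b. sw H (\<lambda>c d. sw H (\<lambda>e f. ?T c d e f b) a) x)"
      by (rule bilin_cong[OF _ _ module_H module_H]) (simp add: 1)
  qed (use x h in \<open>simp_all add: 1[symmetric] smult_mult_right module_H\<close>)
  \<comment> \<open>The sum over the legs of \<open>x\<close> is moved outside, so that
    coassociativity at 1 can be applied with \<open>x_1\<close> and \<open>x_2\<close>
    fixed.\<close>
  also have "\<dots> = sw H (\<lambda>c d. sw H (\<lambda>a b. sw H (\<lambda>e f. ?T c d e f b) a) \<one>\<^bsub>H\<^esub>) x"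
  proof (rule sw_swap)
    show "bilin K H H H (\<lambda>c d. sw H (\<lambda>e f. ?T c d e f b) a)" if "a \<in> carrier H" "b \<in> carrier H" for a b
      using that by (intro bilin_sw_integrand T module_H)
    show "bilin K H H H (\<lambda>a b. sw H (\<lambda>e f. ?T c d e f b) a)" if "c \<in> carrier H" "d \<in> carrier H" for c d
      using that by (intro bilinI linear_sw_integrand linear_sw linear_id T module_H)
  qed (use x in \<open>simp_all add: module_H\<close>)
  also have "\<dots> = sw H (\<lambda>c d. sw H (\<lambda>e y. counit H (d \<otimes>\<^bsub>H\<^esub> y \<otimes>\<^bsub>H\<^esub> h) \<odot>\<^bsub>H\<^esub> (c \<otimes>\<^bsub>H\<^esub> e)) \<one>\<^bsub>H\<^esub>) x"
  proof (rule sw_cong)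
    show "bilin K H H H (\<lambda>c d. sw H (\<lambda>e y. counit H (d \<otimes>\<^bsub>H\<^esub> y \<otimes>\<^bsub>H\<^esub> h) \<odot>\<^bsub>H\<^esub> (c \<otimes>\<^bsub>H\<^esub> e)) \<one>\<^bsub>H\<^esub>)"
      using h by (intro bilin_sw_integrand bilinI linear_rules) simp_all
    fix c d assume cd: "c \<in> carrier H" "d \<in> carrier H"
    have "sw H (\<lambda>a b. sw H (\<lambda>e f. ?T c d e f b) a) \<one>\<^bsub>H\<^esub> = sw H (\<lambda>e y. sw H (\<lambda>f b. ?T c d e f b) y) \<one>\<^bsub>H\<^esub>"
      using cd by (intro sw_coassoc module_H T) simp_all
    also have "\<dots> = sw H (\<lambda>e y. counit H (d \<otimes>\<^bsub>H\<^esub> y \<otimes>\<^bsub>H\<^esub> h) \<odot>\<^bsub>H\<^esub> (c \<otimes>\<^bsub>H\<^esub> e)) \<one>\<^bsub>H\<^esub>"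
      using cd h by (intro sw_cong bilinI linear_rules) (simp_all add: sw_counit_mult(1))
    finally show "sw H (\<lambda>a b. sw H (\<lambda>e f. ?T c d e f b) a) \<one>\<^bsub>H\<^esub> =
      sw H (\<lambda>e y. counit H (d \<otimes>\<^bsub>H\<^esub> y \<otimes>\<^bsub>H\<^esub> h) \<odot>\<^bsub>H\<^esub> (c \<otimes>\<^bsub>H\<^esub> e)) \<one>\<^bsub>H\<^esub>" .
  qed (use x in \<open>simp_all add: module_H\<close>)
  \<comment> \<open>After the contraction, \<open>\<epsilon>(x_2 1_2 h) x_1 1_1\<close> remains, in
    which the legs recombine to \<open>\<Delta>(x 1)\<close>.\<close>
  also have "\<dots> = sw H (\<lambda>a b. counit H (b \<otimes>\<^bsub>H\<^esub> h) \<odot>\<^bsub>H\<^esub> a) (x \<otimes>\<^bsub>H\<^esub> \<one>\<^bsub>H\<^esub>)"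
    by (rule sw_mult[OF module_H eps_bilin(2)[OF h] x, symmetric]) simp
  finally show ?thesis using x by simp
qed

end

text \<open>A tensor product depends on its factors only through carrier, addition and scalar
  action. This identifies products formed from records that differ in \<open>mult\<close>,
  \<open>one\<close> or \<open>act\<close>, such as \<open>tensor_algebra\<close> and
  \<open>tensor\<close>.\<close>

lemma tensor_cong:
  assumes "carrier M = carrier M'" "add M = add M'" "smult M = smult M'"
    and "carrier N = carrier N'" "add N = add N'" "smult N = smult N'"
  shows "tensor K M N = tensor K M' N'" and "pure_tensor K M N = pure_tensor K M' N'"
proof -
  have "tensor_relations K M N = tensor_relations K M' N'"
    by (simp add: tensor_relations_def assms)
  then have "tensor_kernel K M N = tensor_kernel K M' N'"
    by (simp add: tensor_kernel_def assms)
  then show "tensor K M N = tensor K M' N'" "pure_tensor K M N = pure_tensor K M' N'"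
    by (simp_all add: tensor_def pure_tensor_def fun_eq_iff assms)
qed

text \<open>Two different acting spaces \<open>G\<close> and \<open>G'\<close> are allowed, since
  the product of the threefold tensor algebra is the joint action of \<open>H\<close> and of
  \<open>H \<otimes> H\<close>.\<close>

lemma tensor_act_bilin:
  assumes G: "module K G" and G': "module K G'" and M: "module K M" and N: "module K N"
    and a: "bilin K G M M a" and b: "bilin K G' N N b"
  shows "bilin K (tensor K G G') (tensor K M N) (tensor K M N) (tensor_act K M N a b)"
    and "\<lbrakk>g \<in> carrier G; g' \<in> carrier G'; t \<in> carrier (tensor K M N)\<rbrakk> \<Longrightarrow>
      tensor_act K M N a b (pure_tensor K G G' g g') t = tensor_map K M N (a g) (b g') t"
proof -
  note MN = module_tensor[OF M N]
  let ?T = "tensor K M N" and ?p = "pure_tensor K M N"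
  have tm: "tensor_map K M N (a g) (b g') \<in> linear_maps K ?T ?T" if "g \<in> carrier G" "g' \<in> carrier G'" for g g'
    using that by (intro tensor_map_linear M N bilin_right[OF a] bilin_right[OF b])
  have p1: "bilin K M N ?T (\<lambda>m n. ?p (a g m) (b g' n))" if "g \<in> carrier G" "g' \<in> carrier G'" for g g'
    using that by (intro tensor_map_linear M N bilin_right[OF a] bilin_right[OF b])
  have p2: "bilin K G G' ?T (\<lambda>g g'. ?p (a g m) (b g' n))" if "m \<in> carrier M" "n \<in> carrier N" for m n
    using that by (intro tensor_map_linear M N G G' bilin_left[OF a] bilin_left[OF b])
  have B: "bilin K G G' ?T (\<lambda>g g'. tensor_map K M N (a g) (b g') t)" if "t \<in> carrier ?T" for t
    unfolding tensor_map_def by (rule bilin_tensor_lift_integrand[OF M N G G' MN p1 p2 that])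
  show "bilin K (tensor K G G') ?T ?T (tensor_act K M N a b)"
    unfolding tensor_act_def
    by (intro bilinI tensor_lift_linear[OF G G' MN B] linear_tensor_lift_integrand[OF G G' MN MN B] tm)
  show "tensor_act K M N a b (pure_tensor K G G' g g') t = tensor_map K M N (a g) (b g') t"
    if "g \<in> carrier G" "g' \<in> carrier G'" "t \<in> carrier ?T"
    unfolding tensor_act_def by (rule tensor_lift_pure[OF G G' MN B[OF that(3)] that(1,2)])
qed

context weak_bialgebra
begin

text \<open>Mirror image of the argument for \<open>mult_eps_s'\<close>: the counit is inserted at
  the first leg of \<open>x 1_2\<close>, and coassociativity is used in the opposite
  direction.\<close>

lemma mult_eps_t:
  assumes x: "x \<in> carrier H" and h: "h \<in> carrier H"
  shows "x \<otimes>\<^bsub>H\<^esub> eps_t K H h = sw H (\<lambda>a b. counit H (a \<otimes>\<^bsub>H\<^esub> h) \<odot>\<^bsub>H\<^esub> b) x"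
proof -
  \<comment> \<open>The legs are \<open>c = x_1\<close>, \<open>d = x_2\<close>,
    \<open>a = 1_1\<close>, \<open>e = 1_2\<close>, \<open>f = 1_3\<close>.\<close>
  let ?T = "\<lambda>c d a e f. (counit H (c \<otimes>\<^bsub>H\<^esub> e) \<otimes>\<^bsub>K\<^esub> counit H (a \<otimes>\<^bsub>H\<^esub> h)) \<odot>\<^bsub>H\<^esub> (d \<otimes>\<^bsub>H\<^esub> f)"
  have T: "bilin K H H H (\<lambda>c d. ?T c d a e f)" "bilin K H H H (\<lambda>e f. ?T c d a e f)" "bilin K H H H (\<lambda>a e. ?T c d a e f)"
    "(\<lambda>a. ?T c d a e f) \<in> linear_maps K H H"
    if "a \<in> carrier H" "c \<in> carrier H" "d \<in> carrier H" "e \<in> carrier H" "f \<in> carrier H" for a c d e f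
    using that h by (intro bilinI linear_rules; simp)+
  have 1: "counit H (a \<otimes>\<^bsub>H\<^esub> h) \<odot>\<^bsub>H\<^esub> (x \<otimes>\<^bsub>H\<^esub> b) = sw H (\<lambda>c d. sw H (\<lambda>e f. ?T c d a e f) b) x"
    if ab: "a \<in> carrier H" "b \<in> carrier H" for a b
  proof -
    have f: "(\<lambda>y. counit H (a \<otimes>\<^bsub>H\<^esub> h) \<odot>\<^bsub>H\<^esub> y) \<in> linear_maps K H H"
      using ab h by (intro linear_rules) simp_all
    have "counit H (a \<otimes>\<^bsub>H\<^esub> h) \<odot>\<^bsub>H\<^esub> (x \<otimes>\<^bsub>H\<^esub> b) =
      sw H (\<lambda>p q. counit H p \<odot>\<^bsub>H\<^esub> (counit H (a \<otimes>\<^bsub>H\<^esub> h) \<odot>\<^bsub>H\<^esub> q)) (x \<otimes>\<^bsub>H\<^esub> b)"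
      using ab x by (intro sw_counit_left[OF module_H f, symmetric]) simp
    also have "\<dots> = sw H (\<lambda>p q. (counit H p \<otimes>\<^bsub>K\<^esub> counit H (a \<otimes>\<^bsub>H\<^esub> h)) \<odot>\<^bsub>H\<^esub> q) (x \<otimes>\<^bsub>H\<^esub> b)"
      using ab x h by (intro sw_cong bilinI linear_rules) (simp_all add: smult_assoc1)
    also have "\<dots> = sw H (\<lambda>c d. sw H (\<lambda>e f. ?T c d a e f) b) x"
      using ab x h by (intro sw_mult bilinI linear_rules) simp_all
    finally show ?thesis .
  qed
  have "x \<otimes>\<^bsub>H\<^esub> eps_t K H h = sw H (\<lambda>a b. x \<otimes>\<^bsub>H\<^esub> (counit H (a \<otimes>\<^bsub>H\<^esub> h) \<odot>\<^bsub>H\<^esub> b)) \<one>\<^bsub>H\<^esub>"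
    unfolding eps_t_def
    by (rule sw_comp[OF module_H eps_bilin(1)[OF h] module_H linear_mult_right[OF x linear_id]]) simp
  also have "\<dots> = sw H (\<lambda>a b. sw H (\<lambda>c d. sw H (\<lambda>e f. ?T c d a e f) b) x) \<one>\<^bsub>H\<^esub>"
  proof (rule sw_cong)
    have "bilin K H H H (\<lambda>a b. counit H (a \<otimes>\<^bsub>H\<^esub> h) \<odot>\<^bsub>H\<^esub> (x \<otimes>\<^bsub>H\<^esub> b))"
      using x h by (intro bilinI linear_rules) simp_all
    then show "bilin K H H H (\<lambda>a b. sw H (\<lambda>c d. sw H (\<lambda>e f. ?T c d a e f) b) x)"
      by (rule bilin_cong[OF _ _ module_H module_H]) (simp add: 1)
  qed (use x h in \<open>simp_all add: 1[symmetric] smult_mult_right module_H\<close>)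
  also have "\<dots> = sw H (\<lambda>c d. sw H (\<lambda>a b. sw H (\<lambda>e f. ?T c d a e f) b) \<one>\<^bsub>H\<^esub>) x"
  proof (rule sw_swap)
    show "bilin K H H H (\<lambda>c d. sw H (\<lambda>e f. ?T c d a e f) b)" if "a \<in> carrier H" "b \<in> carrier H" for a b
      using that by (intro bilin_sw_integrand T module_H)
    show "bilin K H H H (\<lambda>a b. sw H (\<lambda>e f. ?T c d a e f) b)" if "c \<in> carrier H" "d \<in> carrier H" for c d
      using that by (intro bilinI linear_sw_integrand linear_sw linear_id T module_H)
  qed (use x in \<open>simp_all add: module_H\<close>)
  also have "\<dots> = sw H (\<lambda>c d. sw H (\<lambda>y f. counit H (c \<otimes>\<^bsub>H\<^esub> y \<otimes>\<^bsub>H\<^esub> h) \<odot>\<^bsub>H\<^esub> (d \<otimes>\<^bsub>H\<^esub> f)) \<one>\<^bsub>H\<^esub>) x"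
  proof (rule sw_cong)
    show "bilin K H H H (\<lambda>c d. sw H (\<lambda>y f. counit H (c \<otimes>\<^bsub>H\<^esub> y \<otimes>\<^bsub>H\<^esub> h) \<odot>\<^bsub>H\<^esub> (d \<otimes>\<^bsub>H\<^esub> f)) \<one>\<^bsub>H\<^esub>)"
      using h by (intro bilin_sw_integrand bilinI linear_rules) simp_all
    fix c d assume cd: "c \<in> carrier H" "d \<in> carrier H"
    have "sw H (\<lambda>a b. sw H (\<lambda>e f. ?T c d a e f) b) \<one>\<^bsub>H\<^esub> = sw H (\<lambda>y f. sw H (\<lambda>a e. ?T c d a e f) y) \<one>\<^bsub>H\<^esub>"
      using cd by (intro sw_coassoc[symmetric] module_H T) simp_all
    also have "\<dots> = sw H (\<lambda>y f. counit H (c \<otimes>\<^bsub>H\<^esub> y \<otimes>\<^bsub>H\<^esub> h) \<odot>\<^bsub>H\<^esub> (d \<otimes>\<^bsub>H\<^esub> f)) \<one>\<^bsub>H\<^esub>"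
      using cd h by (intro sw_cong bilinI linear_rules) (simp_all add: sw_counit_mult(2))
    finally show "sw H (\<lambda>a b. sw H (\<lambda>e f. ?T c d a e f) b) \<one>\<^bsub>H\<^esub> =
      sw H (\<lambda>y f. counit H (c \<otimes>\<^bsub>H\<^esub> y \<otimes>\<^bsub>H\<^esub> h) \<odot>\<^bsub>H\<^esub> (d \<otimes>\<^bsub>H\<^esub> f)) \<one>\<^bsub>H\<^esub>" .
  qed (use x in \<open>simp_all add: module_H\<close>)
  also have "\<dots> = sw H (\<lambda>a b. counit H (a \<otimes>\<^bsub>H\<^esub> h) \<odot>\<^bsub>H\<^esub> b) (x \<otimes>\<^bsub>H\<^esub> \<one>\<^bsub>H\<^esub>)"
    by (rule sw_mult[OF module_H eps_bilin(1)[OF h] x, symmetric]) simp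
  finally show ?thesis using x by simp
qed

lemma sw_eps_balanced:
  assumes W: "module K W" and B: "bilin K H H W B" and u: "u \<in> carrier H" and h: "h \<in> carrier H"
  shows "sw W (\<lambda>a b. B (a \<otimes>\<^bsub>H\<^esub> eps_s' K H h) b) u = sw W (\<lambda>a b. B a (b \<otimes>\<^bsub>H\<^esub> eps_t K H h)) u"
proof -
  \<comment> \<open>The common value \<open>\<epsilon>(u_2 h) B(u_1, u_3)\<close>. The side with
    \<open>\<epsilon>\<^sub>s'\<close> reaches it by splitting the first leg of
    \<open>\<Delta>(u)\<close>, the side with \<open>\<epsilon>\<^sub>t\<close> by splitting the
    second.\<close>
  let ?T = "\<lambda>c d e. counit H (d \<otimes>\<^bsub>H\<^esub> h) \<odot>\<^bsub>W\<^esub> B c e"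
  note rules = linear_rules W linear_bilin_left[OF B] linear_bilin_right[OF B]
  note [simp] = bilin_closed[OF B]
  have 1: "B (a \<otimes>\<^bsub>H\<^esub> eps_s' K H h) b = sw W (\<lambda>c d. ?T c d b) a"
    if ab: "a \<in> carrier H" "b \<in> carrier H" for a b
  proof -
    have "B (a \<otimes>\<^bsub>H\<^esub> eps_s' K H h) b = sw W (\<lambda>c d. B (counit H (d \<otimes>\<^bsub>H\<^esub> h) \<odot>\<^bsub>H\<^esub> c) b) a"
      unfolding mult_eps_s'[OF ab(1) h]
      by (rule sw_comp[OF module_H eps_bilin(2)[OF h] W bilin_left[OF B ab(2)] ab(1)])
    also have "\<dots> = sw W (\<lambda>c d. ?T c d b) a"
      using ab h by (intro sw_cong bilinI rules) (simp_all add: linear_maps_smult[OF bilin_left[OF B]])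
    finally show ?thesis .
  qed
  have 2: "B a (b \<otimes>\<^bsub>H\<^esub> eps_t K H h) = sw W (\<lambda>d e. ?T a d e) b"
    if ab: "a \<in> carrier H" "b \<in> carrier H" for a b
  proof -
    have "B a (b \<otimes>\<^bsub>H\<^esub> eps_t K H h) = sw W (\<lambda>d e. B a (counit H (d \<otimes>\<^bsub>H\<^esub> h) \<odot>\<^bsub>H\<^esub> e)) b"
      unfolding mult_eps_t[OF ab(2) h]
      by (rule sw_comp[OF module_H eps_bilin(1)[OF h] W bilin_right[OF B ab(1)] ab(2)])
    also have "\<dots> = sw W (\<lambda>d e. ?T a d e) b"
      using ab h by (intro sw_cong bilinI rules) (simp_all add: linear_maps_smult[OF bilin_right[OF B]])
    finally show ?thesis .
  qed
  have T: "bilin K H H W (\<lambda>c d. ?T c d e)" "bilin K H H W (\<lambda>d e'. ?T e d e')" if "e \<in> carrier H" for e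
    using that h by (intro bilinI rules; simp)+
  have "sw W (\<lambda>a b. B (a \<otimes>\<^bsub>H\<^esub> eps_s' K H h) b) u = sw W (\<lambda>a b. sw W (\<lambda>c d. ?T c d b) a) u"
    using h u by (intro sw_cong[symmetric] bilinI rules) (simp_all add: 1)
  also have "\<dots> = sw W (\<lambda>a b. sw W (\<lambda>d e. ?T a d e) b) u"
    by (rule sw_coassoc[OF W T u])
  also have "\<dots> = sw W (\<lambda>a b. B a (b \<otimes>\<^bsub>H\<^esub> eps_t K H h)) u"
    using h u by (intro sw_cong bilinI rules) (simp_all add: 2)
  finally show ?thesis .
qed

text \<open>With a second copy of \<open>\<Delta>(1)\<close> for \<open>\<epsilon>\<^sub>t\<close>,
  the left side is \<open>\<epsilon>(1'_1 1_1) 1'_2 1_2\<close>: the counit applied to the first leg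
  of \<open>\<Delta>(1)\<Delta>(1) = \<Delta>(1)\<close>.\<close>

lemma sw_eps_t_mult: "sw H (\<lambda>a b. eps_t K H a \<otimes>\<^bsub>H\<^esub> b) \<one>\<^bsub>H\<^esub> = \<one>\<^bsub>H\<^esub>"
proof -
  have 1: "eps_t K H a \<otimes>\<^bsub>H\<^esub> b = sw H (\<lambda>c d. counit H (c \<otimes>\<^bsub>H\<^esub> a) \<odot>\<^bsub>H\<^esub> (d \<otimes>\<^bsub>H\<^esub> b)) \<one>\<^bsub>H\<^esub>"
    if ab: "a \<in> carrier H" "b \<in> carrier H" for a b
  proof -
    have "eps_t K H a \<otimes>\<^bsub>H\<^esub> b = sw H (\<lambda>c d. (counit H (c \<otimes>\<^bsub>H\<^esub> a) \<odot>\<^bsub>H\<^esub> d) \<otimes>\<^bsub>H\<^esub> b) \<one>\<^bsub>H\<^esub>"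
      unfolding eps_t_def
      by (rule sw_comp[OF module_H eps_bilin(1)[OF ab(1)] module_H linear_mult_left[OF linear_id ab(2)]]) simp
    also have "\<dots> = sw H (\<lambda>c d. counit H (c \<otimes>\<^bsub>H\<^esub> a) \<odot>\<^bsub>H\<^esub> (d \<otimes>\<^bsub>H\<^esub> b)) \<one>\<^bsub>H\<^esub>"
      using ab by (intro sw_cong bilinI linear_rules) (simp_all add: smult_mult_left)
    finally show ?thesis .
  qed
  have "sw H (\<lambda>a b. eps_t K H a \<otimes>\<^bsub>H\<^esub> b) \<one>\<^bsub>H\<^esub> =
    sw H (\<lambda>a b. sw H (\<lambda>c d. counit H (c \<otimes>\<^bsub>H\<^esub> a) \<odot>\<^bsub>H\<^esub> (d \<otimes>\<^bsub>H\<^esub> b)) \<one>\<^bsub>H\<^esub>) \<one>\<^bsub>H\<^esub>"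
    by (intro sw_cong[symmetric] bilinI linear_mult_left linear_mult_right eps_t_linear linear_id) (simp_all add: 1 module_H)
  also have "\<dots> = sw H (\<lambda>c d. sw H (\<lambda>a b. counit H (c \<otimes>\<^bsub>H\<^esub> a) \<odot>\<^bsub>H\<^esub> (d \<otimes>\<^bsub>H\<^esub> b)) \<one>\<^bsub>H\<^esub>) \<one>\<^bsub>H\<^esub>"
    by (intro sw_swap bilinI linear_rules) simp_all
  also have "\<dots> = sw H (\<lambda>p q. counit H p \<odot>\<^bsub>H\<^esub> q) (\<one>\<^bsub>H\<^esub> \<otimes>\<^bsub>H\<^esub> \<one>\<^bsub>H\<^esub>)"
    by (intro sw_mult[symmetric] bilinI linear_rules) simp_all
  also have "\<dots> = \<one>\<^bsub>H\<^esub>"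
    by (simp add: counit_left)
  finally show ?thesis .
qed

lemma mult_bilin: "bilin K H H H (mult H)"
  by (intro bilinI linear_rules)

text \<open>Apply the counit to the middle tensor factor of the first identity of \<open>comult_one\<close>.\<close>

lemma sw_eps_s'_one:
  assumes W: "module K W" and B: "bilin K H H W B"
  shows "sw W B \<one>\<^bsub>H\<^esub> = sw W (\<lambda>a b. B (eps_s' K H a) b) \<one>\<^bsub>H\<^esub>"
proof -
  let ?HH = "tensor K H H"
  let ?HHH = "tensor K H ?HH"
  let ?D = "comult H \<one>\<^bsub>H\<^esub>"
  let ?act = "tensor_act K H H (mult H) (mult H)"
  \<comment> \<open>\<open>?T\<close> and the induced map \<open>?\<Theta>\<close> apply the counit
    to the middle factor and \<open>B\<close> to the outer two.\<close>
  let ?T = "\<lambda>c d e. counit H d \<odot>\<^bsub>W\<^esub> B c e"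
  let ?\<Theta> = "tensor_lift K W (\<lambda>c y. tensor_lift K W (\<lambda>d e. ?T c d e) y)"
  let ?X = "tensor_assoc K H H H (pure_tensor K ?HH H ?D \<one>\<^bsub>H\<^esub>)"
  let ?Y = "pure_tensor K H ?HH \<one>\<^bsub>H\<^esub> ?D"
  note rules = linear_rules W linear_bilin_left[OF B] linear_bilin_right[OF B]
  note [simp] = bilin_closed[OF B]
  note assoc = tensor_assoc_linear[OF module_H module_H module_H]
  have D: "?D \<in> carrier ?HH" by (simp add: comult_closed)
  note act = tensor_act_bilin[OF module_H module_H module_H module_H mult_bilin mult_bilin]
  note act2 = tensor_act_bilin[OF module_H module_HH module_H module_HH mult_bilin act(1)]
  have Y: "?Y \<in> carrier ?HHH"
    by (intro pure_tensor_closed module_H module_HH D) simp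
  have T2: "bilin K H H W (\<lambda>d e. ?T c d e)" if "c \<in> carrier H" for c
    using that by (intro bilinI rules) simp_all
  have \<Theta>: "bilin K H ?HH W (\<lambda>c y. tensor_lift K W (\<lambda>d e. ?T c d e) y)"
    by (intro bilinI tensor_lift_linear[OF module_H module_H W T2]
        linear_tensor_lift_integrand[OF module_H module_H module_H W T2] rules) simp_all
  note \<Theta>_linear = tensor_lift_linear[OF module_H module_HH W \<Theta>]
  have id: "id \<in> linear_maps K H H" using linear_id[of K H] by (simp add: id_def)
  \<comment> \<open>\<open>comult_one\<close> forms its products over \<open>tensor_algebra\<close>;
    these identifications bring it to plain tensor products, where the lifting lemmas apply.\<close>
  have algebra: "tensor K M (tensor_algebra K H H) = tensor K M ?HH"
    "pure_tensor K M (tensor_algebra K H H) = pure_tensor K M ?HH"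
    "pure_tensor K (tensor_algebra K H H) M = pure_tensor K ?HH M" for M :: "('k, 'h, 'z) bialg_scheme"
    by (rule tensor_cong; simp add: tensor_algebra_def)+
  have "tensor_map K H ?HH id (comult H) ?D = tensor_act K H ?HH (mult H) ?act ?X ?Y"
    using comult_one[unfolded Let_def, THEN conjunct1]
    by (simp add: tensor_algebra_def[of K H "tensor_algebra K H H"] tensor_map_def tensor_act_def algebra)
      (simp add: tensor_algebra_def tensor_act_def tensor_map_def)
  note one = arg_cong[OF this, of ?\<Theta>]
  \<comment> \<open>On this side \<open>?\<Theta>\<close> gives
    \<open>\<epsilon>(1_2) B(1_1, 1_3)\<close>, which the counit law shortens.\<close>
  have "?\<Theta> (tensor_map K H ?HH id (comult H) ?D) = sw W (\<lambda>c y. ?\<Theta> (pure_tensor K H ?HH (id c) (comult H y))) \<one>\<^bsub>H\<^esub>"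
    unfolding tensor_map_def
    by (rule sw_comp[OF module_HHH tensor_map_linear(3)[OF module_H module_H module_H module_HH id comult_linear] W \<Theta>_linear])
      simp
  also have "\<dots> = sw W B \<one>\<^bsub>H\<^esub>"
    by (rule sw_cong[OF W B])
      (simp_all add: tensor_lift_pure[OF module_H module_HH W \<Theta>] comult_closed sw_counit_left[OF W bilin_right[OF B]])
  finally have lhs: "?\<Theta> (tensor_map K H ?HH id (comult H) ?D) = sw W B \<one>\<^bsub>H\<^esub>" .
  \<comment> \<open>Right multiplication by \<open>?Y\<close> followed by \<open>?\<Theta>\<close>.
    As \<open>?X\<close> is a sum of terms \<open>a \<otimes> (b \<otimes> 1)\<close>, the linear
    map \<open>?G\<close> has to be computed on such terms only.\<close>
  let ?G = "\<lambda>x. ?\<Theta> (tensor_act K H ?HH (mult H) ?act x ?Y)"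
  have G: "?G \<in> linear_maps K ?HHH W"
    by (rule linear_maps_comp[OF bilin_left[OF act2(1) Y] \<Theta>_linear])
  have G_pure: "?G (pure_tensor K H ?HH a (pure_tensor K H H b \<one>\<^bsub>H\<^esub>)) = sw W (\<lambda>d e. counit H (b \<otimes>\<^bsub>H\<^esub> d) \<odot>\<^bsub>W\<^esub> B a e) \<one>\<^bsub>H\<^esub>"
    if ab: "a \<in> carrier H" "b \<in> carrier H" for a b
  proof -
    let ?b1 = "pure_tensor K H H b \<one>\<^bsub>H\<^esub>"
    have b1: "?b1 \<in> carrier ?HH" using ab by (intro pure_tensor_closed module_H) simp_all
    note tm = linear_mult_right[OF _ linear_id]
    have "tensor_act K H ?HH (mult H) ?act (pure_tensor K H ?HH a ?b1) ?Y =
      tensor_map K H ?HH (mult H a) (?act ?b1) ?Y"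
      by (rule act2(2)[OF ab(1) b1 Y])
    also have "\<dots> = pure_tensor K H ?HH (a \<otimes>\<^bsub>H\<^esub> \<one>\<^bsub>H\<^esub>) (?act ?b1 ?D)"
      by (rule tensor_map_linear(2)[OF module_H module_HH module_H module_HH
            bilin_right[OF mult_bilin ab(1)] bilin_right[OF act(1) b1] one_closed D])
    also have "?act ?b1 ?D = tensor_map K H H (mult H b) (mult H \<one>\<^bsub>H\<^esub>) ?D"
      by (rule act(2)[OF ab(2) one_closed D])
    finally have "?G (pure_tensor K H ?HH a ?b1) =
      tensor_lift K W (\<lambda>d e. ?T a d e) (tensor_map K H H (mult H b) (mult H \<one>\<^bsub>H\<^esub>) ?D)"
      using ab D by (simp add: tensor_lift_pure[OF module_H module_HH W \<Theta>]
          linear_maps_closed[OF tensor_map_linear(1)[OF module_H module_H module_H module_H tm tm]])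
    also have "\<dots> = sw W (\<lambda>m n. tensor_lift K W (\<lambda>d e. ?T a d e) (pure_tensor K H H (b \<otimes>\<^bsub>H\<^esub> m) (\<one>\<^bsub>H\<^esub> \<otimes>\<^bsub>H\<^esub> n))) \<one>\<^bsub>H\<^esub>"
      unfolding tensor_map_def using ab
      by (intro sw_comp[OF module_HH tensor_map_linear(3)[OF module_H module_H module_H module_H tm tm] W
            tensor_lift_linear[OF module_H module_H W T2]]) simp_all
    also have "\<dots> = sw W (\<lambda>d e. counit H (b \<otimes>\<^bsub>H\<^esub> d) \<odot>\<^bsub>W\<^esub> B a e) \<one>\<^bsub>H\<^esub>"
      using ab by (intro sw_cong bilinI rules) (simp_all add: tensor_lift_pure[OF module_H module_H W T2])
    finally show ?thesis .
  qed
  have "?G ?X = sw W (\<lambda>a b. ?G (pure_tensor K H ?HH a (pure_tensor K H H b \<one>\<^bsub>H\<^esub>))) \<one>\<^bsub>H\<^esub>"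
    unfolding assoc(2)[OF D one_closed]
    by (rule sw_comp[OF module_HHH assoc(3)[OF one_closed] W G one_closed])
  also have "\<dots> = sw W (\<lambda>a b. sw W (\<lambda>d e. counit H (b \<otimes>\<^bsub>H\<^esub> d) \<odot>\<^bsub>W\<^esub> B a e) \<one>\<^bsub>H\<^esub>) \<one>\<^bsub>H\<^esub>"
    by (intro sw_cong bilin_sw_integrand bilinI rules) (simp_all add: G_pure)
  \<comment> \<open>Two copies of \<open>\<Delta>(1)\<close> are present, in the form
    \<open>\<epsilon>(1_2 1'_1) B(1_1, 1'_2)\<close>. With the unprimed sum inside, its value is
    \<open>B(\<epsilon>\<^sub>s'(1'_1), 1'_2)\<close>.\<close>
  also have "\<dots> = sw W (\<lambda>d e. sw W (\<lambda>a b. counit H (b \<otimes>\<^bsub>H\<^esub> d) \<odot>\<^bsub>W\<^esub> B a e) \<one>\<^bsub>H\<^esub>) \<one>\<^bsub>H\<^esub>"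
    by (intro sw_swap bilinI rules) simp_all
  also have "\<dots> = sw W (\<lambda>d e. B (eps_s' K H d) e) \<one>\<^bsub>H\<^esub>"
  proof (rule sw_cong[OF W])
    show "bilin K H H W (\<lambda>d e. B (eps_s' K H d) e)"
      by (intro bilinI linear_bilin_left[OF B eps_s'_linear] linear_bilin_right[OF B]) (simp_all add: linear_id)
    fix d e assume de: "d \<in> carrier H" "e \<in> carrier H"
    have "B (eps_s' K H d) e = sw W (\<lambda>a b. B (counit H (b \<otimes>\<^bsub>H\<^esub> d) \<odot>\<^bsub>H\<^esub> a) e) \<one>\<^bsub>H\<^esub>"
      unfolding eps_s'_def
      by (rule sw_comp[OF module_H eps_bilin(2)[OF de(1)] W bilin_left[OF B de(2)] one_closed])
    also have "\<dots> = sw W (\<lambda>a b. counit H (b \<otimes>\<^bsub>H\<^esub> d) \<odot>\<^bsub>W\<^esub> B a e) \<one>\<^bsub>H\<^esub>"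
      using de by (intro sw_cong bilinI rules) (simp_all add: linear_maps_smult[OF bilin_left[OF B]])
    finally show "sw W (\<lambda>a b. counit H (b \<otimes>\<^bsub>H\<^esub> d) \<odot>\<^bsub>W\<^esub> B a e) \<one>\<^bsub>H\<^esub> = B (eps_s' K H d) e" ..
  qed simp
  finally show ?thesis using one lhs by simp
qed

end

section \<open>Diagonal actions\<close>

lemma module_cong:
  assumes "module K M"
    and eq: "carrier M' = carrier M" "add M' = add M" "zero M' = zero M" "smult M' = smult M"
  shows "module K M'"
proof -
  interpret module K M by fact
  have "\<exists>y\<in>carrier M. y \<oplus>\<^bsub>M\<^esub> x = \<zero>\<^bsub>M\<^esub>" if "x \<in> carrier M" for x
    using that by (intro bexI[of _ "\<ominus>\<^bsub>M\<^esub> x"]) (simp_all add: M.l_neg)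
  then show ?thesis
    by (intro moduleI abelian_groupI R.is_cring)
      (simp_all add: eq M.a_ac smult_l_distr smult_r_distr smult_assoc1)
qed

lemma with_act_simps [simp]:
  "carrier (with_act M a) = carrier M" "add (with_act M a) = add M" "zero (with_act M a) = zero M"
  "smult (with_act M a) = smult M" "act (with_act M a) = a"
  by (simp_all add: with_act_def)

lemma module_with_act [simp]: "module K (with_act M a) \<longleftrightarrow> module K M"
  using module_cong[of K M "with_act M a"] module_cong[of K "with_act M a" M] by auto

lemma linear_maps_with_act [simp]:
  "linear_maps K (with_act M a) N = linear_maps K M N"
  "linear_maps K M (with_act N b) = linear_maps K M N"
  by (simp_all add: linear_maps_def)

lemma bilin_with_act [simp]:
  "bilin K (with_act M a) N W B = bilin K M N W B"
  "bilin K M (with_act N b) W B = bilin K M N W B"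
  "bilin K M N (with_act W c) B = bilin K M N W B"
  by (simp_all add: bilin_def)

lemma tensor_with_act [simp]:
  "tensor K (with_act M a) N = tensor K M N" "tensor K M (with_act N b) = tensor K M N"
  "pure_tensor K (with_act M a) N = pure_tensor K M N" "pure_tensor K M (with_act N b) = pure_tensor K M N"
  by (rule tensor_cong; simp)+

lemma tensor_map_with_act [simp]:
  "tensor_map K (with_act M a) N = tensor_map K M N" "tensor_map K M (with_act N b) = tensor_map K M N"
  by (simp_all add: tensor_map_def fun_eq_iff)

lemma tensor_map_comp:
  assumes M: "module K M" "module K M'" "module K M''" and N: "module K N" "module K N'" "module K N''"
    and f: "f \<in> linear_maps K M M'" "f' \<in> linear_maps K M' M''"
    and g: "g \<in> linear_maps K N N'" "g' \<in> linear_maps K N' N''"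
    and t: "t \<in> carrier (tensor K M N)"
  shows "tensor_map K M'' N'' f' g' (tensor_map K M' N' f g t) = tensor_map K M'' N'' (\<lambda>x. f' (f x)) (\<lambda>x. g' (g x)) t"
proof (rule tensor_ext[OF M(1) N(1) module_tensor[OF M(3) N(3)] _ _ _ t])
  note 1 = tensor_map_linear[OF M(1) N(1) M(2) N(2) f(1) g(1)]
  note 2 = tensor_map_linear[OF M(2) N(2) M(3) N(3) f(2) g(2)]
  note 3 = tensor_map_linear[OF M(1) N(1) M(3) N(3) linear_maps_comp[OF f] linear_maps_comp[OF g]]
  show "(\<lambda>t. tensor_map K M'' N'' f' g' (tensor_map K M' N' f g t)) \<in> linear_maps K (tensor K M N) (tensor K M'' N'')"
    by (rule linear_maps_comp[OF 1(1) 2(1)])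
  show "tensor_map K M'' N'' (\<lambda>x. f' (f x)) (\<lambda>x. g' (g x)) \<in> linear_maps K (tensor K M N) (tensor K M'' N'')"
    by (rule 3(1))
  fix m n assume "m \<in> carrier M" "n \<in> carrier N"
  then show "tensor_map K M'' N'' f' g' (tensor_map K M' N' f g (pure_tensor K M N m n)) =
      tensor_map K M'' N'' (\<lambda>x. f' (f x)) (\<lambda>x. g' (g x)) (pure_tensor K M N m n)"
    by (simp add: 1(2) 2(2) 3(2) linear_maps_closed[OF f(1)] linear_maps_closed[OF g(1)])
qed

text \<open>The maps have to be identities on the carriers only: \<open>E\<close> is the identity on
  \<open>N \<odot> P\<close>, but in general not on all of \<open>N \<otimes> P\<close>.\<close>

lemma tensor_map_ident:
  assumes M: "module K M" and N: "module K N"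
    and f: "\<And>x. x \<in> carrier M \<Longrightarrow> f x = x" and g: "\<And>x. x \<in> carrier N \<Longrightarrow> g x = x"
    and t: "t \<in> carrier (tensor K M N)"
  shows "tensor_map K M N f g t = t"
proof (rule tensor_ext[OF M N module_tensor[OF M N] _ linear_id _ t])
  note tm = tensor_map_linear[OF M N M N linear_maps_cong[OF linear_id f M] linear_maps_cong[OF linear_id g N]]
  show "tensor_map K M N f g \<in> linear_maps K (tensor K M N) (tensor K M N)"
    by (rule tm(1))
  show "tensor_map K M N f g (pure_tensor K M N m n) = pure_tensor K M N m n"
    if "m \<in> carrier M" "n \<in> carrier N" for m n
    using that by (simp add: tm(2) f g)
qed

text \<open>Provides the vector space structure of \<open>M \<odot> N\<close>, the image of
  \<open>E\<close>, and of the unit object, the image of \<open>\<epsilon>\<^sub>t\<close>.\<close>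

lemma image_submodule:
  assumes M: "module K M" and N: "module K N" and f: "f \<in> linear_maps K M N"
  shows "submodule (f ` carrier M) K N"
proof -
  interpret M: module K M by fact
  interpret N: module K N by fact
  show ?thesis
  proof (rule N.submoduleI)
    show "f ` carrier M \<subseteq> carrier N" using linear_maps_closed[OF f] by blast
    show "\<zero>\<^bsub>N\<^esub> \<in> f ` carrier M"
      unfolding linear_maps_zero[OF M N f, symmetric] by (rule imageI[OF M.zero_closed])
    show "\<ominus>\<^bsub>N\<^esub> y \<in> f ` carrier M" if y: "y \<in> f ` carrier M" for y
    proof -
      obtain x where x: "x \<in> carrier M" "y = f x" using y by (rule imageE)
      have eq: "\<ominus>\<^bsub>N\<^esub> y = f (\<zero>\<^bsub>M\<^esub> \<ominus>\<^bsub>M\<^esub> x)"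
        unfolding linear_maps_minus[OF M N f M.zero_closed x(1)] linear_maps_zero[OF M N f] x(2)
        using linear_maps_closed[OF f x(1)] by (simp add: N.minus_eq)
      show ?thesis unfolding eq by (rule imageI[OF M.minus_closed[OF M.zero_closed x(1)]])
    qed
    show "x \<oplus>\<^bsub>N\<^esub> y \<in> f ` carrier M" if xy: "x \<in> f ` carrier M" "y \<in> f ` carrier M" for x y
    proof -
      obtain a where a: "a \<in> carrier M" "x = f a" using xy(1) by (rule imageE)
      obtain b where b: "b \<in> carrier M" "y = f b" using xy(2) by (rule imageE)
      show ?thesis
        unfolding a(2) b(2) linear_maps_add[OF f a(1) b(1), symmetric]
        by (rule imageI[OF M.add.m_closed[OF a(1) b(1)]])
    qed
    show "c \<odot>\<^bsub>N\<^esub> x \<in> f ` carrier M" if c: "c \<in> carrier K" and x: "x \<in> f ` carrier M" for c x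
    proof -
      obtain a where a: "a \<in> carrier M" "x = f a" using x by (rule imageE)
      show ?thesis
        unfolding a(2) linear_maps_smult[OF f c a(1), symmetric]
        by (rule imageI[OF M.smult_closed[OF c a(1)]])
    qed
  qed
qed

text \<open>
  On \<open>M \<otimes> N\<close> the diagonal action of a weak bialgebra is in general not unital; \<open>pre_module\<close> is
  \<open>left_module\<close> without the unit law.
\<close>

definition bilinear_act ::
  "('k, 'c) ring_scheme \<Rightarrow> ('k, 'h, 'z) module_scheme \<Rightarrow> ('k, 'h, 'm, 'y) hmodule_scheme \<Rightarrow> bool"
  where "bilinear_act K H M \<longleftrightarrow> module K M \<and> bilin K H M M (act M)"

definition pre_module ::
  "('k, 'c) ring_scheme \<Rightarrow> ('k, 'h, 'z) module_scheme \<Rightarrow> ('k, 'h, 'm, 'y) hmodule_scheme \<Rightarrow> bool"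
  where "pre_module K H M \<longleftrightarrow> bilinear_act K H M \<and>
    (\<forall>g\<in>carrier H. \<forall>h\<in>carrier H. \<forall>m\<in>carrier M. act M (g \<otimes>\<^bsub>H\<^esub> h) m = act M g (act M h m))"

text \<open>In contrast to \<open>left_hom\<close>, source and target may be non-unital. This admits
  the maps between \<open>M \<otimes> N\<close> and its two unital companions: \<open>E\<close>, the
  inclusion of \<open>M \<odot> N\<close> and the projection to
  \<open>M \<diamond> N\<close>.\<close>

definition pre_hom ::
  "('k, 'c) ring_scheme \<Rightarrow> ('k, 'h, 'z) module_scheme \<Rightarrow> ('k, 'h, 'm, 'x) hmodule_scheme
    \<Rightarrow> ('k, 'h, 'n, 'y) hmodule_scheme \<Rightarrow> ('m \<Rightarrow> 'n) set"
  where "pre_hom K H M N = {f \<in> linear_maps K M N. \<forall>h\<in>carrier H. \<forall>m\<in>carrier M. f (act M h m) = act N h (f m)}"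

text \<open>Packages \<open>M \<otimes> N\<close> with its diagonal action as a possible factor of a
  further diagonal action, so that \<open>\<Delta>\<close> can be iterated on threefold
  products.\<close>

definition tensor_hmodule ::
  "('k, 'c) ring_scheme \<Rightarrow> ('k, 'h, 'z) bialg_scheme \<Rightarrow> ('k, 'h, 'm, 'x) hmodule_scheme
    \<Rightarrow> ('k, 'h, 'n, 'y) hmodule_scheme \<Rightarrow> ('k, 'h, ('k, 'm, 'n) tensor) hmodule"
  where "tensor_hmodule K H M N = with_act (tensor K M N) (diagonal_act K H M N)"

lemma bilinear_actD:
  assumes "bilinear_act K H M"
  shows "module K M" "bilin K H M M (act M)"
  using assms by (auto simp: bilinear_act_def)

lemma pre_moduleD:
  assumes "pre_module K H M"
  shows "bilinear_act K H M" "module K M" "bilin K H M M (act M)"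
    "\<lbrakk>g \<in> carrier H; h \<in> carrier H; m \<in> carrier M\<rbrakk> \<Longrightarrow> act M (g \<otimes>\<^bsub>H\<^esub> h) m = act M g (act M h m)"
  using assms by (auto simp: pre_module_def bilinear_act_def)

lemma act_closed: "\<lbrakk>bilinear_act K H M; h \<in> carrier H; m \<in> carrier M\<rbrakk> \<Longrightarrow> act M h m \<in> carrier M"
  by (auto simp: bilinear_act_def intro: bilin_closed)

lemma pre_homD:
  assumes "f \<in> pre_hom K H M N"
  shows "f \<in> linear_maps K M N"
    "\<lbrakk>h \<in> carrier H; m \<in> carrier M\<rbrakk> \<Longrightarrow> f (act M h m) = act N h (f m)"
  using assms by (auto simp: pre_hom_def)

lemma pre_hom_id: "id \<in> pre_hom K H M M"
  using linear_id[of K M] by (simp_all add: pre_hom_def id_def)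

lemma left_module_iff:
  "left_module K H M \<longleftrightarrow> k_algebra K H \<and> pre_module K H M \<and> (\<forall>m\<in>carrier M. act M \<one>\<^bsub>H\<^esub> m = m)"
  (is "?L \<longleftrightarrow> ?R")
proof
  assume ?L
  then interpret left_module K H M .
  have M: "module K M" by (rule left_module.axioms(2)[OF \<open>?L\<close>])
  have "bilin K H M M (act M)"
    by (intro bilinI act_linear linear_mapsI) (simp_all add: act_add act_smult linear_maps_closed[OF act_linear])
  then show ?R
    by (simp add: pre_module_def bilinear_act_def act_mult act_one k_algebra_axioms M)
next
  assume R: ?R
  then have B: "bilin K H M M (act M)" and M: "module K M" by (auto dest: pre_moduleD)
  show ?L
    using R by (intro left_module.intro left_module_axioms.intro)
      (auto simp: M bilin_right[OF B] linear_maps_add[OF bilin_left[OF B]] linear_maps_smult[OF bilin_left[OF B]]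
        pre_module_def)
qed

lemma left_hom_pre_hom: "f \<in> left_hom K H M N \<Longrightarrow> f \<in> pre_hom K H M N"
  by (auto simp: left_hom_def pre_hom_def)

context weak_bialgebra
begin

context
  fixes M :: "('k, 'h, 'm, 'x) hmodule_scheme" and N :: "('k, 'h, 'n, 'y) hmodule_scheme"
  assumes M: "bilinear_act K H M" and N: "bilinear_act K H N"
begin

lemma module_tensor_hmodule: "module K (tensor K M N)"
  by (rule module_tensor[OF bilinear_actD(1)[OF M] bilinear_actD(1)[OF N]])

lemma diagonal_act_bilin: "bilin K H (tensor K M N) (tensor K M N) (diagonal_act K H M N)"
proof -
  note A = tensor_act_bilin(1)[OF module_H module_H bilinear_actD(1)[OF M] bilinear_actD(1)[OF N]
      bilinear_actD(2)[OF M] bilinear_actD(2)[OF N]]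
  show ?thesis
    unfolding diagonal_act_def
    by (intro bilinI linear_bilin_left[OF A comult_linear] bilin_right[OF A] comult_closed)
qed

lemma bilinear_act_tensor: "bilinear_act K H (tensor_hmodule K H M N)"
  by (simp add: bilinear_act_def tensor_hmodule_def module_tensor_hmodule diagonal_act_bilin)

lemma pure_act_bilin:
  assumes "m \<in> carrier M" "n \<in> carrier N"
  shows "bilin K H H (tensor K M N) (\<lambda>a b. pure_tensor K M N (act M a m) (act N b n))"
  by (rule tensor_map_linear(3)[OF module_H module_H bilinear_actD(1)[OF M] bilinear_actD(1)[OF N]
        bilin_left[OF bilinear_actD(2)[OF M] assms(1)] bilin_left[OF bilinear_actD(2)[OF N] assms(2)]])

lemma diagonal_act_pure:
  assumes "h \<in> carrier H" "m \<in> carrier M" "n \<in> carrier N"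
  shows "diagonal_act K H M N h (pure_tensor K M N m n) =
    sw (tensor K M N) (\<lambda>a b. pure_tensor K M N (act M a m) (act N b n)) h"
  unfolding diagonal_act_def tensor_act_def
  by (rule sw_cong[OF module_tensor_hmodule pure_act_bilin[OF assms(2,3)] _ assms(1)])
    (rule tensor_map_linear(2)[OF bilinear_actD(1)[OF M] bilinear_actD(1)[OF N] bilinear_actD(1)[OF M]
        bilinear_actD(1)[OF N] bilin_right[OF bilinear_actD(2)[OF M]] bilin_right[OF bilinear_actD(2)[OF N]] assms(2,3)])

end

text \<open>On a pure tensor this is \<open>(g h)_1 m \<otimes> (g h)_2 n = g_1 h_1 m \<otimes> g_2
  h_2 n\<close>, an instance of \<open>sw_mult\<close>. Acting twice produces the sums in the other
  order, whence \<open>sw_swap\<close>.\<close>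

lemma pre_module_tensor:
  assumes M: "pre_module K H M" and N: "pre_module K H N"
  shows "pre_module K H (tensor_hmodule K H M N)"
proof -
  note M' = pre_moduleD(1)[OF M] and N' = pre_moduleD(1)[OF N]
  let ?T = "tensor K M N" and ?p = "pure_tensor K M N"
  note T = module_tensor_hmodule[OF M' N']
  note d = diagonal_act_bilin[OF M' N'] and dp = diagonal_act_pure[OF M' N'] and p = pure_act_bilin[OF M' N']
  have "diagonal_act K H M N (g \<otimes>\<^bsub>H\<^esub> h) t = diagonal_act K H M N g (diagonal_act K H M N h t)"
    if g: "g \<in> carrier H" and h: "h \<in> carrier H" and t: "t \<in> carrier ?T" for g h t
  proof (rule tensor_ext[OF pre_moduleD(2)[OF M] pre_moduleD(2)[OF N] T _ _ _ t])
    show "diagonal_act K H M N (g \<otimes>\<^bsub>H\<^esub> h) \<in> linear_maps K ?T ?T"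
      using g h by (intro bilin_right[OF d]) simp
    show "(\<lambda>t. diagonal_act K H M N g (diagonal_act K H M N h t)) \<in> linear_maps K ?T ?T"
      by (rule linear_maps_comp[OF bilin_right[OF d h] bilin_right[OF d g]])
    fix m n assume mn: "m \<in> carrier M" "n \<in> carrier N"
    have am: "act M a m \<in> carrier M" "act N a n \<in> carrier N" if "a \<in> carrier H" for a
      using that mn M' N' by (simp_all add: act_closed)
    have q1: "bilin K H H ?T (\<lambda>a b. ?p (act M (a \<otimes>\<^bsub>H\<^esub> c) m) (act N (b \<otimes>\<^bsub>H\<^esub> d) n))"
      if "c \<in> carrier H" "d \<in> carrier H" for c d
      using that by (intro bilinI linear_bilin_left[OF p[OF mn]] linear_bilin_right[OF p[OF mn]] linear_rules) simp_all
    have q2: "bilin K H H ?T (\<lambda>c d. ?p (act M (a \<otimes>\<^bsub>H\<^esub> c) m) (act N (b \<otimes>\<^bsub>H\<^esub> d) n))"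
      if "a \<in> carrier H" "b \<in> carrier H" for a b
      using that by (intro bilinI linear_bilin_left[OF p[OF mn]] linear_bilin_right[OF p[OF mn]] linear_rules) simp_all
    have "diagonal_act K H M N g (diagonal_act K H M N h (?p m n)) =
      sw ?T (\<lambda>c d. diagonal_act K H M N g (?p (act M c m) (act N d n))) h"
      unfolding dp[OF h mn] by (rule sw_comp[OF T p[OF mn] T bilin_right[OF d g] h])
    also have "\<dots> = sw ?T (\<lambda>c d. sw ?T (\<lambda>a b. ?p (act M (a \<otimes>\<^bsub>H\<^esub> c) m) (act N (b \<otimes>\<^bsub>H\<^esub> d) n)) g) h"
    proof (rule sw_cong[OF T bilin_sw_integrand[OF module_H module_H T q1 q2 g] _ h])
      fix c d assume cd: "c \<in> carrier H" "d \<in> carrier H"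
      show "diagonal_act K H M N g (?p (act M c m) (act N d n)) =
        sw ?T (\<lambda>a b. ?p (act M (a \<otimes>\<^bsub>H\<^esub> c) m) (act N (b \<otimes>\<^bsub>H\<^esub> d) n)) g"
        unfolding dp[OF g am(1)[OF cd(1)] am(2)[OF cd(2)]]
        using cd mn by (intro sw_cong[OF T q1 _ g]) (simp_all add: pre_moduleD(4)[OF M] pre_moduleD(4)[OF N])
    qed
    also have "\<dots> = sw ?T (\<lambda>a b. sw ?T (\<lambda>c d. ?p (act M (a \<otimes>\<^bsub>H\<^esub> c) m) (act N (b \<otimes>\<^bsub>H\<^esub> d) n)) h) g"
      by (rule sw_swap[OF T q1 q2 h g])
    also have "\<dots> = diagonal_act K H M N (g \<otimes>\<^bsub>H\<^esub> h) (?p m n)"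
      unfolding dp[OF m_closed[OF g h] mn] by (rule sw_mult[OF T p[OF mn] g h, symmetric])
    finally show "diagonal_act K H M N (g \<otimes>\<^bsub>H\<^esub> h) (?p m n) =
      diagonal_act K H M N g (diagonal_act K H M N h (?p m n))" ..
  qed
  then show ?thesis
    using bilinear_act_tensor[OF M' N'] by (simp add: pre_module_def) (simp add: tensor_hmodule_def)
qed

text \<open>Allowing \<open>pre_hom\<close> makes the lemma applicable to \<open>E\<close>,
  inclusions and projections; it is how the action of 1 is moved past them on threefold
  products.\<close>

lemma tensor_map_diagonal:
  assumes M: "bilinear_act K H M" "bilinear_act K H M'" and N: "bilinear_act K H N" "bilinear_act K H N'"
    and f: "f \<in> pre_hom K H M M'" and g: "g \<in> pre_hom K H N N'"
    and h: "h \<in> carrier H" and t: "t \<in> carrier (tensor K M N)"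
  shows "tensor_map K M' N' f g (diagonal_act K H M N h t) = diagonal_act K H M' N' h (tensor_map K M' N' f g t)"
proof (rule tensor_ext[OF _ _ _ _ _ _ t])
  note tm = tensor_map_linear[OF bilinear_actD(1)[OF M(1)] bilinear_actD(1)[OF N(1)]
      bilinear_actD(1)[OF M(2)] bilinear_actD(1)[OF N(2)] pre_homD(1)[OF f] pre_homD(1)[OF g]]
  note T = module_tensor_hmodule[OF M(1) N(1)] and T' = module_tensor_hmodule[OF M(2) N(2)]
  note d = bilin_right[OF diagonal_act_bilin[OF M(1) N(1)] h] and d' = bilin_right[OF diagonal_act_bilin[OF M(2) N(2)] h]
  show "module K M" "module K N" by (rule bilinear_actD(1), fact)+
  show "module K (tensor K M' N')" by (rule T')
  show "(\<lambda>t. tensor_map K M' N' f g (diagonal_act K H M N h t)) \<in> linear_maps K (tensor K M N) (tensor K M' N')"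
    by (rule linear_maps_comp[OF d tm(1)])
  show "(\<lambda>t. diagonal_act K H M' N' h (tensor_map K M' N' f g t)) \<in> linear_maps K (tensor K M N) (tensor K M' N')"
    by (rule linear_maps_comp[OF tm(1) d'])
  fix m n assume mn: "m \<in> carrier M" "n \<in> carrier N"
  then have fg: "f m \<in> carrier M'" "g n \<in> carrier N'"
    using linear_maps_closed[OF pre_homD(1)[OF f]] linear_maps_closed[OF pre_homD(1)[OF g]] by auto
  have "tensor_map K M' N' f g (diagonal_act K H M N h (pure_tensor K M N m n)) =
    sw (tensor K M' N') (\<lambda>a b. tensor_map K M' N' f g (pure_tensor K M N (act M a m) (act N b n))) h"
    unfolding diagonal_act_pure[OF M(1) N(1) h mn]
    by (rule sw_comp[OF T pure_act_bilin[OF M(1) N(1) mn] T' tm(1) h])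
  also have "\<dots> = sw (tensor K M' N') (\<lambda>a b. pure_tensor K M' N' (act M' a (f m)) (act N' b (g n))) h"
    using mn by (intro sw_cong[OF T' pure_act_bilin[OF M(2) N(2) fg] _ h])
      (simp add: tm(2) act_closed[OF M(1)] act_closed[OF N(1)] pre_homD(2)[OF f] pre_homD(2)[OF g])
  also have "\<dots> = diagonal_act K H M' N' h (tensor_map K M' N' f g (pure_tensor K M N m n))"
    using mn by (simp add: tm(2) diagonal_act_pure[OF M(2) N(2) h fg])
  finally show "tensor_map K M' N' f g (diagonal_act K H M N h (pure_tensor K M N m n)) =
    diagonal_act K H M' N' h (tensor_map K M' N' f g (pure_tensor K M N m n))" .
qed


lemma tensor_hmodule_simps [simp]:
  "carrier (tensor_hmodule K H M N) = carrier (tensor K M N)"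
  "act (tensor_hmodule K H M N) = diagonal_act K H M N"
  "tensor K (tensor_hmodule K H M N) P = tensor K (tensor K M N) P"
  "tensor K Q (tensor_hmodule K H M N) = tensor K Q (tensor K M N)"
  "pure_tensor K (tensor_hmodule K H M N) P = pure_tensor K (tensor K M N) P"
  "pure_tensor K Q (tensor_hmodule K H M N) = pure_tensor K Q (tensor K M N)"
  "tensor_map K (tensor_hmodule K H M N) P = tensor_map K (tensor K M N) P"
  "tensor_map K Q (tensor_hmodule K H M N) = tensor_map K Q (tensor K M N)"
  "linear_maps K (tensor_hmodule K H M N) P = linear_maps K (tensor K M N) P"
  "linear_maps K Q (tensor_hmodule K H M N) = linear_maps K Q (tensor K M N)"
  by (simp_all add: tensor_hmodule_def)

text \<open>For \<open>T c d e = c m \<otimes> (d n \<otimes> e p)\<close>, the two actions on pure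
  tensors are the two iterated coproducts, so \<open>sw_coassoc\<close> applies. At
  \<open>h = 1\<close> the lemma matches the operators that describe the two bracketings.\<close>

lemma tensor_assoc_diagonal:
  assumes M: "bilinear_act K H M" and N: "bilinear_act K H N" and P: "bilinear_act K H P"
    and h: "h \<in> carrier H" and s: "s \<in> carrier (tensor K (tensor K M N) P)"
  shows "tensor_assoc K M N P (diagonal_act K H (tensor_hmodule K H M N) P h s) =
    diagonal_act K H M (tensor_hmodule K H N P) h (tensor_assoc K M N P s)"
proof -
  note mM = bilinear_actD(1)[OF M] and mN = bilinear_actD(1)[OF N] and mP = bilinear_actD(1)[OF P]
  note MN = module_tensor[OF mM mN] and NP = module_tensor[OF mN mP]
  note aMN = bilinear_act_tensor[OF M N] and aNP = bilinear_act_tensor[OF N P]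
  let ?W = "tensor K M (tensor K N P)"
  note W = module_tensor[OF mM NP] and V = module_tensor[OF MN mP]
  let ?p3 = "\<lambda>m n p. pure_tensor K M (tensor K N P) m (pure_tensor K N P n p)"
  let ?\<alpha> = "tensor_assoc K M N P"
  let ?dl = "diagonal_act K H (tensor_hmodule K H M N) P" and ?dr = "diagonal_act K H M (tensor_hmodule K H N P)"
  note \<alpha> = tensor_assoc_linear[OF mM mN mP]
  note dl = diagonal_act_bilin[OF aMN P, unfolded tensor_hmodule_simps]
  note dr = diagonal_act_bilin[OF M aNP, unfolded tensor_hmodule_simps]
  have \<alpha>_pure: "?\<alpha> (pure_tensor K (tensor K M N) P (pure_tensor K M N m n) p) = ?p3 m n p"
    if "m \<in> carrier M" "n \<in> carrier N" "p \<in> carrier P" for m n p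
    using that by (simp add: \<alpha>(2) pure_tensor_closed[OF mM mN] tensor_lift_pure[OF mM mN W \<alpha>(3)])
  have L: "(\<lambda>s. ?\<alpha> (?dl h s)) \<in> linear_maps K (tensor K (tensor K M N) P) ?W"
    by (rule linear_maps_comp[OF bilin_right[OF dl h] \<alpha>(1)])
  have R: "(\<lambda>s. ?dr h (?\<alpha> s)) \<in> linear_maps K (tensor K (tensor K M N) P) ?W"
    by (rule linear_maps_comp[OF \<alpha>(1) bilin_right[OF dr h]])
  have pure3: "?\<alpha> (?dl h (pure_tensor K (tensor K M N) P (pure_tensor K M N m n) p)) = ?dr h (?p3 m n p)"
    if m: "m \<in> carrier M" and n: "n \<in> carrier N" and p: "p \<in> carrier P" for m n p
  proof -
    let ?T = "\<lambda>c d e. ?p3 (act M c m) (act N d n) (act P e p)"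
    note acts = act_closed[OF M _ m] act_closed[OF N _ n] act_closed[OF P _ p]
    note lin = linear_pure_left linear_pure_right linear_id bilin_left[OF bilinear_actD(2)[OF M] m]
      bilin_left[OF bilinear_actD(2)[OF N] n] bilin_left[OF bilinear_actD(2)[OF P] p]
    have T1: "bilin K H H ?W (\<lambda>c d. ?T c d e)" if "e \<in> carrier H" for e
      using that by (intro bilinI lin mM mN mP NP pure_tensor_closed acts)
    have T2: "bilin K H H ?W (\<lambda>d e. ?T c d e)" if "c \<in> carrier H" for c
      using that by (intro bilinI lin mM mN mP NP pure_tensor_closed acts)
    have mn: "pure_tensor K M N m n \<in> carrier (tensor K M N)" and np: "pure_tensor K N P n p \<in> carrier (tensor K N P)"
      by (intro pure_tensor_closed mM mN mP m n p)+
    have "?\<alpha> (?dl h (pure_tensor K (tensor K M N) P (pure_tensor K M N m n) p)) =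
      sw ?W (\<lambda>x e. ?\<alpha> (pure_tensor K (tensor K M N) P (diagonal_act K H M N x (pure_tensor K M N m n)) (act P e p))) h"
      unfolding diagonal_act_pure[OF aMN P h, unfolded tensor_hmodule_simps, OF mn p]
      by (rule sw_comp[OF V pure_act_bilin[OF aMN P, unfolded tensor_hmodule_simps, OF mn p] W \<alpha>(1) h])
    also have "\<dots> = sw ?W (\<lambda>x e. sw ?W (\<lambda>c d. ?T c d e) x) h"
    proof (rule sw_cong[OF W _ _ h])
      show "bilin K H H ?W (\<lambda>x e. sw ?W (\<lambda>c d. ?T c d e) x)"
        by (intro bilinI linear_sw[OF W T1] linear_id linear_sw_integrand[OF module_H W T1] bilin_right[OF T2])
      fix x e assume x: "x \<in> carrier H" and e: "e \<in> carrier H"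
      have "?\<alpha> (pure_tensor K (tensor K M N) P (diagonal_act K H M N x (pure_tensor K M N m n)) (act P e p)) =
        sw ?W (\<lambda>c d. ?\<alpha> (pure_tensor K (tensor K M N) P (pure_tensor K M N (act M c m) (act N d n)) (act P e p))) x"
        unfolding diagonal_act_pure[OF M N x m n]
        by (rule sw_comp[OF MN pure_act_bilin[OF M N m n] W
              linear_maps_comp[OF bilin_left[OF pure_tensor_bilin[OF MN mP] acts(3)[OF e]] \<alpha>(1)] x])
      also have "\<dots> = sw ?W (\<lambda>c d. ?T c d e) x"
        using e by (intro sw_cong[OF W T1 _ x] \<alpha>_pure acts)
      finally show "?\<alpha> (pure_tensor K (tensor K M N) P (diagonal_act K H M N x (pure_tensor K M N m n)) (act P e p)) =
        sw ?W (\<lambda>c d. ?T c d e) x" .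
    qed
    also have "\<dots> = sw ?W (\<lambda>c y. sw ?W (\<lambda>d e. ?T c d e) y) h"
      by (rule sw_coassoc[OF W T1 T2 h])
    also have "\<dots> = sw ?W (\<lambda>c y. pure_tensor K M (tensor K N P) (act M c m) (diagonal_act K H N P y (pure_tensor K N P n p))) h"
    proof (rule sw_cong[OF W pure_act_bilin[OF M aNP, unfolded tensor_hmodule_simps, OF m np] _ h])
      fix c y assume c: "c \<in> carrier H" and y: "y \<in> carrier H"
      show "sw ?W (\<lambda>d e. ?T c d e) y =
        pure_tensor K M (tensor K N P) (act M c m) (diagonal_act K H N P y (pure_tensor K N P n p))"
        unfolding diagonal_act_pure[OF N P y n p]
        by (rule sw_comp[OF NP pure_act_bilin[OF N P n p] W bilin_right[OF pure_tensor_bilin[OF mM NP] acts(1)[OF c]] y, symmetric])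
    qed
    also have "\<dots> = ?dr h (?p3 m n p)"
      by (rule diagonal_act_pure[OF M aNP h, unfolded tensor_hmodule_simps, OF m np, symmetric])
    finally show ?thesis .
  qed
  show ?thesis
  proof (rule tensor_ext[OF MN mP W L R _ s])
    \<comment> \<open>The first factor is itself a tensor product, so extensionality is applied a
      second time, in \<open>u\<close>.\<close>
    fix u p assume u: "u \<in> carrier (tensor K M N)" and p: "p \<in> carrier P"
    note pl = bilin_left[OF pure_tensor_bilin[OF MN mP] p]
    show "?\<alpha> (?dl h (pure_tensor K (tensor K M N) P u p)) = ?dr h (?\<alpha> (pure_tensor K (tensor K M N) P u p))"
      by (rule tensor_ext[OF mM mN W linear_maps_comp[OF pl L] linear_maps_comp[OF pl R] _ u])
        (simp add: pure3 \<alpha>_pure p)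
  qed
qed

lemma target_subalgebraD:
  assumes "r \<in> target_subalgebra K H"
  shows "r \<in> carrier H" "eps_t K H r = r"
  using assms by (auto simp: target_subalgebra_def eps_eps_t)

text \<open>This is \<open>sw_eps_balanced\<close> with \<open>B(a, b) = a m \<otimes> b n\<close>
  and \<open>h = r\<close>, where \<open>\<epsilon>\<^sub>t(r) = r\<close>. At \<open>u = 1\<close>
  it says that \<open>E\<close> descends to the quotient; general \<open>u\<close> is what the
  action on the quotient requires.\<close>

lemma diagonal_act_balanced:
  assumes M: "pre_module K H M" and N: "pre_module K H N" and u: "u \<in> carrier H"
    and r: "r \<in> target_subalgebra K H" and m: "m \<in> carrier M" and n: "n \<in> carrier N"
  shows "diagonal_act K H M N u (pure_tensor K M N (act M (eps_s' K H r) m) n) =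
    diagonal_act K H M N u (pure_tensor K M N m (act N r n))"
proof -
  note M' = pre_moduleD(1)[OF M] and N' = pre_moduleD(1)[OF N]
  note r' = target_subalgebraD[OF r]
  let ?T = "tensor K M N" and ?B = "\<lambda>a b. pure_tensor K M N (act M a m) (act N b n)"
  note T = module_tensor_hmodule[OF M' N'] and B = pure_act_bilin[OF M' N' m n]
  have m': "act M (eps_s' K H r) m \<in> carrier M" and n': "act N r n \<in> carrier N"
    using r' m n by (auto intro: act_closed[OF M'] act_closed[OF N'])
  have "diagonal_act K H M N u (pure_tensor K M N (act M (eps_s' K H r) m) n) = sw ?T (\<lambda>a b. ?B (a \<otimes>\<^bsub>H\<^esub> eps_s' K H r) b) u"
    unfolding diagonal_act_pure[OF M' N' u m' n] using r' m
    by (intro sw_cong[OF T _ _ u] bilinI linear_bilin_left[OF B] linear_bilin_right[OF B] linear_mult_left linear_id)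
      (simp_all add: pre_moduleD(4)[OF M])
  also have "\<dots> = sw ?T (\<lambda>a b. ?B a (b \<otimes>\<^bsub>H\<^esub> r)) u"
    using sw_eps_balanced[OF T B u r'(1)] r' by simp
  also have "\<dots> = diagonal_act K H M N u (pure_tensor K M N m (act N r n))"
    unfolding diagonal_act_pure[OF M' N' u m n'] using r' n
    by (intro sw_cong[OF T pure_act_bilin[OF M' N' m n'] _ u]) (simp add: pre_moduleD(4)[OF N])
  finally show ?thesis .
qed

section \<open>The two tensor products of modules\<close>

context
  fixes M :: "('k, 'h, 'm, 'x) hmodule_scheme" and N :: "('k, 'h, 'n, 'y) hmodule_scheme"
  assumes M: "bilinear_act K H M" and N: "bilinear_act K H N"
begin

lemma diamond_generators_subset:
  "{pure_tensor K M N (act M (eps_s' K H r) m) n \<ominus>\<^bsub>tensor K M N\<^esub> pure_tensor K M N m (act N r n)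
      | r m n. r \<in> target_subalgebra K H \<and> m \<in> carrier M \<and> n \<in> carrier N} \<subseteq> carrier (tensor K M N)"
proof -
  interpret T: module K "tensor K M N" by (rule module_tensor_hmodule[OF M N])
  show ?thesis
    by (auto intro!: T.minus_closed pure_tensor_closed bilinear_actD(1) M N act_closed dest: target_subalgebraD)
qed

lemma quotient_diamond: "quotient K (tensor K M N) (diamond_relations K H M N)"
  unfolding quotient_def diamond_relations_def
  using module_tensor_hmodule[OF M N] span_in_submodule[OF _ diamond_generators_subset] by blast

lemma module_diamond: "module K (diamond K H M N)"
  unfolding diamond_def module_with_act by (rule quotient.module_quotient[OF quotient_diamond])

lemma carrier_diamond: "carrier (diamond K H M N) = diamond_proj K H M N ` carrier (tensor K M N)"
  unfolding diamond_def diamond_proj_def with_act_simps by (rule quotient.carrier_quotient[OF quotient_diamond])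

lemma diamond_proj_linear: "diamond_proj K H M N \<in> linear_maps K (tensor K M N) (diamond K H M N)"
  unfolding diamond_def diamond_proj_def[abs_def] linear_maps_with_act
  by (rule quotient.proj_linear[OF quotient_diamond])

lemma diamond_proj_balanced:
  assumes r: "r \<in> target_subalgebra K H" and m: "m \<in> carrier M" and n: "n \<in> carrier N"
  shows "diamond_proj K H M N (pure_tensor K M N (act M (eps_s' K H r) m) n) =
    diamond_proj K H M N (pure_tensor K M N m (act N r n))"
proof -
  note r' = target_subalgebraD[OF r]
  have "pure_tensor K M N (act M (eps_s' K H r) m) n \<ominus>\<^bsub>tensor K M N\<^esub> pure_tensor K M N m (act N r n)
    \<in> diamond_relations K H M N"
    unfolding diamond_relations_def using assms by (intro subsetD[OF span_in_superset]) blast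
  moreover have "pure_tensor K M N (act M (eps_s' K H r) m) n \<in> carrier (tensor K M N)"
    "pure_tensor K M N m (act N r n) \<in> carrier (tensor K M N)"
    using r' m n by (intro pure_tensor_closed bilinear_actD(1)[OF M] bilinear_actD(1)[OF N] act_closed[OF M] act_closed[OF N]; simp)+
  ultimately show ?thesis
    unfolding diamond_proj_def using quotient.coset_eq_iff[OF quotient_diamond] by blast
qed

section \<open>The universal property of the quotient \<open>M \<diamond> N\<close>\<close>

context
  fixes W :: "('k, 'w, 'v) module_scheme" and f
  assumes W: "module K W" and f: "f \<in> linear_maps K (tensor K M N) W"
    and balanced: "\<And>r m n. \<lbrakk>r \<in> target_subalgebra K H; m \<in> carrier M; n \<in> carrier N\<rbrakk> \<Longrightarrow>
      f (pure_tensor K M N (act M (eps_s' K H r) m) n) = f (pure_tensor K M N m (act N r n))"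
begin

lemma balanced_diamond_relations:
  assumes "y \<in> diamond_relations K H M N"
  shows "f y = \<zero>\<^bsub>W\<^esub>"
proof (rule span_in_kernel[OF module_tensor_hmodule[OF M N] W f diamond_generators_subset])
  interpret W: module K W by (rule W)
  fix x assume "x \<in> {pure_tensor K M N (act M (eps_s' K H r) m) n \<ominus>\<^bsub>tensor K M N\<^esub> pure_tensor K M N m (act N r n)
      | r m n. r \<in> target_subalgebra K H \<and> m \<in> carrier M \<and> n \<in> carrier N}"
  then obtain r m n where r: "r \<in> target_subalgebra K H" and m: "m \<in> carrier M" and n: "n \<in> carrier N"
    and x: "x = pure_tensor K M N (act M (eps_s' K H r) m) n \<ominus>\<^bsub>tensor K M N\<^esub> pure_tensor K M N m (act N r n)"
    by blast
  note r' = target_subalgebraD[OF r]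
  have c: "pure_tensor K M N (act M (eps_s' K H r) m) n \<in> carrier (tensor K M N)"
    "pure_tensor K M N m (act N r n) \<in> carrier (tensor K M N)"
    using r' m n by (intro pure_tensor_closed bilinear_actD(1)[OF M] bilinear_actD(1)[OF N] act_closed[OF M] act_closed[OF N]; simp)+
  show "f x = \<zero>\<^bsub>W\<^esub>"
    using linear_maps_closed[OF f c(2)]
    by (simp add: x linear_maps_minus[OF module_tensor_hmodule[OF M N] W f c] balanced[OF r m n] W.minus_eq W.r_neg)
qed (use assms in \<open>simp add: diamond_relations_def\<close>)

lemma the_elem_diamond_proj:
  "t \<in> carrier (tensor K M N) \<Longrightarrow> the_elem (f ` diamond_proj K H M N t) = f t"
  unfolding diamond_proj_def
  by (rule quotient.the_elem_coset[OF quotient_diamond W f balanced_diamond_relations])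

lemma the_elem_diamond_linear: "(\<lambda>X. the_elem (f ` X)) \<in> linear_maps K (diamond K H M N) W"
  unfolding diamond_def linear_maps_with_act
  by (rule quotient.the_elem_linear[OF quotient_diamond W f balanced_diamond_relations])

end

end

section \<open>Both products of left modules, and their comparison\<close>

lemma left_moduleD:
  assumes "left_module K H M"
  shows "pre_module K H M" "bilinear_act K H M" "module K M" "bilin K H M M (act M)"
    "m \<in> carrier M \<Longrightarrow> act M \<one>\<^bsub>H\<^esub> m = m"
  using assms by (auto simp: left_module_iff dest: pre_moduleD)

context
  fixes M :: "('k, 'h, 'm, 'x) hmodule_scheme" and N :: "('k, 'h, 'n, 'y) hmodule_scheme"
  assumes M: "left_module K H M" and N: "left_module K H N"
begin

private lemmas M' = left_moduleD[OF M]
private lemmas N' = left_moduleD[OF N]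
private abbreviation "T \<equiv> tensor K M N"
private abbreviation "\<pi> \<equiv> diamond_proj K H M N"
private abbreviation "d \<equiv> diagonal_act K H M N"

private lemmas T = module_tensor_hmodule[OF M'(2) N'(2)]
private lemmas Q = module_diamond[OF M'(2) N'(2)]
private lemmas d = diagonal_act_bilin[OF M'(2) N'(2)]
private lemmas \<pi> = diamond_proj_linear[OF M'(2) N'(2)]

lemma diagonal_act_mult:
  "\<lbrakk>g \<in> carrier H; h \<in> carrier H; t \<in> carrier T\<rbrakk> \<Longrightarrow> d (g \<otimes>\<^bsub>H\<^esub> h) t = d g (d h t)"
  using pre_moduleD(4)[OF pre_module_tensor[OF M'(1) N'(1)]] by simp

text \<open>A consequence of \<open>1 h = h = h 1\<close>; at \<open>h = 1\<close> it makes
  \<open>E\<close> idempotent.\<close>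

lemma diagonal_act_one:
  assumes "h \<in> carrier H" "t \<in> carrier T"
  shows "d \<one>\<^bsub>H\<^esub> (d h t) = d h t" "d h (d \<one>\<^bsub>H\<^esub> t) = d h t"
  using diagonal_act_mult[OF one_closed assms] diagonal_act_mult[OF assms(1) one_closed assms(2)] assms by simp_all

lemma diamond_proj_diagonal_one:
  assumes t: "t \<in> carrier T"
  shows "\<pi> (d \<one>\<^bsub>H\<^esub> t) = \<pi> t"
proof (rule tensor_ext[OF M'(3) N'(3) Q linear_maps_comp[OF bilin_right[OF d one_closed] \<pi>] \<pi> _ t])
  fix m n assume m: "m \<in> carrier M" and n: "n \<in> carrier N"
  let ?B = "\<lambda>a b. \<pi> (pure_tensor K M N (act M a m) (act N b n))"
  let ?F = "\<lambda>y. \<pi> (pure_tensor K M N m (act N y n))"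
  let ?Q = "diamond K H M N"
  have B: "bilin K H H ?Q ?B"
    by (rule bilin_comp[OF pure_act_bilin[OF M'(2) N'(2) m n] \<pi>])
  have F: "?F \<in> linear_maps K H ?Q"
    by (rule linear_maps_comp[OF linear_maps_comp[OF bilin_left[OF N'(4) n] bilin_right[OF pure_tensor_bilin[OF M'(3) N'(3)] m]] \<pi>])
  have tb: "bilin K H H H (\<lambda>a b. eps_t K H a \<otimes>\<^bsub>H\<^esub> b)"
    by (intro bilinI linear_mult_left linear_mult_right eps_t_linear linear_id) simp_all
  have "\<pi> (d \<one>\<^bsub>H\<^esub> (pure_tensor K M N m n)) = sw ?Q ?B \<one>\<^bsub>H\<^esub>"
    unfolding diagonal_act_pure[OF M'(2) N'(2) one_closed m n]
    by (rule sw_comp[OF T pure_act_bilin[OF M'(2) N'(2) m n] Q \<pi> one_closed])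
  also have "\<dots> = sw ?Q (\<lambda>a b. ?B (eps_s' K H a) b) \<one>\<^bsub>H\<^esub>"
    by (rule sw_eps_s'_one[OF Q B])
  also have "\<dots> = sw ?Q (\<lambda>a b. ?F (eps_t K H a \<otimes>\<^bsub>H\<^esub> b)) \<one>\<^bsub>H\<^esub>"
  proof (rule sw_cong[OF Q bilin_comp[OF tb F] _ one_closed])
    fix a b assume a: "a \<in> carrier H" and b: "b \<in> carrier H"
    \<comment> \<open>The relation is used with \<open>r = \<epsilon>\<^sub>t(a)\<close> and the
      vectors \<open>m\<close> and \<open>b n\<close>. Its left side contains
      \<open>\<epsilon>\<^sub>s'(\<epsilon>\<^sub>t(a))\<close>, which is
      \<open>\<epsilon>\<^sub>s'(a)\<close>.\<close>
    have "eps_t K H a \<in> target_subalgebra K H" using a by (simp add: target_subalgebra_def)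
    from diamond_proj_balanced[OF M'(2) N'(2) this m act_closed[OF N'(2) b n]]
    show "?B (eps_s' K H a) b = ?F (eps_t K H a \<otimes>\<^bsub>H\<^esub> b)"
      using a b n by (simp add: eps_eps_t pre_moduleD(4)[OF N'(1)])
  qed
  also have "\<dots> = ?F \<one>\<^bsub>H\<^esub>"
    using sw_comp[OF module_H tb Q F one_closed] by (simp add: sw_eps_t_mult)
  also have "\<dots> = \<pi> (pure_tensor K M N m n)"
    using n by (simp add: N'(5))
  finally show "\<pi> (d \<one>\<^bsub>H\<^esub> (pure_tensor K M N m n)) = \<pi> (pure_tensor K M N m n)" .
qed

text \<open>A class determines the value of \<open>E\<close>, as \<open>E\<close> is balanced;
  conversely, the value of \<open>E\<close> determines the class, as projecting after
  \<open>E\<close> is the same as projecting.\<close>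

lemma diamond_proj_eq_iff:
  assumes "s \<in> carrier T" "t \<in> carrier T"
  shows "\<pi> s = \<pi> t \<longleftrightarrow> d \<one>\<^bsub>H\<^esub> s = d \<one>\<^bsub>H\<^esub> t"
proof
  have E: "the_elem (d \<one>\<^bsub>H\<^esub> ` \<pi> t) = d \<one>\<^bsub>H\<^esub> t" if "t \<in> carrier T" for t
    by (rule the_elem_diamond_proj[OF M'(2) N'(2) T bilin_right[OF d one_closed] _ that])
      (rule diagonal_act_balanced[OF M'(1) N'(1) one_closed])
  show "d \<one>\<^bsub>H\<^esub> s = d \<one>\<^bsub>H\<^esub> t" if "\<pi> s = \<pi> t"
    using E[OF assms(1)] E[OF assms(2)] that by simp
  show "\<pi> s = \<pi> t" if "d \<one>\<^bsub>H\<^esub> s = d \<one>\<^bsub>H\<^esub> t"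
    using diamond_proj_diagonal_one[OF assms(1)] diamond_proj_diagonal_one[OF assms(2)] that by simp
qed

private lemma \<pi>d:
  assumes "h \<in> carrier H"
  shows "(\<lambda>t. \<pi> (d h t)) \<in> linear_maps K T (diamond K H M N)"
    and "\<lbrakk>r \<in> target_subalgebra K H; m \<in> carrier M; n \<in> carrier N\<rbrakk> \<Longrightarrow>
      \<pi> (d h (pure_tensor K M N (act M (eps_s' K H r) m) n)) = \<pi> (d h (pure_tensor K M N m (act N r n)))"
  by (rule linear_maps_comp[OF bilin_right[OF d assms] \<pi>])
    (simp add: diagonal_act_balanced[OF M'(1) N'(1) assms])

lemma act_diamond:
  assumes "h \<in> carrier H" "t \<in> carrier T"
  shows "act (diamond K H M N) h (\<pi> t) = \<pi> (d h t)"
  using the_elem_diamond_proj[OF M'(2) N'(2) Q \<pi>d[OF assms(1)] assms(2)]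
  by (simp add: diamond_def)

text \<open>The unit law may fail on \<open>M \<otimes> N\<close>, but holds on the quotient because
  the projection absorbs \<open>E\<close>. The other laws are inherited along the surjective
  projection.\<close>

lemma left_module_diamond: "left_module K H (diamond K H M N)"
proof -
  let ?Q = "diamond K H M N"
  have "bilin K H ?Q ?Q (act ?Q)"
  proof (rule bilinI)
    fix h assume h: "h \<in> carrier H"
    show "act ?Q h \<in> linear_maps K ?Q ?Q"
      using the_elem_diamond_linear[OF M'(2) N'(2) Q \<pi>d[OF h]]
      by (simp add: diamond_def)
  next
    fix X assume "X \<in> carrier ?Q"
    then obtain t where t: "t \<in> carrier T" "X = \<pi> t"
      unfolding carrier_diamond[OF M'(2) N'(2)] by (rule imageE)
    show "(\<lambda>h. act ?Q h X) \<in> linear_maps K H ?Q"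
      by (rule linear_maps_cong[OF linear_maps_comp[OF bilin_left[OF d t(1)] \<pi>] _ module_H])
        (simp add: t act_diamond)
  qed
  moreover have "act ?Q (g \<otimes>\<^bsub>H\<^esub> h) X = act ?Q g (act ?Q h X)"
    if gh: "g \<in> carrier H" "h \<in> carrier H" and X: "X \<in> carrier ?Q" for g h X
  proof -
    obtain t where t: "t \<in> carrier T" "X = \<pi> t"
      using X unfolding carrier_diamond[OF M'(2) N'(2)] by (rule imageE)
    show ?thesis
      using gh t(1) by (simp add: t(2) act_diamond diagonal_act_mult bilin_closed[OF d])
  qed
  moreover have "act ?Q \<one>\<^bsub>H\<^esub> X = X" if X: "X \<in> carrier ?Q" for X
  proof -
    obtain t where t: "t \<in> carrier T" "X = \<pi> t"
      using X unfolding carrier_diamond[OF M'(2) N'(2)] by (rule imageE)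
    then show ?thesis by (simp add: act_diamond diamond_proj_diagonal_one)
  qed
  ultimately show ?thesis
    by (simp add: left_module_iff pre_module_def bilinear_act_def k_algebra_axioms Q)
qed

lemma diamond_proj_hom: "\<pi> \<in> pre_hom K H (tensor_hmodule K H M N) (diamond K H M N)"
  by (simp add: pre_hom_def \<pi> act_diamond)

lemma odot_simps:
  "carrier (odot K H M N) = d \<one>\<^bsub>H\<^esub> ` carrier T" "add (odot K H M N) = add T"
  "smult (odot K H M N) = smult T" "zero (odot K H M N) = zero T" "act (odot K H M N) = d"
  by (simp_all add: odot_def)

text \<open>The image of an idempotent is its set of fixed points.\<close>

lemma mem_odot_iff: "t \<in> carrier (odot K H M N) \<longleftrightarrow> t \<in> carrier T \<and> d \<one>\<^bsub>H\<^esub> t = t"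
proof
  assume "t \<in> carrier (odot K H M N)"
  then obtain s where "s \<in> carrier T" "t = d \<one>\<^bsub>H\<^esub> s" unfolding odot_simps by (rule imageE)
  then show "t \<in> carrier T \<and> d \<one>\<^bsub>H\<^esub> t = t"
    by (simp add: bilin_closed[OF d] diagonal_act_one)
next
  assume "t \<in> carrier T \<and> d \<one>\<^bsub>H\<^esub> t = t"
  then show "t \<in> carrier (odot K H M N)"
    unfolding odot_simps by (metis imageI)
qed

lemma module_odot: "module K (odot K H M N)"
  unfolding odot_def module_with_act
  by (rule submodule.submodule_is_module[OF image_submodule[OF T T bilin_right[OF d one_closed]] T])

lemma linear_maps_into_odot:
  "f \<in> linear_maps K X (odot K H M N) \<longleftrightarrow> f \<in> linear_maps K X T \<and> (\<forall>x\<in>carrier X. d \<one>\<^bsub>H\<^esub> (f x) = f x)"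
proof -
  have eq: "add (odot K H M N) = add T" "smult (odot K H M N) = smult T" by (simp_all add: odot_simps)
  show ?thesis
    unfolding linear_maps_def eq by (auto simp: mem_odot_iff Pi_iff)
qed

lemma linear_maps_from_odot: "f \<in> linear_maps K T X \<Longrightarrow> f \<in> linear_maps K (odot K H M N) X"
  by (auto simp: linear_maps_def mem_odot_iff odot_simps(2,3))

lemma left_module_odot: "left_module K H (odot K H M N)"
proof -
  have "bilin K H (odot K H M N) (odot K H M N) d"
    by (intro bilinI)
      (simp_all add: linear_maps_into_odot linear_maps_from_odot bilin_right[OF d] bilin_left[OF d] mem_odot_iff diagonal_act_one)
  then show ?thesis
    by (simp add: left_module_iff pre_module_def bilinear_act_def k_algebra_axioms module_odot odot_simps(5)
        mem_odot_iff diagonal_act_mult)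
qed

text \<open>\<open>E\<close> as a retraction of \<open>M \<otimes> N\<close> onto
  \<open>M \<odot> N\<close>. Together with the inclusion it replaces flatness arguments when
  \<open>M \<odot> N\<close> is tensored with a third module.\<close>

lemma odot_proj_hom: "d \<one>\<^bsub>H\<^esub> \<in> pre_hom K H (tensor_hmodule K H M N) (odot K H M N)"
  by (simp add: pre_hom_def linear_maps_into_odot bilin_right[OF d] odot_simps(5) diagonal_act_one)

lemma odot_incl_hom: "id \<in> pre_hom K H (odot K H M N) (tensor_hmodule K H M N)"
  using pre_hom_id[of K H "tensor_hmodule K H M N"]
  by (simp add: pre_hom_def linear_maps_from_odot odot_simps(5))

text \<open>Injectivity: two fixed points of \<open>E\<close> with the same class have the same
  image under \<open>E\<close>. Surjectivity: the class of \<open>t\<close> is also the class of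
  \<open>E t\<close>.\<close>

lemma gamma_iso: "gamma K H M N \<in> left_iso K H (odot K H M N) (diamond K H M N)"
proof -
  have \<gamma>: "gamma K H M N = \<pi>" by (simp add: gamma_def fun_eq_iff)
  have "inj_on \<pi> (carrier (odot K H M N))"
    by (rule inj_onI) (simp add: mem_odot_iff diamond_proj_eq_iff)
  moreover have "\<pi> ` carrier (odot K H M N) = carrier (diamond K H M N)"
    unfolding odot_simps carrier_diamond[OF M'(2) N'(2)] image_image
    by (rule image_cong) (simp_all add: diamond_proj_diagonal_one)
  ultimately show ?thesis
    using left_module_odot left_module_diamond
    by (simp add: left_iso_def left_hom_def bij_betw_def \<gamma> linear_maps_from_odot \<pi> mem_odot_iff odot_simps(5) act_diamond)
qed

end

text \<open>As \<open>f\<close> and \<open>g\<close> commute with the actions,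
  \<open>f \<otimes> g\<close> carries relations to relations. Restricted to
  \<open>M \<odot> N\<close>, the equation is the naturality of \<open>gamma\<close>.\<close>

lemma diamond_map_proj:
  assumes M: "left_module K H M" "left_module K H M'" and N: "left_module K H N" "left_module K H N'"
    and f: "f \<in> pre_hom K H M M'" and g: "g \<in> pre_hom K H N N'" and t: "t \<in> carrier (tensor K M N)"
  shows "diamond_map K H M' N' f g (diamond_proj K H M N t) = diamond_proj K H M' N' (tensor_map K M' N' f g t)"
  unfolding diamond_map_def
proof (rule the_elem_diamond_proj[OF left_moduleD(2)[OF M(1)] left_moduleD(2)[OF N(1)]
      module_diamond[OF left_moduleD(2)[OF M(2)] left_moduleD(2)[OF N(2)]] _ _ t])
  note tm = tensor_map_linear[OF left_moduleD(3)[OF M(1)] left_moduleD(3)[OF N(1)]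
      left_moduleD(3)[OF M(2)] left_moduleD(3)[OF N(2)] pre_homD(1)[OF f] pre_homD(1)[OF g]]
  show "(\<lambda>t. diamond_proj K H M' N' (tensor_map K M' N' f g t)) \<in> linear_maps K (tensor K M N) (diamond K H M' N')"
    by (rule linear_maps_comp[OF tm(1) diamond_proj_linear]) (fact left_moduleD(2)[OF M(2)] left_moduleD(2)[OF N(2)])+
  fix r m n assume r: "r \<in> target_subalgebra K H" and m: "m \<in> carrier M" and n: "n \<in> carrier N"
  note r' = target_subalgebraD[OF r]
  have fm: "f m \<in> carrier M'" and gn: "g n \<in> carrier N'"
    using linear_maps_closed[OF pre_homD(1)[OF f] m] linear_maps_closed[OF pre_homD(1)[OF g] n] by auto
  show "diamond_proj K H M' N' (tensor_map K M' N' f g (pure_tensor K M N (act M (eps_s' K H r) m) n)) =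
    diamond_proj K H M' N' (tensor_map K M' N' f g (pure_tensor K M N m (act N r n)))"
    using r' m n diamond_proj_balanced[OF left_moduleD(2)[OF M(2)] left_moduleD(2)[OF N(2)] r fm gn]
    by (simp add: tm(2) act_closed[OF left_moduleD(2)[OF M(1)]] act_closed[OF left_moduleD(2)[OF N(1)]]
        pre_homD(2)[OF f] pre_homD(2)[OF g])
qed

section \<open>Compatibility with the associativity constraints\<close>

context
  fixes M :: "('k, 'h, 'm, 'x) hmodule_scheme" and N :: "('k, 'h, 'n, 'y) hmodule_scheme"
    and P :: "('k, 'h, 'p, 'w) hmodule_scheme"
  assumes M: "left_module K H M" and N: "left_module K H N" and P: "left_module K H P"
begin

private lemmas mM = left_moduleD(3)[OF M]
private lemmas mN = left_moduleD(3)[OF N]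
private lemmas mP = left_moduleD(3)[OF P]
private lemmas bM = left_moduleD(2)[OF M]
private lemmas bN = left_moduleD(2)[OF N]
private lemmas bP = left_moduleD(2)[OF P]
private lemmas MN = module_tensor[OF mM mN]
private lemmas NP = module_tensor[OF mN mP]
private lemmas bMN = bilinear_act_tensor[OF bM bN]
private lemmas bNP = bilinear_act_tensor[OF bN bP]
private lemmas oMN = left_module_odot[OF M N]
private lemmas oNP = left_module_odot[OF N P]
private lemmas qMN = left_module_diamond[OF M N]
private lemmas qNP = left_module_diamond[OF N P]

private abbreviation "\<alpha> \<equiv> tensor_assoc K M N P"
private abbreviation "dl \<equiv> diagonal_act K H (tensor_hmodule K H M N) P"
private abbreviation "dr \<equiv> diagonal_act K H M (tensor_hmodule K H N P)"
private abbreviation "ql s \<equiv> diamond_proj K H (diamond K H M N) P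
  (tensor_map K (diamond K H M N) P (diamond_proj K H M N) id s)"
private abbreviation "qr s \<equiv> diamond_proj K H M (diamond K H N P)
  (tensor_map K M (diamond K H N P) id (diamond_proj K H N P) s)"

private lemma \<alpha>_closed: "s \<in> carrier (tensor K (tensor K M N) P) \<Longrightarrow> \<alpha> s \<in> carrier (tensor K M (tensor K N P))"
  by (rule linear_maps_closed[OF tensor_assoc_linear(1)[OF mM mN mP]])

text \<open>\<open>dl h\<close> acts on the first factor through \<open>\<Delta>(h_1)\<close>, and
  \<open>\<Delta>(1)\<Delta>(h_1) = \<Delta>(h_1)\<close>, so a further \<open>E\<close> on that
  factor changes nothing.\<close>

private lemma tensor_map_proj_left:
  assumes h: "h \<in> carrier H" and s: "s \<in> carrier (tensor K (tensor K M N) P)"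
  shows "tensor_map K (tensor K M N) P (diagonal_act K H M N \<one>\<^bsub>H\<^esub>) id (dl h s) = dl h s"
proof (rule tensor_ext[OF MN mP module_tensor[OF MN mP] _ _ _ s])
  note d = diagonal_act_bilin[OF bM bN]
  note dl = diagonal_act_bilin[OF bMN bP, unfolded tensor_hmodule_simps]
  note tm = tensor_map_linear[OF MN mP MN mP bilin_right[OF d one_closed] pre_homD(1)[OF pre_hom_id]]
  show "(\<lambda>s. tensor_map K (tensor K M N) P (diagonal_act K H M N \<one>\<^bsub>H\<^esub>) id (dl h s)) \<in>
    linear_maps K (tensor K (tensor K M N) P) (tensor K (tensor K M N) P)"
    by (rule linear_maps_comp[OF bilin_right[OF dl h] tm(1)])
  show "dl h \<in> linear_maps K (tensor K (tensor K M N) P) (tensor K (tensor K M N) P)"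
    by (rule bilin_right[OF dl h])
  fix u p assume u: "u \<in> carrier (tensor K M N)" and p: "p \<in> carrier P"
  note B = pure_act_bilin[OF bMN bP, unfolded tensor_hmodule_simps, OF u p]
  show "tensor_map K (tensor K M N) P (diagonal_act K H M N \<one>\<^bsub>H\<^esub>) id (dl h (pure_tensor K (tensor K M N) P u p)) =
    dl h (pure_tensor K (tensor K M N) P u p)"
    unfolding diagonal_act_pure[OF bMN bP h, unfolded tensor_hmodule_simps, OF u p]
      sw_comp[OF module_tensor[OF MN mP] B module_tensor[OF MN mP] tm(1) h]
    using u p by (intro sw_cong[OF module_tensor[OF MN mP] B _ h])
      (simp add: tm(2) bilin_closed[OF d] act_closed[OF bP] diagonal_act_one[OF M N])
qed

private lemma tensor_map_proj_right:
  assumes h: "h \<in> carrier H" and s: "s \<in> carrier (tensor K M (tensor K N P))"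
  shows "tensor_map K M (tensor K N P) id (diagonal_act K H N P \<one>\<^bsub>H\<^esub>) (dr h s) = dr h s"
proof (rule tensor_ext[OF mM NP module_tensor[OF mM NP] _ _ _ s])
  note d = diagonal_act_bilin[OF bN bP]
  note dr = diagonal_act_bilin[OF bM bNP, unfolded tensor_hmodule_simps]
  note tm = tensor_map_linear[OF mM NP mM NP pre_homD(1)[OF pre_hom_id] bilin_right[OF d one_closed]]
  show "(\<lambda>s. tensor_map K M (tensor K N P) id (diagonal_act K H N P \<one>\<^bsub>H\<^esub>) (dr h s)) \<in>
    linear_maps K (tensor K M (tensor K N P)) (tensor K M (tensor K N P))"
    by (rule linear_maps_comp[OF bilin_right[OF dr h] tm(1)])
  show "dr h \<in> linear_maps K (tensor K M (tensor K N P)) (tensor K M (tensor K N P))"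
    by (rule bilin_right[OF dr h])
  fix m u assume m: "m \<in> carrier M" and u: "u \<in> carrier (tensor K N P)"
  note B = pure_act_bilin[OF bM bNP, unfolded tensor_hmodule_simps, OF m u]
  show "tensor_map K M (tensor K N P) id (diagonal_act K H N P \<one>\<^bsub>H\<^esub>) (dr h (pure_tensor K M (tensor K N P) m u)) =
    dr h (pure_tensor K M (tensor K N P) m u)"
    unfolding diagonal_act_pure[OF bM bNP h, unfolded tensor_hmodule_simps, OF m u]
      sw_comp[OF module_tensor[OF mM NP] B module_tensor[OF mM NP] tm(1) h]
    using u m by (intro sw_cong[OF module_tensor[OF mM NP] B _ h])
      (simp add: tm(2) bilin_closed[OF d] act_closed[OF bM] diagonal_act_one[OF N P])
qed

text \<open>The map \<open>\<sigma>\<close> induced by \<open>E\<close> on \<open>M \<diamond> N\<close> splits the projection, so no flatness is needed.\<close>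

private lemma ql_eqD:
  assumes s: "s \<in> carrier (tensor K (tensor K M N) P)" and t: "t \<in> carrier (tensor K (tensor K M N) P)"
    and eq: "ql s = ql t"
  shows "dl \<one>\<^bsub>H\<^esub> s = dl \<one>\<^bsub>H\<^esub> t"
proof -
  let ?E = "diagonal_act K H M N \<one>\<^bsub>H\<^esub>" and ?\<sigma> = "\<lambda>X. the_elem (diagonal_act K H M N \<one>\<^bsub>H\<^esub> ` X)"
  let ?\<pi> = "tensor_map K (diamond K H M N) P (diamond_proj K H M N) id"
  note idP = pre_homD(1)[OF pre_hom_id[of K H P]]
  note Q = left_moduleD(3)[OF qMN]
  note \<pi> = diamond_proj_linear[OF bM bN]
  note tm = tensor_map_linear(1)[OF MN mP Q mP \<pi> idP]
  note E = bilin_right[OF diagonal_act_bilin[OF bM bN] one_closed]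
  note bal = diagonal_act_balanced[OF left_moduleD(1)[OF M] left_moduleD(1)[OF N] one_closed]
  have \<sigma>: "?\<sigma> \<in> linear_maps K (diamond K H M N) (tensor K M N)"
    by (rule the_elem_diamond_linear[OF bM bN MN E]) (rule bal)
  have \<sigma>\<pi>: "?\<sigma> (diamond_proj K H M N u) = ?E u" if "u \<in> carrier (tensor K M N)" for u
    by (rule the_elem_diamond_proj[OF bM bN MN E _ that]) (rule bal)
  have dl_closed: "dl \<one>\<^bsub>H\<^esub> x \<in> carrier (tensor K (tensor K M N) P)" if "x \<in> carrier (tensor K (tensor K M N) P)" for x
    using bilin_closed[OF diagonal_act_bilin[OF bMN bP] one_closed] that by simp
  \<comment> \<open>Since \<open>?\<sigma>\<close> after the projection is \<open>E\<close>, the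
    composite of the two maps is \<open>E \<otimes> id\<close>, which fixes the image of the action
    of 1.\<close>
  have split: "tensor_map K (tensor K M N) P ?\<sigma> id (?\<pi> (dl \<one>\<^bsub>H\<^esub> x)) = dl \<one>\<^bsub>H\<^esub> x"
    if x: "x \<in> carrier (tensor K (tensor K M N) P)" for x
  proof -
    have "tensor_map K (tensor K M N) P ?\<sigma> id (?\<pi> (dl \<one>\<^bsub>H\<^esub> x)) =
      tensor_map K (tensor K M N) P (\<lambda>u. ?\<sigma> (diamond_proj K H M N u)) (\<lambda>p. id (id p)) (dl \<one>\<^bsub>H\<^esub> x)"
      by (rule tensor_map_comp[OF MN Q MN mP mP mP \<pi> \<sigma> idP idP dl_closed[OF x]])
    also have "\<dots> = tensor_map K (tensor K M N) P ?E id (dl \<one>\<^bsub>H\<^esub> x)"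
      unfolding tensor_map_def
      by (rule tensor_lift_cong[OF MN mP module_tensor[OF MN mP] tensor_map_linear(3)[OF MN mP MN mP E idP] _ dl_closed[OF x]])
        (simp add: \<sigma>\<pi>)
    also have "\<dots> = dl \<one>\<^bsub>H\<^esub> x" by (rule tensor_map_proj_left[OF one_closed x])
    finally show ?thesis .
  qed
  \<comment> \<open>Equality in the outer quotient is equality after acting with 1. Linearity of the
    projection over \<open>H\<close> moves this action back to
    \<open>(M \<otimes> N) \<otimes> P\<close>, where the splitting can be used.\<close>
  have nat: "?\<pi> (dl \<one>\<^bsub>H\<^esub> x) = diagonal_act K H (diamond K H M N) P \<one>\<^bsub>H\<^esub> (?\<pi> x)"
    if "x \<in> carrier (tensor K (tensor K M N) P)" for x
    using that by (intro tensor_map_diagonal[OF bMN left_moduleD(2)[OF qMN] bP bP diamond_proj_hom[OF M N] pre_hom_id]) simp_all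
  have "diagonal_act K H (diamond K H M N) P \<one>\<^bsub>H\<^esub> (?\<pi> s) = diagonal_act K H (diamond K H M N) P \<one>\<^bsub>H\<^esub> (?\<pi> t)"
    using eq diamond_proj_eq_iff[OF qMN P linear_maps_closed[OF tm s] linear_maps_closed[OF tm t]] by simp
  then have "?\<pi> (dl \<one>\<^bsub>H\<^esub> s) = ?\<pi> (dl \<one>\<^bsub>H\<^esub> t)"
    using nat[OF s] nat[OF t] by simp
  then show ?thesis
    using split[OF s] split[OF t] by metis
qed

text \<open>Projecting the hypothesis and moving the action of 1 past the projection gives equal
  values of the outer idempotent, hence equal classes.\<close>

private lemma qr_eqI:
  assumes s: "s \<in> carrier (tensor K M (tensor K N P))" and t: "t \<in> carrier (tensor K M (tensor K N P))"
    and eq: "dr \<one>\<^bsub>H\<^esub> s = dr \<one>\<^bsub>H\<^esub> t"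
  shows "qr s = qr t"
proof -
  let ?\<pi> = "tensor_map K M (diamond K H N P) id (diamond_proj K H N P)"
  note tm = tensor_map_linear(1)[OF mM NP mM left_moduleD(3)[OF qNP] pre_homD(1)[OF pre_hom_id] diamond_proj_linear[OF bN bP]]
  have nat: "?\<pi> (dr \<one>\<^bsub>H\<^esub> x) = diagonal_act K H M (diamond K H N P) \<one>\<^bsub>H\<^esub> (?\<pi> x)"
    if "x \<in> carrier (tensor K M (tensor K N P))" for x
    using that by (intro tensor_map_diagonal[OF bM bM bNP left_moduleD(2)[OF qNP] pre_hom_id diamond_proj_hom[OF N P]]) simp_all
  show ?thesis
    using nat[OF s] nat[OF t] eq
    by (simp add: diamond_proj_eq_iff[OF M qNP linear_maps_closed[OF tm s] linear_maps_closed[OF tm t]])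
qed

text \<open>Resolves the definite description. The witness is \<open>s\<close>; any other
  \<open>t\<close> with the same class has the same image under the action of 1, an equality that
  \<open>tensor_assoc_diagonal\<close> carries to the other bracketing.\<close>

lemma diamond_assoc_eq:
  assumes s: "s \<in> carrier (tensor K (tensor K M N) P)"
  shows "diamond_assoc K H M N P (ql s) = qr (\<alpha> s)"
  unfolding diamond_assoc_def
proof (rule the_equality)
  show "\<exists>t\<in>carrier (tensor K (tensor K M N) P). ql s = ql t \<and> qr (\<alpha> s) = qr (\<alpha> t)"
    using s by blast
  fix Y assume "\<exists>t\<in>carrier (tensor K (tensor K M N) P). ql s = ql t \<and> Y = qr (\<alpha> t)"
  then obtain t where t: "t \<in> carrier (tensor K (tensor K M N) P)" "ql s = ql t" "Y = qr (\<alpha> t)"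
    by blast
  have "dr \<one>\<^bsub>H\<^esub> (\<alpha> s) = dr \<one>\<^bsub>H\<^esub> (\<alpha> t)"
    using ql_eqD[OF s t(1,2)] tensor_assoc_diagonal[OF bM bN bP one_closed s]
      tensor_assoc_diagonal[OF bM bN bP one_closed t(1)] by simp
  then show "Y = qr (\<alpha> s)"
    unfolding t(3) by (intro qr_eqI \<alpha>_closed s t(1)) (rule sym)
qed

lemma odot_assoc_eq:
  assumes t: "t \<in> carrier (odot K H (odot K H M N) P)"
  shows "odot_assoc K H M N P t \<in> carrier (odot K H M (odot K H N P))"
    and "tensor_map K M (tensor K N P) id id (odot_assoc K H M N P t) =
      \<alpha> (tensor_map K (tensor K M N) P id id t)"
proof -
  let ?O = "odot K H N P" and ?E = "diagonal_act K H N P \<one>\<^bsub>H\<^esub>"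
  let ?\<iota> = "tensor_map K (tensor K M N) P id id t"
  \<comment> \<open>The candidate value: applying \<open>E\<close> to the inner product turns an
    element of \<open>M \<otimes> (N \<otimes> P)\<close> into a class over the smaller carrier of
    \<open>N \<odot> P\<close>.\<close>
  let ?s = "tensor_map K M ?O id ?E (\<alpha> ?\<iota>)"
  note O = left_moduleD(3)[OF oNP]
  note id = pre_homD(1)[OF pre_hom_id]
  note E_hom = odot_proj_hom[OF N P]
  note E = pre_homD(1)[OF E_hom, unfolded tensor_hmodule_simps]
  note E' = bilin_right[OF diagonal_act_bilin[OF bN bP] one_closed]
  note I = pre_homD(1)[OF odot_incl_hom[OF N P], unfolded tensor_hmodule_simps]
  note I' = pre_homD(1)[OF odot_incl_hom[OF M N], unfolded tensor_hmodule_simps]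
  have t': "t \<in> carrier (tensor K (odot K H M N) P)" "diagonal_act K H (odot K H M N) P \<one>\<^bsub>H\<^esub> t = t"
    using t unfolding mem_odot_iff[OF oMN P] by auto
  have \<iota>: "?\<iota> \<in> carrier (tensor K (tensor K M N) P)"
    by (rule linear_maps_closed[OF tensor_map_linear(1)[OF left_moduleD(3)[OF oMN] mP MN mP I' id] t'(1)])
  \<comment> \<open>Being fixed by 1 passes from \<open>t\<close> along the inclusion and then along
    associativity. It ensures that the inclusion sends the candidate back to
    \<open>\<alpha> ?\<iota>\<close>.\<close>
  have "dl \<one>\<^bsub>H\<^esub> ?\<iota> = ?\<iota>"
    using tensor_map_diagonal[OF left_moduleD(2)[OF oMN] bMN bP bP odot_incl_hom[OF M N] pre_hom_id one_closed t'(1)] t'(2)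
    by simp
  then have fixed: "dr \<one>\<^bsub>H\<^esub> (\<alpha> ?\<iota>) = \<alpha> ?\<iota>"
    using tensor_assoc_diagonal[OF bM bN bP one_closed \<iota>] by simp
  note c = \<alpha>_closed[OF \<iota>]
  have s: "?s \<in> carrier (tensor K M ?O)"
    by (rule linear_maps_closed[OF tensor_map_linear(1)[OF mM NP mM O id E] c])
  have "diagonal_act K H M ?O \<one>\<^bsub>H\<^esub> ?s = tensor_map K M ?O id ?E (dr \<one>\<^bsub>H\<^esub> (\<alpha> ?\<iota>))"
    using c by (intro tensor_map_diagonal[OF bM bM bNP left_moduleD(2)[OF oNP] pre_hom_id E_hom, symmetric]) simp_all
  then have s_mem: "?s \<in> carrier (odot K H M ?O)"
    using s by (simp add: mem_odot_iff[OF M oNP] fixed)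
  have "tensor_map K M (tensor K N P) id id ?s = tensor_map K M (tensor K N P) (\<lambda>x. id (id x)) (\<lambda>x. id (?E x)) (\<alpha> ?\<iota>)"
    by (rule tensor_map_comp[OF mM mM mM NP O NP id id E I c])
  also have "\<dots> = \<alpha> ?\<iota>"
    using tensor_map_proj_right[OF one_closed c, unfolded fixed] by (simp add: id_def)
  finally have s_eq: "tensor_map K M (tensor K N P) id id ?s = \<alpha> ?\<iota>" .
  \<comment> \<open>\<open>E\<close> gives a left inverse of the map induced by the inclusion. That
    map is therefore injective on the carrier in question, and the description has at most one
    solution.\<close>
  have retract: "tensor_map K M ?O id ?E (tensor_map K M (tensor K N P) id id x) = x"
    if x: "x \<in> carrier (odot K H M ?O)" for x
  proof -
    have x': "x \<in> carrier (tensor K M ?O)" using x unfolding mem_odot_iff[OF M oNP] by simp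
    have "tensor_map K M ?O id ?E (tensor_map K M (tensor K N P) id id x) =
      tensor_map K M ?O (\<lambda>x. id (id x)) (\<lambda>x. ?E (id x)) x"
      by (rule tensor_map_comp[OF mM mM mM O NP O id id I E x'])
    also have "\<dots> = x"
      by (rule tensor_map_ident[OF mM O _ _ x']) (simp_all add: mem_odot_iff[OF N P])
    finally show ?thesis .
  qed
  have "odot_assoc K H M N P t = ?s"
    unfolding odot_assoc_def
  proof (rule the_equality)
    show "?s \<in> carrier (odot K H M ?O) \<and> tensor_map K M (tensor K N P) id id ?s = \<alpha> ?\<iota>"
      using s_mem s_eq by simp
    show "x = ?s" if "x \<in> carrier (odot K H M ?O) \<and> tensor_map K M (tensor K N P) id id x = \<alpha> ?\<iota>" for x
      using that retract[of x] by simp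
  qed
  then show "odot_assoc K H M N P t \<in> carrier (odot K H M ?O)"
    "tensor_map K M (tensor K N P) id id (odot_assoc K H M N P t) = \<alpha> ?\<iota>"
    using s_mem s_eq by simp_all
qed

text \<open>Both sides are the class of \<open>\<alpha> ?\<iota>\<close>: replacing \<open>t\<close>
  or its associate by their images under the inclusions is invisible after projection, and then
  \<open>diamond_assoc_eq\<close> and \<open>odot_assoc_eq\<close> meet.\<close>

lemma gamma_assoc:
  assumes t: "t \<in> carrier (odot K H (odot K H M N) P)"
  shows "diamond_assoc K H M N P
      (gamma K H (diamond K H M N) P (odot_map K (diamond K H M N) P (gamma K H M N) id t)) =
    gamma K H M (diamond K H N P)
      (odot_map K M (diamond K H N P) id (gamma K H N P) (odot_assoc K H M N P t))"
proof -
  note id = pre_homD(1)[OF pre_hom_id]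
  let ?\<iota> = "tensor_map K (tensor K M N) P id id t" and ?s = "odot_assoc K H M N P t"
  note IMN = pre_homD(1)[OF odot_incl_hom[OF M N], unfolded tensor_hmodule_simps]
  note INP = pre_homD(1)[OF odot_incl_hom[OF N P], unfolded tensor_hmodule_simps]
  \<comment> \<open>Fresh type variables keep the equation polymorphic, as \<open>gamma\<close>
    occurs at several types in the goal.\<close>
  have \<gamma>: "gamma K H A B = diamond_proj K H A B" for A :: "('k, 'h, 'aa, 'b) hmodule_scheme" and B :: "('k, 'h, 'ab, 'd) hmodule_scheme"
    by (simp add: gamma_def fun_eq_iff)
  have t': "t \<in> carrier (tensor K (odot K H M N) P)"
    using t unfolding mem_odot_iff[OF oMN P] by simp
  have s': "?s \<in> carrier (tensor K M (odot K H N P))"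
    using odot_assoc_eq(1)[OF t] unfolding mem_odot_iff[OF M oNP] by simp
  have \<iota>: "?\<iota> \<in> carrier (tensor K (tensor K M N) P)"
    by (rule linear_maps_closed[OF tensor_map_linear(1)[OF left_moduleD(3)[OF oMN] mP MN mP IMN id] t'])
  have l: "tensor_map K (diamond K H M N) P (diamond_proj K H M N) id ?\<iota> =
    tensor_map K (diamond K H M N) P (diamond_proj K H M N) id t"
    using tensor_map_comp[OF left_moduleD(3)[OF oMN] MN left_moduleD(3)[OF qMN] mP mP mP IMN diamond_proj_linear[OF bM bN] id id t']
    by (simp add: id_def)
  have r: "tensor_map K M (diamond K H N P) id (diamond_proj K H N P) (tensor_map K M (tensor K N P) id id ?s) =
    tensor_map K M (diamond K H N P) id (diamond_proj K H N P) ?s"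
    using tensor_map_comp[OF mM mM mM left_moduleD(3)[OF oNP] NP left_moduleD(3)[OF qNP] id id INP diamond_proj_linear[OF bN bP] s']
    by (simp add: id_def)
  show ?thesis
    using diamond_assoc_eq[OF \<iota>] by (simp add: \<gamma> odot_map_def l r flip: odot_assoc_eq(2)[OF t])
qed

end

section \<open>Compatibility with the unit constraints\<close>

lemma eps_t_eps_s'_mult:
  assumes x: "x \<in> carrier H" and r: "r \<in> target_subalgebra K H"
  shows "eps_t K H (eps_s' K H r \<otimes>\<^bsub>H\<^esub> x) = eps_t K H x \<otimes>\<^bsub>H\<^esub> r"
proof -
  note r' = target_subalgebraD[OF r]
  have "eps_t K H (eps_s' K H r \<otimes>\<^bsub>H\<^esub> x) =
    sw H (\<lambda>a b. counit H (a \<otimes>\<^bsub>H\<^esub> eps_s' K H r \<otimes>\<^bsub>H\<^esub> x) \<odot>\<^bsub>H\<^esub> b) \<one>\<^bsub>H\<^esub>"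
    unfolding eps_t_def[of K H "eps_s' K H r \<otimes>\<^bsub>H\<^esub> x"] using r'(1) x
    by (intro sw_cong bilinI linear_rules) (simp_all add: m_assoc)
  \<comment> \<open>The balance identity for \<open>B(a, b) = \<epsilon>(a x) b\<close> trades
    \<open>\<epsilon>\<^sub>s'(r)\<close> on the first leg for
    \<open>r = \<epsilon>\<^sub>t(r)\<close> on the second.\<close>
  also have "\<dots> = sw H (\<lambda>a b. counit H (a \<otimes>\<^bsub>H\<^esub> x) \<odot>\<^bsub>H\<^esub> (b \<otimes>\<^bsub>H\<^esub> eps_t K H r)) \<one>\<^bsub>H\<^esub>"
    by (rule sw_eps_balanced[OF module_H eps_bilin(1)[OF x] one_closed r'(1)])
  also have "\<dots> = sw H (\<lambda>a b. (counit H (a \<otimes>\<^bsub>H\<^esub> x) \<odot>\<^bsub>H\<^esub> b) \<otimes>\<^bsub>H\<^esub> r) \<one>\<^bsub>H\<^esub>"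
    using r' x by (intro sw_cong bilinI linear_rules) (simp_all add: smult_mult_left)
  also have "\<dots> = eps_t K H x \<otimes>\<^bsub>H\<^esub> r"
    unfolding eps_t_def
    by (rule sw_comp[OF module_H eps_bilin(1)[OF x] module_H linear_mult_left[OF linear_id r'(1)] one_closed, symmetric])
  finally show ?thesis .
qed

text \<open>The balance identity read in the other direction, for
  \<open>B(a, b) = \<epsilon>(b x) a\<close>.\<close>

lemma eps_s'_mult:
  assumes x: "x \<in> carrier H" and r: "r \<in> target_subalgebra K H"
  shows "eps_s' K H (r \<otimes>\<^bsub>H\<^esub> x) = eps_s' K H x \<otimes>\<^bsub>H\<^esub> eps_s' K H r"
proof -
  note r' = target_subalgebraD[OF r]
  have "eps_s' K H (r \<otimes>\<^bsub>H\<^esub> x) = sw H (\<lambda>a b. counit H (b \<otimes>\<^bsub>H\<^esub> eps_t K H r \<otimes>\<^bsub>H\<^esub> x) \<odot>\<^bsub>H\<^esub> a) \<one>\<^bsub>H\<^esub>"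
    unfolding eps_s'_def[of K H "r \<otimes>\<^bsub>H\<^esub> x"] using r' x
    by (intro sw_cong bilinI linear_rules) (simp_all add: m_assoc)
  also have "\<dots> = sw H (\<lambda>a b. counit H (b \<otimes>\<^bsub>H\<^esub> x) \<odot>\<^bsub>H\<^esub> (a \<otimes>\<^bsub>H\<^esub> eps_s' K H r)) \<one>\<^bsub>H\<^esub>"
    by (rule sw_eps_balanced[OF module_H eps_bilin(2)[OF x] one_closed r'(1), symmetric])
  also have "\<dots> = sw H (\<lambda>a b. (counit H (b \<otimes>\<^bsub>H\<^esub> x) \<odot>\<^bsub>H\<^esub> a) \<otimes>\<^bsub>H\<^esub> eps_s' K H r) \<one>\<^bsub>H\<^esub>"
    using r' x by (intro sw_cong bilinI linear_rules) (simp_all add: smult_mult_left)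
  also have "\<dots> = eps_s' K H x \<otimes>\<^bsub>H\<^esub> eps_s' K H r"
    unfolding eps_s'_def[of K H x]
    by (rule sw_comp[OF module_H eps_bilin(2)[OF x] module_H linear_mult_left[OF linear_id eps_s'_closed[OF r'(1)]] one_closed, symmetric])
  finally show ?thesis .
qed

lemma unit_module_simps:
  "carrier (unit_module K H) = target_subalgebra K H" "add (unit_module K H) = add H"
  "smult (unit_module K H) = smult H" "act (unit_module K H) = (\<lambda>h x. eps_t K H (h \<otimes>\<^bsub>H\<^esub> x))"
  by (simp_all add: unit_module_def)

lemma linear_maps_from_unit:
  assumes f: "f \<in> linear_maps K H X"
  shows "f \<in> linear_maps K (unit_module K H) X"
  by (rule linear_mapsI)
    (simp_all add: unit_module_simps target_subalgebraD(1) linear_maps_closed[OF f] linear_maps_add[OF f]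
      linear_maps_smult[OF f])

lemma linear_maps_into_unit:
  assumes f: "f \<in> linear_maps K X H"
  shows "(\<lambda>x. eps_t K H (f x)) \<in> linear_maps K X (unit_module K H)"
proof -
  note g = linear_maps_comp[OF f eps_t_linear]
  show ?thesis
    by (rule linear_mapsI)
      (simp_all add: unit_module_simps linear_maps_add[OF g] linear_maps_smult[OF g],
        simp add: target_subalgebra_def linear_maps_closed[OF f])
qed

text \<open>A bilinear action is what the universal property of \<open>\<diamond>\<close> asks of
  its factors, so that property becomes available with the unit object as a factor.\<close>

lemma bilinear_act_unit: "bilinear_act K H (unit_module K H)"
proof -
  have "module K (unit_module K H)"
    unfolding unit_module_def module_with_act target_subalgebra_def
    by (rule submodule.submodule_is_module[OF image_submodule[OF module_H module_H eps_t_linear] module_H])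
  moreover have "bilin K H (unit_module K H) (unit_module K H) (\<lambda>h x. eps_t K H (h \<otimes>\<^bsub>H\<^esub> x))"
  proof (rule bilinI)
    show "(\<lambda>x. eps_t K H (h \<otimes>\<^bsub>H\<^esub> x)) \<in> linear_maps K (unit_module K H) (unit_module K H)"
      if "h \<in> carrier H" for h
      by (rule linear_maps_from_unit[OF linear_maps_into_unit[OF linear_mult_right[OF that linear_id]]])
    show "(\<lambda>h. eps_t K H (h \<otimes>\<^bsub>H\<^esub> x)) \<in> linear_maps K H (unit_module K H)"
      if "x \<in> carrier (unit_module K H)" for x
      using that unfolding unit_module_simps(1)
      by (intro linear_maps_into_unit linear_mult_left linear_id target_subalgebraD(1))
  qed
  ultimately show ?thesis by (simp add: bilinear_act_def unit_module_simps(4))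
qed

context
  fixes M :: "('k, 'h, 'm, 'x) hmodule_scheme"
  assumes M: "left_module K H M"
begin

lemma odot_unit_subset:
  shows "carrier (odot K H (unit_module K H) M) \<subseteq> carrier (tensor K (unit_module K H) M)"
    and "carrier (odot K H M (unit_module K H)) \<subseteq> carrier (tensor K M (unit_module K H))"
  using bilin_closed[OF diagonal_act_bilin[OF bilinear_act_unit left_moduleD(2)[OF M]] one_closed]
    bilin_closed[OF diagonal_act_bilin[OF left_moduleD(2)[OF M] bilinear_act_unit] one_closed]
  by (auto simp: odot_def)

text \<open>\<open>gamma\<close> does not change representatives, so it suffices that
  \<open>x \<otimes> m \<mapsto> x m\<close> is balanced. By \<open>eps_t_eps_s'_mult\<close>,
  \<open>\<epsilon>\<^sub>s'(r)\<close> acts on the unit object as right multiplication by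
  \<open>r\<close>.\<close>

lemma gamma_lunit:
  assumes t: "t \<in> carrier (odot K H (unit_module K H) M)"
  shows "diamond_lunit K M (gamma K H (unit_module K H) M t) = odot_lunit K M t"
proof -
  note M' = left_moduleD[OF M] and U = bilinear_actD(1)[OF bilinear_act_unit]
  have B: "bilin K (unit_module K H) M M (\<lambda>x m. act M x m)"
    by (intro bilinI linear_maps_from_unit bilin_left[OF M'(4)] bilin_right[OF M'(4)])
      (simp_all add: unit_module_simps target_subalgebraD)
  show ?thesis
    unfolding diamond_lunit_def odot_lunit_def gamma_def
  proof (rule the_elem_diamond_proj[OF bilinear_act_unit M'(2) M'(3) tensor_lift_linear[OF U M'(3) M'(3) B] _
        subsetD[OF odot_unit_subset(1) t]])
    fix r x m assume r: "r \<in> target_subalgebra K H" and x: "x \<in> carrier (unit_module K H)" and m: "m \<in> carrier M"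
    note r' = target_subalgebraD[OF r]
    have x': "x \<in> carrier H" "eps_t K H x = x" using x by (simp_all add: unit_module_simps target_subalgebraD)
    show "tensor_lift K M (\<lambda>x m. act M x m) (pure_tensor K (unit_module K H) M (act (unit_module K H) (eps_s' K H r) x) m) =
      tensor_lift K M (\<lambda>x m. act M x m) (pure_tensor K (unit_module K H) M x (act M r m))"
      using r' x x' m
      by (simp add: tensor_lift_pure[OF U M'(3) M'(3) B] act_closed[OF bilinear_act_unit] act_closed[OF M'(2)])
        (simp add: unit_module_simps eps_t_eps_s'_mult[OF x'(1) r] pre_moduleD(4)[OF M'(1)])
  qed
qed

text \<open>Balancedness of \<open>m \<otimes> x \<mapsto> \<epsilon>\<^sub>s'(x) m\<close>: the
  action of \<open>r\<close> on \<open>x\<close> is \<open>\<epsilon>\<^sub>t(r x)\<close>,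
  \<open>\<epsilon>\<^sub>s'\<close> does not see this \<open>\<epsilon>\<^sub>t\<close>, and it
  reverses the product by \<open>eps_s'_mult\<close>.\<close>

lemma gamma_runit:
  assumes t: "t \<in> carrier (odot K H M (unit_module K H))"
  shows "diamond_runit K H M (gamma K H M (unit_module K H) t) = odot_runit K H M t"
proof -
  note M' = left_moduleD[OF M] and U = bilinear_actD(1)[OF bilinear_act_unit]
  have B: "bilin K M (unit_module K H) M (\<lambda>m x. act M (eps_s' K H x) m)"
    by (intro bilinI linear_maps_from_unit linear_bilin_left[OF M'(4) eps_s'_linear] bilin_right[OF M'(4)])
      (simp_all add: unit_module_simps target_subalgebraD)
  show ?thesis
    unfolding diamond_runit_def odot_runit_def gamma_def
  proof (rule the_elem_diamond_proj[OF M'(2) bilinear_act_unit M'(3) tensor_lift_linear[OF M'(3) U M'(3) B] _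
        subsetD[OF odot_unit_subset(2) t]])
    fix r m x assume r: "r \<in> target_subalgebra K H" and m: "m \<in> carrier M" and x: "x \<in> carrier (unit_module K H)"
    note r' = target_subalgebraD[OF r]
    have x': "x \<in> carrier H" "eps_t K H x = x" using x by (simp_all add: unit_module_simps target_subalgebraD)
    show "tensor_lift K M (\<lambda>m x. act M (eps_s' K H x) m) (pure_tensor K M (unit_module K H) (act M (eps_s' K H r) m) x) =
      tensor_lift K M (\<lambda>m x. act M (eps_s' K H x) m) (pure_tensor K M (unit_module K H) m (act (unit_module K H) r x))"
      using r' x x' m
      by (simp add: tensor_lift_pure[OF M'(3) U M'(3) B] act_closed[OF bilinear_act_unit] act_closed[OF M'(2)])
        (simp add: unit_module_simps eps_eps_t eps_s'_mult[OF x'(1) r] pre_moduleD(4)[OF M'(1)])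
  qed
qed

end

end

theorem proposition5p3:
  fixes K :: "'k ring" and H :: "('k, 'h) bialg"
    and M :: "('k, 'h, 'm) hmodule" and N :: "('k, 'h, 'n) hmodule" and P :: "('k, 'h, 'p) hmodule"
    and M' :: "('k, 'h, 'm2) hmodule" and N' :: "('k, 'h, 'n2) hmodule"
  assumes "weak_bialgebra K H"
    and "left_module K H M" and "left_module K H N" and "left_module K H P"
    and "left_module K H M'" and "left_module K H N'"
  shows
    "gamma K H M N \<in> left_iso K H (odot K H M N) (diamond K H M N) \<and>
     (\<forall>f\<in>left_hom K H M M'. \<forall>g\<in>left_hom K H N N'. \<forall>t\<in>carrier (odot K H M N).
        gamma K H M' N' (odot_map K M' N' f g t)
          = diamond_map K H M' N' f g (gamma K H M N t)) \<and>
     (\<forall>t\<in>carrier (odot K H (odot K H M N) P).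
        diamond_assoc K H M N P
          (gamma K H (diamond K H M N) P (odot_map K (diamond K H M N) P (gamma K H M N) id t))
        = gamma K H M (diamond K H N P)
            (odot_map K M (diamond K H N P) id (gamma K H N P) (odot_assoc K H M N P t))) \<and>
     (\<forall>t\<in>carrier (odot K H (unit_module K H) M).
        diamond_lunit K M (gamma K H (unit_module K H) M t) = odot_lunit K M t) \<and>
     (\<forall>t\<in>carrier (odot K H M (unit_module K H)).
        diamond_runit K H M (gamma K H M (unit_module K H) t) = odot_runit K H M t)"
proof -
  interpret weak_bialgebra K H by fact
  show ?thesis
  proof (intro conjI ballI)
    show "gamma K H M N \<in> left_iso K H (odot K H M N) (diamond K H M N)"
      by (rule gamma_iso[OF assms(2,3)])
    show "gamma K H M' N' (odot_map K M' N' f g t) = diamond_map K H M' N' f g (gamma K H M N t)"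
      if "f \<in> left_hom K H M M'" "g \<in> left_hom K H N N'" "t \<in> carrier (odot K H M N)" for f g t
      using diamond_map_proj[OF assms(2,5,3,6) that(1,2)[THEN left_hom_pre_hom]] that(3)
      by (simp add: gamma_def odot_map_def mem_odot_iff[OF assms(2,3)])
  qed (simp_all add: gamma_assoc[OF assms(2-4)] gamma_lunit[OF assms(2)] gamma_runit[OF assms(2)])
qed

end
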